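(* Let $n \geq 3$ and let $u \geq 0$ be a weak solution of the obstacle problem $$\Delta u = \chi_{\{u>0\}} \quad \text{in } \mathbb{R}^n.$$ If the coincidence set $\{u=0\}$ is bounded and has nonempty interior, then $\{u=0\}$ is an ellipsoid.
   Context: $\chi_S$ denotes the characteristic function of a set $S$. A weak solution of $\Delta u = \chi_{\{u>0\}}$ on an open set $\Omega$ is a function $u \in W^{1,2}_{loc}(\Omega)$ such that $-\int_\Omega \nabla u\cdot\nabla\phi = \int_\Omega \chi_{\{u>0\}}\phi$ for all $\phi \in C^\infty_c(\Omega)$. An ellipsoid is a set of the form $\{x \in \mathbb{R}^n : x^T A x \leq 1\}$, where $A \in \mathbb{R}^{n\times n}$ is symmetric and positive definite.
   Formalization: The solution u is taken to be its continuous representative, so that {u=0} is well defined, and "is an ellipsoid" is understood up to translation, since translating u moves the coincidence set away from the origin. *)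

theory Defs
  imports "HOL-Analysis.Analysis"
begin

coinductive smooth_fun :: "(real^'n \<Rightarrow> real) \<Rightarrow> bool" where
  "\<lbrakk> \<forall>x. (f has_derivative D x) (at x);
     \<forall>i. smooth_fun (\<lambda>x. D x (axis i 1)) \<rbrakk> \<Longrightarrow> smooth_fun f"

definition tsupport :: "(real^'n \<Rightarrow> real) \<Rightarrow> (real^'n) set" where
  "tsupport f = closure {x. f x \<noteq> 0}"

definition test_fun :: "(real^'n \<Rightarrow> real) \<Rightarrow> bool" where
  "test_fun \<phi> \<longleftrightarrow> smooth_fun \<phi> \<and> compact (tsupport \<phi>)"

definition partial :: "(real^'n \<Rightarrow> real) \<Rightarrow> 'n \<Rightarrow> real^'n \<Rightarrow> real" where
  "partial \<phi> i x = frechet_derivative \<phi> (at x) (axis i 1)"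

definition L2_loc :: "(real^'n \<Rightarrow> real) \<Rightarrow> bool" where
  "L2_loc f \<longleftrightarrow> f \<in> borel_measurable lborel \<and>
     (\<forall>K. compact K \<longrightarrow> set_integrable lborel K (\<lambda>x. (f x)\<^sup>2))"

definition weak_partial :: "(real^'n \<Rightarrow> real) \<Rightarrow> 'n \<Rightarrow> (real^'n \<Rightarrow> real) \<Rightarrow> bool" where
  "weak_partial u i g \<longleftrightarrow> (\<forall>\<phi>. test_fun \<phi> \<longrightarrow>
     (\<integral>x. u x * partial \<phi> i x \<partial>lborel) = - (\<integral>x. g x * \<phi> x \<partial>lborel))"

definition weak_gradient :: "(real^'n \<Rightarrow> real) \<Rightarrow> ('n \<Rightarrow> real^'n \<Rightarrow> real) \<Rightarrow> bool" where
  "weak_gradient u G \<longleftrightarrow> L2_loc u \<and> (\<forall>i. L2_loc (G i) \<and> weak_partial u i (G i))"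

definition weak_obstacle_solution :: "(real^'n \<Rightarrow> real) \<Rightarrow> bool" where
  "weak_obstacle_solution u \<longleftrightarrow> (\<exists>G. weak_gradient u G \<and>
     (\<forall>\<phi>. test_fun \<phi> \<longrightarrow>
        - (\<integral>x. (\<Sum>i\<in>UNIV. G i x * partial \<phi> i x) \<partial>lborel)
        = (\<integral>x. indicator {y. u y > 0} x * \<phi> x \<partial>lborel)))"

definition ellipsoid :: "(real^'n) set \<Rightarrow> bool" where
  "ellipsoid E \<longleftrightarrow> (\<exists>A :: real^'n^'n. transpose A = A \<and>
     (\<forall>x. x \<noteq> 0 \<longrightarrow> x \<bullet> (A *v x) > 0) \<and> E = {x. x \<bullet> (A *v x) \<le> 1})"

end

(* Outside its zero set C the solution has Laplacian 1, so u - V has Laplacian 1 everywhere, V being the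
   Newtonian potential of C. Averages of u over large balls show that u - V is a quadratic polynomial q
   (only u >= 0 is needed), and since V > 0 tends to 0 at infinity, q is positive definite up to a
   negative constant: q = sum p_i y_i^2 - m. Minimising a convex function of the squared semi-axes yields
   an ellipsoid whose obstacle solution w has the same quadratic polynomial q. Then u - w tends to 0 at
   infinity, and the comparison principle gives u = w.

   All averages are taken with the kernels eta_r(z) = r^-n f(1 - |z|^2/r^2), where f is a derivative of
   t -> exp(-1/t); they satisfy d/dr eta_r = (r/2) Laplace(xi_r) with xi_r of the same kind, which turns
   the weak equation into a differential equation in r. *)

theory Submission
  imports Defs
begin

text \<open>The potential is obtained only as a pointwise limit and u is only continuous, so no
  second derivative of either is at hand. The Liouville step therefore uses third finite
  differences, which can be moved onto the smooth kernel; three of them beat the quadratic growth of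
  the averages. For the same reason Laplace(q) = 1 is not read off from q. The number theta = 2 sum
  p_i is left open, the ellipsoid is fitted to p_i / theta, and theta = 1 follows because u - theta
  w is bounded while the averages of u and of w grow with the same r^2 term. The convex function is
  the integral over s >= 0 of prod (t_i + s)^(-1/2), plus a linear term sum q_i t_i. The partial
  derivatives of the integral are, up to a common factor, the quadratic coefficients in the
  classical potential of an ellipsoid, so stationarity prescribes them; the scaling t -> rho t then
  adjusts the constant m. The dimension n >= 3 enters through integrability at infinity, both for
  the r-derivative of the averages with the r^2 term removed and for that product.\<close>

section \<open>Smooth bump functions\<close>

text \<open>The powers in the denominator close the family under differentiation: every derivative
  of exp(-1/t) is a linear combination of its members. In particular \<open>flat_exp 2\<close> is
  the derivative of \<open>flat_exp 0\<close>.\<close>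

definition flat_exp :: "nat \<Rightarrow> real \<Rightarrow> real" where
  "flat_exp k t = (if t \<le> 0 then 0 else exp (- 1 / t) / t ^ k)"

lemma flat_exp_nonneg [simp]: "flat_exp k t \<ge> 0"
  by (simp add: flat_exp_def)

lemma flat_exp_pos_iff: "flat_exp k t > 0 \<longleftrightarrow> t > 0"
  by (auto simp: flat_exp_def)

lemma flat_exp_eq_0 [simp]: "t \<le> 0 \<Longrightarrow> flat_exp k t = 0"
  by (simp add: flat_exp_def)

lemma flat_exp_0_le_1: "flat_exp 0 t \<le> 1"
  by (auto simp: flat_exp_def)

lemma flat_exp_has_real_derivative:
  "(flat_exp k has_real_derivative flat_exp (k + 2) t - real k * flat_exp (k + 1) t) (at t)"
proof -
  consider "t < 0" | "t = 0" | "t > 0" by linarith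
  then show ?thesis
  proof cases
    case 1
    have "((\<lambda>_. 0::real) has_real_derivative 0) (at t)" by simp
    then have "(flat_exp k has_real_derivative 0) (at t)"
      by (rule has_field_derivative_transform_within_open[where S="{..<0}"])
        (use 1 in auto)
    with 1 show ?thesis by simp
  next
    case 2
    \<comment> \<open>The substitution h = 1/x turns the right-hand difference quotient at 0 into
      x^(k+1) / exp x.\<close>
    have "((\<lambda>x::real. x ^ Suc k / exp x) \<longlongrightarrow> 0) at_top"
      by (rule tendsto_power_div_exp_0)
    then have "((\<lambda>h::real. flat_exp k (inverse h) / inverse h) \<longlongrightarrow> 0) at_top"
      by (rule Lim_transform_eventually)
        (auto intro!: eventually_mono[OF eventually_gt_at_top[of 0]]
          simp: flat_exp_def exp_minus field_simps)
    then have R: "((\<lambda>h. flat_exp k h / h) \<longlongrightarrow> 0) (at_right 0)"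
      by (subst filterlim_at_right_to_top) 
    have L: "((\<lambda>h. flat_exp k h / h) \<longlongrightarrow> 0) (at_left 0)"
      by (rule Lim_transform_eventually[OF tendsto_const])
        (auto simp: eventually_at_left_field intro!: exI[of _ "-1"])
    have "((\<lambda>h. flat_exp k h / h) \<longlongrightarrow> 0) (at 0)"
      using R L by (simp add: filterlim_at_split)
    then show ?thesis using 2 by (simp add: has_field_derivative_iff)
  next
    case 3
    have pow: "((\<lambda>t. t ^ k) has_real_derivative real k * t ^ k / t) (at t)"
      using 3 DERIV_pow[of k t] by (cases k) auto
    have E: "((\<lambda>t. exp (- 1 / t)) has_real_derivative exp (- 1 / t) / t\<^sup>2) (at t)"
      using 3 by (auto intro!: derivative_eq_intros simp: power2_eq_square)
    have "((\<lambda>t. exp (- 1 / t) / t ^ k) has_real_derivative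
        exp (- 1 / t) / t ^ (k + 2) - real k * (exp (- 1 / t) / t ^ (k + 1))) (at t)"
      by (rule DERIV_cong[OF DERIV_divide[OF E pow]])
        (use 3 in \<open>auto simp: field_simps power2_eq_square\<close>)
    then have "(flat_exp k has_real_derivative
        exp (- 1 / t) / t ^ (k + 2) - real k * (exp (- 1 / t) / t ^ (k + 1))) (at t)"
      by (rule has_field_derivative_transform_within_open[where S="{0<..}"])
        (use 3 in \<open>auto simp: flat_exp_def\<close>)
    with 3 show ?thesis by (simp add: flat_exp_def)
  qed
qed

lemma continuous_on_flat_exp [continuous_intros]:
  "continuous_on S f \<Longrightarrow> continuous_on S (\<lambda>x. flat_exp k (f x))"
proof -
  have "continuous_on UNIV (flat_exp k)"
    by (meson DERIV_isCont continuous_at_imp_continuous_on flat_exp_has_real_derivative)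
  then show "continuous_on S f \<Longrightarrow> continuous_on S (\<lambda>x. flat_exp k (f x))"
    by (rule continuous_on_compose2) auto
qed

lemma borel_measurable_flat_exp [measurable]: "flat_exp k \<in> borel_measurable borel"
  by (intro borel_measurable_continuous_onI continuous_intros)

text \<open>A class that contains the bumps and is closed under partial derivatives; it is the
  coinduction invariant for \<open>smooth_fun\<close>. The parameter \<open>r\<close> stands for the
  square of the radius.\<close>

inductive flat_poly :: "real^'n \<Rightarrow> real \<Rightarrow> (real^'n \<Rightarrow> real) \<Rightarrow> bool" for c r where
  const: "flat_poly c r (\<lambda>x. a)"
| coord: "flat_poly c r (\<lambda>x. x $ i)"
| flat: "flat_poly c r (\<lambda>x. flat_exp k (1 - (x - c) \<bullet> (x - c) / r))"
| add: "flat_poly c r f \<Longrightarrow> flat_poly c r g \<Longrightarrow> flat_poly c r (\<lambda>x. f x + g x)"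
| mult: "flat_poly c r f \<Longrightarrow> flat_poly c r g \<Longrightarrow> flat_poly c r (\<lambda>x. f x * g x)"

lemma has_derivative_flat_exp_ball:
  fixes c :: "'a::real_inner"
  shows "((\<lambda>x. flat_exp k (1 - (x - c) \<bullet> (x - c) / r)) has_derivative
    (\<lambda>v. - 2 / r * ((x - c) \<bullet> v) * (flat_exp (k + 2) (1 - (x - c) \<bullet> (x - c) / r)
       - real k * flat_exp (k + 1) (1 - (x - c) \<bullet> (x - c) / r)))) (at x)"
proof -
  have "((\<lambda>x. 1 - (x - c) \<bullet> (x - c) / r) has_derivative (\<lambda>v. - 2 / r * ((x - c) \<bullet> v))) (at x)"
    by (cases "r = 0") (auto intro!: derivative_eq_intros simp: inner_commute field_simps)
  from DERIV_compose_FDERIV[OF flat_exp_has_real_derivative this] show ?thesis .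
qed

lemma flat_poly_has_derivative:
  fixes c :: "real^'n"
  assumes "flat_poly c r f"
  shows "\<exists>D. (\<forall>x. (f has_derivative D x) (at x)) \<and> (\<forall>i. flat_poly c r (\<lambda>x. D x (axis i 1)))"
  using assms
proof induction
  case (const a)
  then show ?case
    by (intro exI[of _ "\<lambda>x v. 0"]) (auto intro: flat_poly.intros)
next
  case (coord j)
  have "((\<lambda>x::real^'n. x $ j) has_derivative (\<lambda>v. v $ j)) (at x)" for x
    by (rule bounded_linear.has_derivative[OF bounded_linear_vec_nth has_derivative_ident])
  then show ?case
    by (intro exI[of _ "\<lambda>x v. v $ j"]) (auto intro: flat_poly.const)
next
  case (flat k)
  let ?t = "\<lambda>x. 1 - (x - c) \<bullet> (x - c) / r"
  let ?D = "\<lambda>x v. - 2 / r * ((x - c) \<bullet> v) * (flat_exp (k + 2) (?t x)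
       - real k * flat_exp (k + 1) (?t x))"
  have "flat_poly c r (\<lambda>x. ?D x (axis i 1))" for i
  proof -
    have "flat_poly c r (\<lambda>x. (- 2 / r) * (x $ i + - (c $ i)) * (flat_exp (k + 2) (?t x) +
        (- real k) * flat_exp (k + 1) (?t x)))"
      by (intro flat_poly.intros)
    then show ?thesis by (simp add: inner_axis algebra_simps)
  qed
  then show ?case using has_derivative_flat_exp_ball[of k c r]
    by (intro exI[of _ ?D]) blast
next
  case (add f g)
  then obtain Df Dg where D: "\<forall>x. (f has_derivative Df x) (at x)" "\<forall>i. flat_poly c r (\<lambda>x. Df x (axis i 1))"
    "\<forall>x. (g has_derivative Dg x) (at x)" "\<forall>i. flat_poly c r (\<lambda>x. Dg x (axis i 1))" by blast
  then show ?case
    by (intro exI[of _ "\<lambda>x v. Df x v + Dg x v"]) (auto intro: flat_poly.add has_derivative_add)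
next
  case (mult f g)
  then obtain Df Dg where D: "\<forall>x. (f has_derivative Df x) (at x)" "\<forall>i. flat_poly c r (\<lambda>x. Df x (axis i 1))"
    "\<forall>x. (g has_derivative Dg x) (at x)" "\<forall>i. flat_poly c r (\<lambda>x. Dg x (axis i 1))" by blast
  then show ?case using mult.hyps
    by (intro exI[of _ "\<lambda>x v. f x * Dg x v + Df x v * g x"])
      (auto intro!: flat_poly.add flat_poly.mult has_derivative_mult)
qed

lemma smooth_fun_flat_poly: "flat_poly c r f \<Longrightarrow> smooth_fun f"
proof (coinduction arbitrary: f)
  case smooth_fun
  then show ?case using flat_poly_has_derivative[of c r f] by blast
qed

section \<open>Radial bumps, their partial derivatives and their Laplacian\<close>

definition bump :: "nat \<Rightarrow> real^'n \<Rightarrow> real \<Rightarrow> real^'n \<Rightarrow> real" where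
  "bump k c r x = flat_exp k (1 - (x - c) \<bullet> (x - c) / r\<^sup>2)"

text \<open>With f = \<open>flat_exp 0\<close>, f' = \<open>flat_exp 2\<close> and f'' =
  \<open>flat_exp 4\<close> - 2 \<open>flat_exp 3\<close>, this is the Laplacian of f(1 - |x - c|^2
  / r^2), that is, of \<open>bump 0 c r\<close>.\<close>

definition bump_lap :: "real^'n \<Rightarrow> real \<Rightarrow> real^'n \<Rightarrow> real" where
  "bump_lap c r x = (4 * bump 4 c r x - 8 * bump 3 c r x) * ((x - c) \<bullet> (x - c)) / r ^ 4
     - 2 * real CARD('n) * bump 2 c r x / r\<^sup>2"

lemma flat_poly_bump: "flat_poly c (r\<^sup>2) (bump k c r)"
  unfolding bump_def by (rule flat_poly.flat)

lemma smooth_fun_bump: "smooth_fun (bump k c r)"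
  using flat_poly_bump smooth_fun_flat_poly by blast

lemma bump_nonneg [simp]: "bump k c r x \<ge> 0"
  by (simp add: bump_def)

lemma bump_pos_iff: "r > 0 \<Longrightarrow> bump k c r x > 0 \<longleftrightarrow> x \<in> ball c r"
proof -
  assume r: "r > 0"
  have "(x - c) \<bullet> (x - c) = (dist c x)\<^sup>2"
    by (simp add: dist_norm norm_minus_commute power2_norm_eq_inner inner_diff_left inner_diff_right inner_commute)
  moreover have "(dist c x)\<^sup>2 < r\<^sup>2 \<longleftrightarrow> dist c x < r" using r
      power2_less_imp_less[of "dist c x" r] power_strict_mono[of "dist c x" r 2] by auto
  ultimately show ?thesis using r
    by (auto simp: bump_def flat_exp_pos_iff field_simps)
qed

lemma bump_eq_0_ball: "r > 0 \<Longrightarrow> x \<notin> ball c r \<Longrightarrow> bump k c r x = 0"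
  by (metis bump_nonneg bump_pos_iff order_less_le)

lemma bump_lap_eq_0: "r > 0 \<Longrightarrow> x \<notin> ball c r \<Longrightarrow> bump_lap c r x = 0"
  by (simp add: bump_lap_def bump_eq_0_ball)

lemma continuous_on_bump [continuous_intros]: "continuous_on S (bump k c r)"
  unfolding bump_def by (cases "r = 0") (auto intro!: continuous_intros)

lemma continuous_on_bump_lap [continuous_intros]: "continuous_on S (bump_lap c r)"
  unfolding bump_lap_def by (cases "r = 0") (auto intro!: continuous_intros)

lemma partial_eqI: "(f has_derivative D) (at x) \<Longrightarrow> partial f i x = D (axis i 1)"
  unfolding partial_def using frechet_derivative_at by metis

lemma has_derivative_bump:
  "(bump k c r has_derivative (\<lambda>v. - 2 / r\<^sup>2 * ((x - c) \<bullet> v) *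
     (bump (k + 2) c r x - real k * bump (k + 1) c r x))) (at x)"
  unfolding bump_def by (rule has_derivative_flat_exp_ball)

lemma partial_bump:
  fixes c :: "real^'n"
  shows "partial (bump k c r) i x =
     - 2 / r\<^sup>2 * (x $ i - c $ i) * (bump (k + 2) c r x - real k * bump (k + 1) c r x)"
  unfolding partial_eqI[OF has_derivative_bump] by (simp add: inner_axis)

lemma has_derivative_vec_nth': "((\<lambda>x::real^'n. x $ j) has_derivative (\<lambda>v. v $ j)) (at x)"
  by (rule bounded_linear.has_derivative[OF bounded_linear_vec_nth has_derivative_ident])

lemma has_derivative_partial_bump_0:
  "(partial (bump 0 c r) i has_derivative (\<lambda>v. - 2 / r\<^sup>2 * (v $ i) * bump 2 c r x
     + 4 / r ^ 4 * (x $ i - c $ i) * ((x - c) \<bullet> v) * (bump 4 c r x - 2 * bump 3 c r x))) (at x)"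
proof -
  define a where "a = 2 / r\<^sup>2"
  have a: "- 2 / r\<^sup>2 = - a" "4 / r ^ 4 = a * a" by (simp_all add: a_def)
  have eq: "partial (bump 0 c r) i = (\<lambda>x. (- a) * (x $ i - c $ i) * bump 2 c r x)"
    by (auto simp: partial_bump fun_eq_iff numeral_2_eq_2 a_def)
  define W where "W v = (x - c) \<bullet> v" for v
  have "(bump 2 c r has_derivative (\<lambda>v. - a * W v * (bump 4 c r x - 2 * bump 3 c r x))) (at x)"
    using has_derivative_bump[of 2 c r x] by (simp add: a_def W_def eval_nat_numeral)
  note this[derivative_intros]
  show ?thesis unfolding eq a W_def[symmetric]
    by (rule derivative_eq_intros has_derivative_vec_nth' refl)+
       (simp add: fun_eq_iff algebra_simps)
qed

lemma partial_partial_bump: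
  "partial (partial (bump 0 c r) i) i x = - 2 / r\<^sup>2 * bump 2 c r x
     + 4 / r ^ 4 * (x $ i - c $ i)\<^sup>2 * (bump 4 c r x - 2 * bump 3 c r x)"
  by (subst partial_eqI[OF has_derivative_partial_bump_0]) (simp add: inner_axis power2_eq_square)

lemma sum_partial_partial_bump:
  "(\<Sum>i\<in>UNIV. partial (partial (bump 0 c r) i) i x) = bump_lap c r (x::real^'n)"
proof -
  define W where "W = (x - c) \<bullet> (x - c)"
  have W: "(\<Sum>i\<in>UNIV. (x $ i - c $ i)\<^sup>2) = W"
    by (simp add: W_def inner_vec_def power2_eq_square)
  show ?thesis
    unfolding partial_partial_bump bump_lap_def W_def[symmetric] sum.distrib
      sum_distrib_right[symmetric] sum_distrib_left[symmetric] W
    by (simp add: algebra_simps add_divide_distrib diff_divide_distrib)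
qed

lemma smooth_fun_partial_bump: "smooth_fun (partial (bump k c r) i)"
proof -
  have *: "flat_poly c (r\<^sup>2) (\<lambda>x. (- 2 / r\<^sup>2) * (x $ i + - (c $ i)) * (bump (k + 2) c r x + (- real k) * bump (k + 1) c r x))"
    by (intro flat_poly.intros flat_poly_bump)
  have "partial (bump k c r) i = (\<lambda>x. (- 2 / r\<^sup>2) * (x $ i + - (c $ i)) * (bump (k + 2) c r x + (- real k) * bump (k + 1) c r x))"
    by (auto simp: partial_bump fun_eq_iff)
  with * show ?thesis using smooth_fun_flat_poly by metis
qed

lemma compact_tsupport:
  assumes "\<And>x. x \<notin> cball c r \<Longrightarrow> f x = 0"
  shows "compact (tsupport f)"
proof -
  have "tsupport f \<subseteq> cball c r" unfolding tsupport_def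
    using assms by (intro closure_minimal subsetI) (metis (mono_tags) mem_Collect_eq, simp)
  then show ?thesis unfolding tsupport_def
    by (meson bounded_cball bounded_subset closed_closure compact_eq_bounded_closed)
qed

lemma bump_eq_0: "r > 0 \<Longrightarrow> x \<notin> cball c r \<Longrightarrow> bump k c r x = 0"
  by (rule bump_eq_0_ball) auto

lemma test_fun_bump: "r > 0 \<Longrightarrow> test_fun (bump k c r)"
  unfolding test_fun_def
  by (auto intro!: smooth_fun_bump compact_tsupport[of c r] bump_eq_0 simp del: mem_cball)

lemma test_fun_partial_bump: "r > 0 \<Longrightarrow> test_fun (partial (bump k c r) i)"
  unfolding test_fun_def
  by (auto intro!: smooth_fun_partial_bump compact_tsupport[of c r] simp: partial_bump bump_eq_0 simp del: mem_cball)

section \<open>The weak equation tested against bump functions\<close>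

text \<open>The weak equation with the gradient eliminated, tested against radial bumps only. All
  later arguments start from this form, and the solution built from an ellipsoid can be verified in
  it without constructing its weak gradient.\<close>

definition obst :: "(real^'n \<Rightarrow> real) \<Rightarrow> bool" where
  "obst u \<longleftrightarrow> continuous_on UNIV u \<and> (\<forall>x. u x \<ge> 0) \<and>
    (\<forall>c r. r > 0 \<longrightarrow> (LBINT x. u x * bump_lap c r x) =
       (LBINT x. indicator {y. u y > 0} x * bump 0 c r x))"

lemma integrable_continuous_cball:
  fixes f :: "'a::euclidean_space \<Rightarrow> real"
  assumes "continuous_on UNIV f" "\<And>x. x \<notin> cball c r \<Longrightarrow> f x = 0"
  shows "integrable lborel f"
proof -
  have "integrable lborel (\<lambda>x. indicator (cball c r) x *\<^sub>R f x)"
    by (rule borel_integrable_compact) (use assms(1) continuous_on_subset in auto)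
  also have "(\<lambda>x. indicator (cball c r) x *\<^sub>R f x) = f"
    using assms(2) by (force simp: indicator_def)
  finally show ?thesis .
qed

text \<open>Dominated by g^2 + f^2 on the ball, because 2|g f| <= g^2 + f^2.\<close>

lemma integrable_L2_loc_mult:
  assumes "L2_loc g" "continuous_on UNIV f" "\<And>x. x \<notin> cball c r \<Longrightarrow> f x = 0"
  shows "integrable lborel (\<lambda>x. g x * f x)"
proof (rule Bochner_Integration.integrable_bound)
  show "integrable lborel (\<lambda>x. indicator (cball c r) x *\<^sub>R (g x)\<^sup>2 + (f x)\<^sup>2)"
  proof (rule Bochner_Integration.integrable_add)
    show "integrable lborel (\<lambda>x. indicator (cball c r) x *\<^sub>R (g x)\<^sup>2)"
      using assms(1) by (simp add: L2_loc_def set_integrable_def)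
    show "integrable lborel (\<lambda>x. (f x)\<^sup>2)"
      by (rule integrable_continuous_cball[of _ c r]) (use assms in \<open>auto intro!: continuous_intros simp del: mem_cball\<close>)
  qed
  have [measurable]: "g \<in> borel_measurable borel" using assms(1) by (simp add: L2_loc_def)
  have [measurable]: "f \<in> borel_measurable borel"
    using assms(2) by (rule borel_measurable_continuous_onI)
  show "(\<lambda>x. g x * f x) \<in> borel_measurable lborel" by measurable
  have "norm (g x * f x) \<le> norm (indicator (cball c r) x *\<^sub>R (g x)\<^sup>2 + (f x)\<^sup>2)" for x
  proof (cases "x \<in> cball c r")
    case True
    have "2 * \<bar>g x * f x\<bar> \<le> (g x)\<^sup>2 + (f x)\<^sup>2"
      using sum_squares_bound[of "\<bar>g x\<bar>" "\<bar>f x\<bar>"] by (simp add: abs_mult)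
    then have "\<bar>g x * f x\<bar> \<le> (g x)\<^sup>2 + (f x)\<^sup>2"
      using abs_ge_zero[of "g x * f x"] by linarith
    with True show ?thesis by simp
  qed (simp add: assms(3) del: mem_cball)
  then show "AE x in lborel. norm (g x * f x) \<le> norm (indicator (cball c r) x *\<^sub>R (g x)\<^sup>2 + (f x)\<^sup>2)"
    by simp
qed

lemma continuous_on_partial_bump: "continuous_on S (partial (bump k c r) i)"
  unfolding partial_bump[abs_def] by (cases "r = 0") (auto intro!: continuous_intros)

lemma continuous_on_partial_partial_bump: "continuous_on S (partial (partial (bump 0 c r) i) i)"
  unfolding ext[of "partial (partial (bump 0 c r) i) i", OF partial_partial_bump]
  by (cases "r = 0") (auto intro!: continuous_intros)

text \<open>The partial derivatives of a bump are test functions themselves, so the definition of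
  the weak gradient can be applied to them; this puts both derivatives on the bump.\<close>

lemma weak_obstacle_solution_imp_obst:
  fixes u :: "real^'n \<Rightarrow> real"
  assumes u: "continuous_on UNIV u" "\<forall>x. u x \<ge> 0" "weak_obstacle_solution u"
  shows "obst u"
  unfolding obst_def
proof (intro conjI allI impI u(1) u(2)[rule_format])
  fix c :: "real^'n" and r :: real
  assume r: "r > 0"
  obtain G where G: "weak_gradient u G"
    and eq: "\<And>\<phi>. test_fun \<phi> \<Longrightarrow> - (LBINT x. (\<Sum>i\<in>UNIV. G i x * partial \<phi> i x))
        = (LBINT x. indicator {y. u y > 0} x * \<phi> x)"
    using u(3) unfolding weak_obstacle_solution_def by blast
  let ?\<phi> = "bump 0 c r"
  have z: "x \<notin> cball c r \<Longrightarrow> bump k c r x = 0" for x k using bump_eq_0 r by blast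
  have "(LBINT x. u x * bump_lap c r x) =
      (LBINT x. (\<Sum>i\<in>UNIV. u x * partial (partial ?\<phi> i) i x))"
    by (simp add: sum_partial_partial_bump flip: sum_distrib_left)
  also have "\<dots> = (\<Sum>i\<in>UNIV. LBINT x. u x * partial (partial ?\<phi> i) i x)"
  proof (rule Bochner_Integration.integral_sum)
    fix i :: 'n
    show "integrable lborel (\<lambda>x. u x * partial (partial ?\<phi> i) i x)"
      by (rule integrable_continuous_cball[of _ c r])
        (use z r in \<open>auto intro!: continuous_intros u(1) continuous_on_partial_partial_bump
           simp: partial_partial_bump simp del: mem_cball\<close>)
  qed
  also have "\<dots> = (\<Sum>i\<in>UNIV. - (LBINT x. G i x * partial ?\<phi> i x))"
  proof (intro sum.cong refl)
    fix i :: 'n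
    have "weak_partial u i (G i)" using G by (simp add: weak_gradient_def)
    then show "(LBINT x. u x * partial (partial ?\<phi> i) i x) = - (LBINT x. G i x * partial ?\<phi> i x)"
      unfolding weak_partial_def using test_fun_partial_bump[OF r, of 0 c i] by blast
  qed
  also have "\<dots> = - (\<Sum>i\<in>UNIV. LBINT x. G i x * partial ?\<phi> i x)"
    by (simp add: sum_negf)
  also have "(\<Sum>i\<in>UNIV. LBINT x. G i x * partial ?\<phi> i x)
      = (LBINT x. (\<Sum>i\<in>UNIV. G i x * partial ?\<phi> i x))"
  proof (rule Bochner_Integration.integral_sum[symmetric])
    fix i :: 'n
    show "integrable lborel (\<lambda>x. G i x * partial ?\<phi> i x)"
    proof (rule integrable_L2_loc_mult)
      show "L2_loc (G i)" using G by (simp add: weak_gradient_def)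
      show "partial ?\<phi> i x = 0" if "x \<notin> cball c r" for x
        by (simp add: partial_bump z[OF that])
    qed (rule continuous_on_partial_bump)
  qed
  also have "- \<dots> = (LBINT x. indicator {y. u y > 0} x * ?\<phi> x)"
    by (rule eq[OF test_fun_bump[OF r]])
  finally show "(LBINT x. u x * bump_lap c r x) =
     (LBINT x. indicator {y. u y > 0} x * ?\<phi> x)" .
qed

section \<open>Averages against bump functions\<close>

lemma integral_affine_euclidean:
  fixes f :: "'a::euclidean_space \<Rightarrow> real"
  assumes c: "c > 0" and f: "f \<in> borel_measurable borel"
  shows "(LBINT x. f (t + c *\<^sub>R x)) = (LBINT x. f x) / c ^ DIM('a)"
proof -
  have m: "f \<in> borel_measurable (distr lborel borel (\<lambda>x. t + c *\<^sub>R x))" using f by simp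
  have "(LBINT x. f x) = (\<integral>x. f x \<partial>density (distr lborel borel (\<lambda>x. t + c *\<^sub>R x)) (\<lambda>_. ennreal (\<bar>c\<bar> ^ DIM('a))))"
    using lborel_affine[of c t] c by simp
  also have "\<dots> = (\<integral>x. c ^ DIM('a) *\<^sub>R f x \<partial>distr lborel borel (\<lambda>x. t + c *\<^sub>R x))"
    using c m by (subst integral_density) auto
  also have "\<dots> = c ^ DIM('a) * (LBINT x. f (t + c *\<^sub>R x))"
    using f by (subst integral_distr) auto
  finally show ?thesis using c by simp
qed

text \<open>The total weight is \<open>bmass k\<close> instead of 1. Index 2 is used for solutions
  and index 0 for indicators of sets, the pairing dictated by
  \<open>has_real_derivative_bump_radius\<close>.\<close>

definition bavg :: "nat \<Rightarrow> (real^'n \<Rightarrow> real) \<Rightarrow> real \<Rightarrow> real^'n \<Rightarrow> real" where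
  "bavg k u r c = (LBINT x. u x * bump k c r x) / r ^ CARD('n)"

definition bmass :: "'n::finite itself \<Rightarrow> nat \<Rightarrow> real" where
  "bmass _ k = (LBINT x. bump k (0::real^'n) 1 x)"

lemma bump_affine: "r > 0 \<Longrightarrow> bump k c r (c + r *\<^sub>R z) = bump k 0 1 z"
  by (simp add: bump_def power2_eq_square)

lemma borel_measurable_bump [measurable]: "bump k c r \<in> borel_measurable borel"
  by (intro borel_measurable_continuous_onI continuous_intros)

lemma bavg_affine:
  fixes u :: "real^'n \<Rightarrow> real"
  assumes "r > 0" "u \<in> borel_measurable borel"
  shows "bavg k u r c = (LBINT z. u (c + r *\<^sub>R z) * bump k 0 1 z)"
proof -
  have "(\<lambda>x. u x * bump k c r x) \<in> borel_measurable borel" using assms(2) by measurable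
  from integral_affine_euclidean[OF assms(1) this, of c]
  show ?thesis using assms(1) by (simp add: bavg_def bump_affine)
qed

lemma integrable_bump: "r > 0 \<Longrightarrow> integrable lborel (bump k c r)"
  by (rule integrable_continuous_cball[of _ c r]) (auto intro!: continuous_intros bump_eq_0 simp del: mem_cball)

lemma bavg_const:
  "r > 0 \<Longrightarrow> bavg k (\<lambda>x. a) r (c::real^'n) = a * bmass TYPE('n) k"
  by (subst bavg_affine) (auto simp: bmass_def)

lemma continuous_nonneg_integral_eq_0:
  fixes f :: "'a::euclidean_space \<Rightarrow> real"
  assumes "continuous_on UNIV f" "\<And>x. f x \<ge> 0" "integrable lborel f" "(LBINT x. f x) = 0"
  shows "f x = 0"
proof (rule ccontr)
  assume "f x \<noteq> 0"
  then have pos: "f x > 0" using assms(2)[of x] by linarith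
  have "AE x in lborel. f x = 0"
    using integral_nonneg_eq_0_iff_AE[OF assms(3)] assms(2,4) by simp
  moreover have op: "open {x. f x \<noteq> 0}"
    using open_Collect_neq[OF assms(1) continuous_on_const] by simp
  ultimately have "emeasure lborel {x. f x \<noteq> 0} = 0"
    by (subst (asm) AE_iff_measurable[OF _ refl]) auto
  then have "{x. f x \<noteq> 0} \<in> null_sets lborel" using op by (intro null_setsI) auto
  then have "negligible {x. f x \<noteq> 0}"
    unfolding negligible_iff_null_sets by (rule null_sets_completionI)
  with op have "{x. f x \<noteq> 0} = {}" using open_not_negligible by blast
  then show False using pos by auto
qed

lemma bmass_pos: "bmass TYPE('n::finite) k > 0"
proof -
  have "bmass TYPE('n) k \<noteq> 0"
  proof
    assume "bmass TYPE('n) k = 0"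
    then have "bump k (0::real^'n) 1 0 = 0"
      by (intro continuous_nonneg_integral_eq_0[where f="bump k (0::real^'n) 1"])
        (auto simp: bmass_def integrable_bump continuous_on_bump)
    moreover have "bump k (0::real^'n) 1 0 > 0" by (subst bump_pos_iff) auto
    ultimately show False by simp
  qed
  moreover have "bmass TYPE('n) k \<ge> 0"
    unfolding bmass_def by (intro Bochner_Integration.integral_nonneg) auto
  ultimately show ?thesis by linarith
qed

text \<open>With f = \<open>flat_exp 0\<close> and W = |x - c|^2, both sides equal r^-n (2 W f'' /
  r^3 - n f' / r), taken at 1 - W / r^2. The derivative f' = \<open>flat_exp 2\<close> has to be the
  kernel on the left for this to work.\<close>

lemma has_real_derivative_bump_radius:
  assumes "r > 0"
  shows "((\<lambda>r. bump 2 c r x / r ^ CARD('n)) has_real_derivative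
     r / 2 * bump_lap c r (x::real^'n) / r ^ CARD('n)) (at r)"
proof -
  define W where "W = (x - c) \<bullet> (x - c)"
  define N where "N = CARD('n)"
  have "((\<lambda>r. 1 - W / r\<^sup>2) has_real_derivative 2 * W / r ^ 3) (at r)"
    using assms by (auto intro!: derivative_eq_intros simp: field_simps eval_nat_numeral)
  from DERIV_chain2[OF flat_exp_has_real_derivative[of 2] this]
  have 1: "((\<lambda>r. bump 2 c r x) has_real_derivative (bump 4 c r x - 2 * bump 3 c r x) * (2 * W / r ^ 3)) (at r)"
    unfolding bump_def W_def by (simp add: eval_nat_numeral)
  have 2: "((\<lambda>r. r ^ N) has_real_derivative real N * r ^ N / r) (at r)"
    using assms DERIV_pow[of N r] by (cases N) auto
  have e: "(b * (2 * W / r ^ 3) * r ^ N - d * (real N * r ^ N / r)) / (r ^ N * r ^ N)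
      = r / 2 * (4 * b * W / r ^ 4 - 2 * real N * d / r\<^sup>2) / r ^ N" for b d
    using assms by (simp add: field_simps eval_nat_numeral)
  have "((\<lambda>r. bump 2 c r x / r ^ N) has_real_derivative
     r / 2 * (4 * (bump 4 c r x - 2 * bump 3 c r x) * W / r ^ 4 - 2 * real N * bump 2 c r x / r\<^sup>2) / r ^ N) (at r)"
    using DERIV_divide[OF 1 2] assms unfolding e by simp
  then show ?thesis unfolding bump_lap_def W_def N_def by (simp add: algebra_simps)
qed

lemma continuous_on_bump_lap_radius:
  "continuous_on ({0<..} \<times> UNIV) (\<lambda>(r, x). bump_lap c r (x::real^'n))"
  unfolding bump_lap_def bump_def split_beta by (auto intro!: continuous_intros)

lemma cball_subset_cbox:
  obtains a b :: "'a::euclidean_space" where "cball c r \<subseteq> cbox a b"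
  using bounded_subset_cbox_symmetric[OF bounded_cball[of c r]] by metis

lemma lborel_integral_eq_integral_cbox:
  fixes f :: "'a::euclidean_space \<Rightarrow> real"
  assumes "continuous_on UNIV f" "\<And>x. x \<notin> cball c r \<Longrightarrow> f x = 0" "cball c r \<subseteq> cbox a b"
  shows "(LBINT x. f x) = integral (cbox a b) f"
proof -
  have "(f has_integral (LBINT x. f x)) UNIV"
    using integrable_continuous_cball[OF assms(1,2)] has_integral_integral_lborel by blast
  moreover have "(\<lambda>x. if x \<in> cbox a b then f x else 0) = f"
    using assms(2,3) by (force simp: fun_eq_iff simp del: mem_cball)
  ultimately have "(f has_integral (LBINT x. f x)) (cbox a b)"
    using has_integral_restrict_UNIV[of "cbox a b" f] by simp
  then show ?thesis by (simp add: integral_unique)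
qed

lemma bavg_has_real_derivative:
  fixes u :: "real^'n \<Rightarrow> real"
  assumes u: "continuous_on UNIV u" and r: "r > 0"
  shows "((\<lambda>r. bavg 2 u r c) has_real_derivative
     r / 2 * (LBINT x. u x * bump_lap c r x) / r ^ CARD('n)) (at r)"
proof -
  obtain a b where ab: "cball c (2 * r) \<subseteq> cbox a b" using cball_subset_cbox .
  have uS: "continuous_on S u" for S using u continuous_on_subset by blast
  \<comment> \<open>For radii in \<open>U\<close> all supports lie in one fixed box and the radius
    stays away from 0, as differentiation under the integral requires.\<close>
  define U where "U = {r / 2 <..< 2 * r}"
  have z: "x \<notin> cball c (2 * r) \<Longrightarrow> s \<in> U \<Longrightarrow> bump k c s x = 0 \<and> bump_lap c s x = 0" for x k s
    using bump_eq_0_ball[of s x c k] bump_lap_eq_0[of s x c] r by (auto simp: U_def)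
  have "((\<lambda>s. integral (cbox a b) (\<lambda>x. u x * (bump 2 c s x / s ^ CARD('n)))) has_field_derivative
     integral (cbox a b) (\<lambda>x. u x * (r / 2 * bump_lap c r x / r ^ CARD('n)))) (at r within U)"
  proof (rule leibniz_rule_field_derivative)
    show "convex U" "r \<in> U" using r by (auto simp: U_def)
    fix s assume s: "s \<in> U"
    then have s0: "s > 0" using r by (auto simp: U_def)
    show "(\<lambda>x. u x * (bump 2 c s x / s ^ CARD('n))) integrable_on cbox a b"
      using s0 by (intro integrable_continuous continuous_intros uS) auto
    fix x
    show "((\<lambda>s. u x * (bump 2 c s x / s ^ CARD('n))) has_real_derivative
        u x * (s / 2 * bump_lap c s x / s ^ CARD('n))) (at s within U)"
      by (rule DERIV_cmult[OF has_field_derivative_at_within[OF has_real_derivative_bump_radius[OF s0]]])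
  next
    have "continuous_on (U \<times> cbox a b) (\<lambda>(s, x). bump_lap c s x)"
      by (rule continuous_on_subset[OF continuous_on_bump_lap_radius]) (use r in \<open>auto simp: U_def\<close>)
    then have *: "continuous_on (U \<times> cbox a b) (\<lambda>z. bump_lap c (fst z) (snd z))"
      by (simp add: split_beta)
    have **: "continuous_on (U \<times> cbox a b) (\<lambda>z. u (snd z))"
      by (rule continuous_on_compose2[OF u]) (auto intro!: continuous_intros)
    show "continuous_on (U \<times> cbox a b) (\<lambda>(s, x). u x * (s / 2 * bump_lap c s x / s ^ CARD('n)))"
      unfolding split_beta using r
      by (intro continuous_on_mult continuous_on_divide continuous_on_power continuous_on_fst
          continuous_on_id continuous_on_const * **) (auto simp: U_def)
  qed
  moreover have "at r within U = at r"
    by (rule at_within_open) (use r in \<open>auto simp: U_def\<close>)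
  moreover have eq: "integral (cbox a b) (\<lambda>x. u x * (bump 2 c s x / s ^ CARD('n))) = bavg 2 u s c"
    if "s \<in> U" for s
  proof -
    have "s > 0" using that r by (auto simp: U_def)
    have "(LBINT x. u x * (bump 2 c s x / s ^ CARD('n))) = integral (cbox a b) (\<lambda>x. u x * (bump 2 c s x / s ^ CARD('n)))"
    proof (rule lborel_integral_eq_integral_cbox[OF _ _ ab])
      show "continuous_on UNIV (\<lambda>x. u x * (bump 2 c s x / s ^ CARD('n)))"
        using \<open>s > 0\<close> by (intro continuous_intros u) simp
    qed (simp add: z[OF _ that] del: mem_cball)
    then show ?thesis using \<open>s > 0\<close> unfolding bavg_def by auto
  qed
  moreover have "integral (cbox a b) (\<lambda>x. u x * (r / 2 * bump_lap c r x / r ^ CARD('n)))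
     = r / 2 * (LBINT x. u x * bump_lap c r x) / r ^ CARD('n)"
  proof -
    have "r \<in> U" using r by (auto simp: U_def)
    have "(LBINT x. u x * (r / 2 * bump_lap c r x / r ^ CARD('n)))
       = integral (cbox a b) (\<lambda>x. u x * (r / 2 * bump_lap c r x / r ^ CARD('n)))"
    proof (rule lborel_integral_eq_integral_cbox[OF _ _ ab])
      show "continuous_on UNIV (\<lambda>x. u x * (r / 2 * bump_lap c r x / r ^ CARD('n)))"
        using r by (intro continuous_intros u) simp
    qed (simp add: z[OF _ \<open>r \<in> U\<close>] del: mem_cball)
    moreover have "u x * (r / 2 * bump_lap c r x / r ^ CARD('n)) = (r / 2 / r ^ CARD('n)) * (u x * bump_lap c r x)" for x
      by simp
    ultimately show ?thesis
      by (metis (no_types, lifting) Bochner_Integration.integral_cong integral_mult_right_zero times_divide_eq_left)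
  qed
  ultimately have D: "((\<lambda>s. integral (cbox a b) (\<lambda>x. u x * (bump 2 c s x / s ^ CARD('n)))) has_field_derivative
     r / 2 * (LBINT x. u x * bump_lap c r x) / r ^ CARD('n)) (at r)" by metis
  show ?thesis
  proof (rule has_field_derivative_transform_within_open[OF D, of U])
    show "open U" "r \<in> U" using r by (auto simp: U_def)
  qed (rule eq)
qed

lemma bavg_tendsto:
  fixes u :: "real^'n \<Rightarrow> real"
  assumes u: "continuous_on UNIV u"
  shows "((\<lambda>r. bavg 2 u r c) \<longlongrightarrow> u c * bmass TYPE('n) 2) (at_right 0)"
proof (rule tendstoI)
  fix e :: real assume e: "e > 0"
  define m where "m = bmass TYPE('n) 2"
  have m: "m > 0" unfolding m_def by (rule bmass_pos)
  have [measurable]: "u \<in> borel_measurable borel" using u by (rule borel_measurable_continuous_onI)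
  obtain d where d: "d > 0" "\<And>x. dist x c < d \<Longrightarrow> dist (u x) (u c) < e / (2 * m)"
  proof -
    have "e / (2 * m) > 0" using e m by simp
    with u that show thesis unfolding continuous_on_iff by blast
  qed
  have "dist (bavg 2 u r c) (u c * m) < e" if r: "0 < r" "r < d" for r
  proof -
    have "continuous_on UNIV (\<lambda>z. u (c + r *\<^sub>R z))"
      by (rule continuous_on_compose2[OF u]) (auto intro!: continuous_intros)
    then have int: "integrable lborel (\<lambda>z. u (c + r *\<^sub>R z) * bump 2 0 1 z)"
      by (intro integrable_continuous_cball[of _ 0 1] continuous_on_mult continuous_on_bump)
        (auto intro!: bump_eq_0 simp del: mem_cball)
    have "bavg 2 u r c - u c * m = (LBINT z. (u (c + r *\<^sub>R z) * bump 2 0 1 z - u c * bump 2 0 1 z))"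
      by (subst Bochner_Integration.integral_diff)
        (use int integrable_bump[of 1 2 "0::real^'n"] in \<open>simp_all add: bavg_affine[OF r(1)] m_def bmass_def\<close>)
    also have "norm \<dots> \<le> (\<integral>z. e / (2 * m) * bump 2 0 1 z \<partial>(lborel :: (real^'n) measure))"
    proof (rule Bochner_Integration.integral_norm_bound_integral)
      show "integrable lborel (\<lambda>z. u (c + r *\<^sub>R z) * bump 2 0 1 z - u c * bump 2 0 1 z)"
        using int integrable_bump[of 1 2 "0::real^'n"] by simp
      show "integrable lborel (\<lambda>z. e / (2 * m) * bump 2 (0::real^'n) 1 z)" using integrable_bump[of 1 2 "0::real^'n"] by simp
      fix z :: "real^'n"
      show "norm (u (c + r *\<^sub>R z) * bump 2 0 1 z - u c * bump 2 0 1 z) \<le> e / (2 * m) * bump 2 0 1 z"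
      proof (cases "z \<in> ball 0 1")
        case True
        then have "r * norm z \<le> r * 1" using r by (intro mult_left_mono) auto
        then have "r * norm z < d" using r by linarith
        then have "dist (u (c + r *\<^sub>R z)) (u c) < e / (2 * m)" using r by (intro d) (simp add: dist_norm)
        then show ?thesis
          unfolding left_diff_distrib[symmetric] dist_norm norm_mult
          by (intro mult_mono) auto
      next
        case False
        then show ?thesis by (simp add: bump_eq_0_ball)
      qed
    qed
    also have "\<dots> = e / 2" using m by (simp add: m_def bmass_def)
    finally show ?thesis using e by (simp add: dist_norm)
  qed
  then show "\<forall>\<^sub>F r in at_right 0. dist (bavg 2 u r c) (u c * bmass TYPE('n) 2) < e"
    unfolding m_def[symmetric] eventually_at_right_field using d(1) by blast
qed

section \<open>The potential of the zero set\<close>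

lemma obst_continuous: "obst u \<Longrightarrow> continuous_on UNIV u"
  and obst_nonneg: "obst u \<Longrightarrow> u x \<ge> 0"
  by (auto simp: obst_def)

lemma obst_measurable: "obst u \<Longrightarrow> u \<in> borel_measurable borel"
  by (rule borel_measurable_continuous_onI[OF obst_continuous])

lemma obst_bavg_has_real_derivative:
  fixes u :: "real^'n \<Rightarrow> real"
  assumes "obst u" "r > 0"
  shows "((\<lambda>r. bavg 2 u r c) has_real_derivative r / 2 * bavg 0 (indicator {y. u y > 0}) r c) (at r)"
proof -
  have "(LBINT x. u x * bump_lap c r x) = (LBINT x. indicator {y. u y > 0} x * bump 0 c r x)"
    using assms by (auto simp: obst_def)
  with bavg_has_real_derivative[OF obst_continuous[OF assms(1)] assms(2), of c]
  show ?thesis by (simp add: bavg_def)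
qed

section \<open>Averages of indicator functions\<close>

lemma integrable_indicator_bump:
  assumes "r > 0" "S \<in> sets borel"
  shows "integrable lborel (\<lambda>x. indicator S x * bump k c r x)"
proof (rule Bochner_Integration.integrable_bound[OF integrable_bump[OF assms(1)]])
  show "AE x in lborel. norm (indicator S x * bump k c r x) \<le> norm (bump k c r x)"
    by (auto simp: indicator_def)
qed (use assms in simp)

lemma bavg_indicator_nonneg: "r > 0 \<Longrightarrow> bavg k (indicator S) r c \<ge> 0"
  unfolding bavg_def by (intro divide_nonneg_pos Bochner_Integration.integral_nonneg) auto

lemma bavg_indicator_mono:
  assumes "r > 0" "S \<in> sets borel" "T \<in> sets borel"
    and "\<And>x. x \<in> ball c r \<Longrightarrow> x \<in> S \<Longrightarrow> x \<in> T"
  shows "bavg k (indicator S) r c \<le> bavg k (indicator T) r c"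
  unfolding bavg_def
proof (rule divide_right_mono[OF integral_mono])
  fix x show "indicator S x * bump k c r x \<le> indicator T x * bump k c r x"
    using assms(4)[of x] bump_eq_0_ball[of r x c k] assms(1) by (cases "x \<in> ball c r") (auto simp: indicator_def)
qed (use assms integrable_indicator_bump in auto)

lemma bavg_indicator_Compl:
  assumes "r > 0" "S \<in> sets borel"
  shows "bavg k (indicator S) r (c::real^'n) + bavg k (indicator (- S)) r c = bmass TYPE('n) k"
proof -
  have "bmass TYPE('n) k = bavg k (\<lambda>x. 1) r c" using bavg_const[OF assms(1), of k 1 c] by simp
  also have "\<dots> = (LBINT x. indicator S x * bump k c r x + indicator (- S) x * bump k c r x) / r ^ CARD('n)"
    unfolding bavg_def by (auto intro!: arg_cong2[where f="(/)"] Bochner_Integration.integral_cong simp: indicator_def)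
  also have "\<dots> = bavg k (indicator S) r c + bavg k (indicator (- S)) r c"
    unfolding bavg_def using assms
    by (subst Bochner_Integration.integral_add) (auto intro!: integrable_indicator_bump simp: add_divide_distrib)
  finally show ?thesis by simp
qed

lemma bavg_indicator_le_mass:
  assumes "r > 0" "S \<in> sets borel"
  shows "bavg k (indicator S) r (c::real^'n) \<le> bmass TYPE('n) k"
  using bavg_indicator_Compl[OF assms, of k c] bavg_indicator_nonneg[OF assms(1), of k "- S" c] by linarith

lemma bavg_indicator_le_measure:
  fixes c :: "real^'n"
  assumes "r > 0" "S \<in> sets borel" "bounded S"
  shows "bavg 0 (indicator S) r c \<le> measure lborel S / r ^ CARD('n)"
proof -
  have fin: "emeasure lborel S < \<infinity>" using assms(3) emeasure_bounded_finite by blast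
  have "(LBINT x. indicator S x * bump 0 c r x) \<le> (LBINT x. indicator S x)"
  proof (rule integral_mono)
    show "integrable lborel (indicator S :: _ \<Rightarrow> real)" using assms fin by simp
    show "indicator S x * bump 0 c r x \<le> indicator S x" for x
      by (auto simp: indicator_def bump_def flat_exp_0_le_1)
  qed (use assms integrable_indicator_bump in auto)
  also have "\<dots> = measure lborel S" using assms fin by simp
  finally show ?thesis using assms(1) unfolding bavg_def by (simp add: divide_right_mono)
qed

text \<open>If the Laplacian of u were 1 everywhere, the average would equal the first two terms;
  the deficit is what the zero set takes away. Its r-derivative is r/2 times the average of the
  indicator of the zero set, so it increases from its limit 0 at r = 0.\<close>

definition deficit :: "(real^'n \<Rightarrow> real) \<Rightarrow> real \<Rightarrow> real^'n \<Rightarrow> real" where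
  "deficit u r c = bmass TYPE('n) 2 * u c + bmass TYPE('n) 0 * r\<^sup>2 / 4 - bavg 2 u r c"

lemma closed_zero_set: "continuous_on UNIV u \<Longrightarrow> closed {x. u x = (0::real)}"
  using closed_Collect_eq[of u "\<lambda>_. 0"] by simp

lemma deficit_has_real_derivative:
  fixes u :: "real^'n \<Rightarrow> real"
  assumes u: "obst u" and r: "r > 0"
  shows "((\<lambda>r. deficit u r c) has_real_derivative r / 2 * bavg 0 (indicator {y. u y = 0}) r c) (at r)"
proof -
  have "{y. u y = 0} \<in> sets borel"
    by (rule borel_closed[OF closed_zero_set[OF obst_continuous[OF u]]])
  moreover have "- {y. u y = 0} = {y. u y > 0}" using obst_nonneg[OF u] by (auto simp: order_less_le)
  ultimately have "bavg 0 (indicator {y. u y > 0}) r c = bmass TYPE('n) 0 - bavg 0 (indicator {y. u y = 0}) r c"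
    using bavg_indicator_Compl[OF r, of "{y. u y = 0}" 0 c] by simp
  note * = obst_bavg_has_real_derivative[OF u r, of c, unfolded this]
  show ?thesis unfolding deficit_def
    by (rule derivative_eq_intros * refl | use r in \<open>simp add: algebra_simps\<close>)+
qed

lemma deficit_tendsto_0:
  fixes u :: "real^'n \<Rightarrow> real"
  assumes u: "obst u"
  shows "((\<lambda>r. deficit u r c) \<longlongrightarrow> 0) (at_right 0)"
proof -
  have "((\<lambda>r. deficit u r c) \<longlongrightarrow> bmass TYPE('n) 2 * u c + bmass TYPE('n) 0 * 0\<^sup>2 / 4 - u c * bmass TYPE('n) 2) (at_right 0)"
    unfolding deficit_def by (intro tendsto_intros bavg_tendsto obst_continuous[OF u]) auto
  then show ?thesis by (simp add: mult.commute)
qed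

lemma deficit_mono:
  assumes u: "obst u" and "0 < r" "r \<le> s"
  shows "deficit u r c \<le> deficit u s c"
proof (rule DERIV_nonneg_imp_nondecreasing[OF assms(3)])
  fix t assume "r \<le> t" "t \<le> s"
  then have "t > 0" using assms(2) by simp
  with deficit_has_real_derivative[OF u this, of c] bavg_indicator_nonneg[OF this]
  show "\<exists>y. ((\<lambda>s. deficit u s c) has_real_derivative y) (at t) \<and> y \<ge> 0"
    by (meson divide_nonneg_pos less_eq_real_def mult_nonneg_nonneg zero_less_numeral)
qed

lemma deficit_nonneg:
  assumes u: "obst u" and "0 < r"
  shows "deficit u r c \<ge> 0"
proof (rule tendsto_upperbound[OF deficit_tendsto_0[OF u, of c]])
  show "\<forall>\<^sub>F s in at_right 0. deficit u s c \<le> deficit u r c"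
    unfolding eventually_at_right_field using deficit_mono[OF u] assms(2)
    by (intro exI[of _ r]) auto
qed simp

text \<open>The derivative vanishes at all radii below r, so the deficit is constant there. The
  limit at 0 identifies the constant, and continuity transfers it to r itself.\<close>

lemma deficit_eq_0:
  assumes u: "obst u" and r: "0 < r" and "ball c r \<inter> {y. u y = 0} = {}"
  shows "deficit u r c = 0"
proof -
  have "((\<lambda>s. deficit u s c) has_real_derivative 0) (at t)" if t: "t \<in> {0<..<r}" for t
  proof -
    have "ball c t \<subseteq> ball c r" using t by auto
    then have "bavg 0 (indicator {y. u y = 0}) t c \<le> bavg 0 (indicator {}) t c"
      using assms t closed_zero_set[OF obst_continuous[OF u]]
      by (intro bavg_indicator_mono) auto
    moreover have "bavg 0 (indicator {}) t c = 0" by (simp add: bavg_def)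
    moreover have "bavg 0 (indicator {y. u y = 0}) t c \<ge> 0" using t by (intro bavg_indicator_nonneg) auto
    ultimately have "bavg 0 (indicator {y. u y = 0}) t c = 0" by linarith
    with deficit_has_real_derivative[OF u, of t c] t show ?thesis by simp
  qed
  then obtain k where k: "\<And>t. t \<in> {0<..<r} \<Longrightarrow> deficit u t c = k"
    using has_field_derivative_zero_constant[of "{0<..<r}" "\<lambda>s. deficit u s c",
      OF convex_real_interval(8) has_field_derivative_at_within] by blast
  have "((\<lambda>s. deficit u s c) \<longlongrightarrow> k) (at_right 0)"
    by (rule Lim_transform_eventually[OF tendsto_const])
      (use k r in \<open>auto simp: eventually_at_right_field intro!: exI[of _ r]\<close>)
  then have "k = 0" by (rule tendsto_unique[OF _ _ deficit_tendsto_0[OF u], rotated]) simp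
  moreover have "((\<lambda>s. deficit u s c) \<longlongrightarrow> k) (at_left r)"
    by (rule Lim_transform_eventually[OF tendsto_const])
      (use k r in \<open>auto simp: eventually_at_left_field intro!: exI[of _ 0]\<close>)
  moreover have "((\<lambda>s. deficit u s c) \<longlongrightarrow> deficit u r c) (at_left r)"
    by (rule filterlim_at_split[THEN iffD1, THEN conjunct1])
      (use DERIV_isCont[OF deficit_has_real_derivative[OF u r]] in \<open>simp add: isCont_def\<close>)
  ultimately show ?thesis using tendsto_unique[of "at_left r"] trivial_limit_at_left_real by metis
qed

text \<open>The average of an indicator is at most \<open>bmass 0\<close>, which makes the
  difference of the two sides monotone in r. The bound is uniform in c; its value at r = 1 starts
  the estimate of \<open>pot\<close>.\<close>

lemma deficit_le_small:
  fixes u :: "real^'n \<Rightarrow> real"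
  assumes u: "obst u" and r: "0 < r"
  shows "deficit u r c \<le> bmass TYPE('n) 0 * r\<^sup>2 / 4"
proof -
  let ?m = "bmass TYPE('n) 0"
  have mono: "?m * s\<^sup>2 / 4 - deficit u s c \<le> ?m * r\<^sup>2 / 4 - deficit u r c" if "0 < s" "s \<le> r" for s
  proof (rule DERIV_nonneg_imp_nondecreasing[OF that(2)])
    fix t assume "s \<le> t" "t \<le> r"
    then have t: "t > 0" using that by simp
    have "bavg 0 (indicator {y. u y = 0}) t c \<le> ?m"
      by (intro bavg_indicator_le_mass t borel_closed closed_zero_set obst_continuous[OF u])
    then have "t / 2 * (?m - bavg 0 (indicator {y. u y = 0}) t c) \<ge> 0" using t by simp
    moreover have "((\<lambda>s. ?m * s\<^sup>2 / 4 - deficit u s c) has_real_derivative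
       t / 2 * (?m - bavg 0 (indicator {y. u y = 0}) t c)) (at t)"
      by (auto intro!: derivative_eq_intros deficit_has_real_derivative[OF u t] simp: algebra_simps)
    ultimately show "\<exists>y. ((\<lambda>s. ?m * s\<^sup>2 / 4 - deficit u s c) has_real_derivative y) (at t) \<and> y \<ge> 0"
      by blast
  qed
  have "((\<lambda>s. ?m * s\<^sup>2 / 4 - deficit u s c) \<longlongrightarrow> ?m * 0\<^sup>2 / 4 - 0) (at_right 0)"
    by (intro tendsto_intros deficit_tendsto_0[OF u]) simp
  then have "?m * 0\<^sup>2 / 4 - 0 \<le> ?m * r\<^sup>2 / 4 - deficit u r c"
    by (rule tendsto_upperbound)
      (use mono r in \<open>auto simp: eventually_at_right_field intro!: exI[of _ r]\<close>)
  then show ?thesis by simp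
qed

text \<open>With C the zero set, the derivative is at most (r/2) |C| r^-n, hence at most |C| / (2
  r^2) for r >= 1 and n >= 3. Integration gives a bound that does not depend on c.\<close>

lemma deficit_diff_le:
  fixes u :: "real^'n \<Rightarrow> real"
  assumes u: "obst u" and n: "CARD('n) \<ge> 3" and b: "bounded {y. u y = 0}" and r: "1 \<le> r" "r \<le> s"
  shows "deficit u s c - deficit u r c \<le> measure lborel {y. u y = 0} / 2 * (1 / r - 1 / s)"
proof -
  let ?M = "measure lborel {y. u y = 0}"
  have "- ?M / 2 * (1 / r) - deficit u r c \<le> - ?M / 2 * (1 / s) - deficit u s c"
  proof (rule DERIV_nonneg_imp_nondecreasing[OF r(2)])
    fix t assume "r \<le> t" "t \<le> s"
    then have t: "t \<ge> 1" "t > 0" using r by auto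
    have "t ^ 3 \<le> t ^ CARD('n)" using t n by (intro power_increasing) auto
    then have "?M / t ^ CARD('n) \<le> ?M / t ^ 3" using t by (intro divide_left_mono) auto
    moreover have "bavg 0 (indicator {y. u y = 0}) t c \<le> ?M / t ^ CARD('n)"
      by (intro bavg_indicator_le_measure t b borel_closed closed_zero_set obst_continuous[OF u])
    ultimately have "t / 2 * bavg 0 (indicator {y. u y = 0}) t c \<le> t / 2 * (?M / t ^ 3)"
      using t by (intro mult_left_mono) auto
    also have "\<dots> = ?M / 2 / t\<^sup>2" using t by (simp add: field_simps eval_nat_numeral)
    finally have "0 \<le> ?M / 2 / t\<^sup>2 - t / 2 * bavg 0 (indicator {y. u y = 0}) t c" by simp
    moreover have "((\<lambda>s. - ?M / 2 * (1 / s)) has_real_derivative ?M / 2 / t\<^sup>2) (at t)"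
      using t by (auto intro!: derivative_eq_intros simp: power2_eq_square)
    from DERIV_diff[OF this deficit_has_real_derivative[OF u t(2), of c]]
    have "((\<lambda>s. - ?M / 2 * (1 / s) - deficit u s c) has_real_derivative
       ?M / 2 / t\<^sup>2 - t / 2 * bavg 0 (indicator {y. u y = 0}) t c) (at t)" .
    ultimately show "\<exists>y. ((\<lambda>s. - ?M / 2 * (1 / s) - deficit u s c) has_real_derivative y) (at t) \<and> y \<ge> 0"
      by blast
  qed
  then show ?thesis by (simp add: algebra_simps)
qed

text \<open>If all deficits at c vanished, so would the derivative at a radius R whose ball contains
  the zero set. There \<open>bump 0 c R\<close> is positive on the interior, which is not a null
  set.\<close>

lemma deficit_pos:
  fixes u :: "real^'n \<Rightarrow> real"
  assumes u: "obst u" and b: "bounded {y. u y = 0}" and i: "interior {y. u y = 0} \<noteq> {}"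
  shows "\<exists>r>0. deficit u r c > 0"
proof (rule ccontr)
  assume "\<not> ?thesis"
  then have z: "deficit u r c = 0" if "r > 0" for r
    using deficit_nonneg[OF u that, of c] that by force
  obtain R where R: "R > 0" "{y. u y = 0} \<subseteq> ball c R"
    using b bounded_subset_ballD by blast
  have "((\<lambda>_. 0) has_real_derivative R / 2 * bavg 0 (indicator {y. u y = 0}) R c) (at R)"
    by (rule has_field_derivative_transform_within_open[OF deficit_has_real_derivative[OF u R(1)], where S="{0<..}"])
      (use R z in auto)
  then have "R / 2 * bavg 0 (indicator {y. u y = 0}) R c = 0"
    using DERIV_unique DERIV_const by blast
  then have "(LBINT x. indicator {y. u y = 0} x * bump 0 c R x) = 0" using R by (simp add: bavg_def)
  moreover have mC: "{y. u y = 0} \<in> sets borel"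
    by (intro borel_closed closed_zero_set obst_continuous[OF u])
  ultimately have "AE x in lborel. indicator {y. u y = 0} x * bump 0 c R x = 0"
    using integral_nonneg_eq_0_iff_AE[OF integrable_indicator_bump[OF R(1) mC, of 0 c]] by simp
  then have "AE x in lborel. x \<notin> interior {y. u y = 0}"
  proof eventually_elim
    case (elim x)
    show ?case
    proof
      assume "x \<in> interior {y. u y = 0}"
      then have x: "x \<in> {y. u y = 0}" using interior_subset by blast
      then have "bump 0 c R x > 0" using R bump_pos_iff by blast
      with elim x show False by simp
    qed
  qed
  then have "interior {y. u y = 0} \<in> null_sets lborel"
    by (subst (asm) AE_iff_null_sets[symmetric]) auto
  then have "negligible (interior {y. u y = 0})"
    unfolding negligible_iff_null_sets by (rule null_sets_completionI)
  with i show False using open_not_negligible open_interior by blast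
qed

text \<open>The limit below is, up to a dimensional factor, the Newtonian potential of the zero set.\<close>

definition pot :: "(real^'n \<Rightarrow> real) \<Rightarrow> real^'n \<Rightarrow> real" where
  "pot u c = lim (\<lambda>k. deficit u (real (Suc k)) c) / bmass TYPE('n) 2"

lemma pot_tendsto:
  fixes u :: "real^'n \<Rightarrow> real"
  assumes u: "obst u" and n: "CARD('n) \<ge> 3" and b: "bounded {y. u y = 0}"
  shows "(\<lambda>k. deficit u (real (Suc k)) c) \<longlonglongrightarrow> bmass TYPE('n) 2 * pot u c"
proof -
  have "convergent (\<lambda>k. deficit u (real (Suc k)) c)"
  proof (rule Bseq_mono_convergent)
    show "Bseq (\<lambda>k. deficit u (real (Suc k)) c)"
    proof (rule BseqI')
      fix k :: nat
      have "deficit u (real (Suc k)) c - deficit u 1 c \<le> measure lborel {y. u y = 0} / 2 * (1 / 1 - 1 / real (Suc k))"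
        by (rule deficit_diff_le[OF u n b]) auto
      also have "\<dots> \<le> measure lborel {y. u y = 0} / 2 * 1" by (intro mult_left_mono) auto
      finally have "deficit u (real (Suc k)) c - deficit u 1 c \<le> measure lborel {y. u y = 0} / 2" by simp
      then show "norm (deficit u (real (Suc k)) c) \<le> deficit u 1 c + measure lborel {y. u y = 0} / 2"
        using deficit_nonneg[OF u, of "real (Suc k)" c] by simp
    qed
    show "\<forall>m n. m \<le> n \<longrightarrow> deficit u (real (Suc m)) c \<le> deficit u (real (Suc n)) c"
      by (intro allI impI deficit_mono[OF u]) auto
  qed
  then show ?thesis using bmass_pos[where 'n='n, of 2] by (simp add: pot_def convergent_LIMSEQ_iff)
qed

lemma deficit_le_pot:
  fixes u :: "real^'n \<Rightarrow> real"
  assumes u: "obst u" and n: "CARD('n) \<ge> 3" and b: "bounded {y. u y = 0}" and r: "r > 0"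
  shows "deficit u r c \<le> bmass TYPE('n) 2 * pot u c"
proof (rule tendsto_lowerbound[OF pot_tendsto[OF u n b]])
  obtain N where "r \<le> real N" using real_arch_simple by blast
  then show "\<forall>\<^sub>F k in sequentially. deficit u r c \<le> deficit u (real (Suc k)) c"
    by (intro eventually_sequentiallyI[of N] deficit_mono[OF u r]) auto
qed simp

lemma pot_le:
  fixes u :: "real^'n \<Rightarrow> real"
  assumes u: "obst u" and n: "CARD('n) \<ge> 3" and b: "bounded {y. u y = 0}" and r: "r \<ge> 1"
  shows "bmass TYPE('n) 2 * pot u c \<le> deficit u r c + measure lborel {y. u y = 0} / 2 / r"
proof (rule tendsto_upperbound[OF pot_tendsto[OF u n b]])
  obtain N where N: "r \<le> real N" using real_arch_simple by blast
  have "deficit u (real (Suc k)) c \<le> deficit u r c + measure lborel {y. u y = 0} / 2 / r" if "k \<ge> N" for k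
  proof -
    have "deficit u (real (Suc k)) c - deficit u r c \<le> measure lborel {y. u y = 0} / 2 * (1 / r - 1 / real (Suc k))"
      by (rule deficit_diff_le[OF u n b r]) (use N that in linarith)
    also have "\<dots> \<le> measure lborel {y. u y = 0} / 2 * (1 / r)" by (intro mult_left_mono) auto
    finally show ?thesis by simp
  qed
  then show "\<forall>\<^sub>F k in sequentially. deficit u (real (Suc k)) c \<le> deficit u r c + measure lborel {y. u y = 0} / 2 / r"
    by (rule eventually_sequentiallyI)
qed simp

lemma pot_bounded:
  fixes u :: "real^'n \<Rightarrow> real"
  assumes u: "obst u" and n: "CARD('n) \<ge> 3" and b: "bounded {y. u y = 0}"
  obtains K where "\<And>r c. r > 0 \<Longrightarrow> deficit u r c \<le> K" "\<And>c. pot u c \<le> K"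
proof -
  define K0 where "K0 = bmass TYPE('n) 0 / 4 + measure lborel {y. u y = 0} / 2"
  let ?m = "bmass TYPE('n) 2"
  have m: "?m > 0" by (rule bmass_pos)
  have *: "?m * pot u c \<le> K0" for c
    using pot_le[OF u n b, of 1 c] deficit_le_small[OF u, of 1 c] by (simp add: K0_def)
  have K0: "K0 \<ge> 0" using bmass_pos[where 'n='n, of 0] by (simp add: K0_def)
  show thesis
  proof (rule that[of "max K0 (K0 / ?m)"])
    show "deficit u r c \<le> max K0 (K0 / ?m)" if "r > 0" for r c
      using deficit_le_pot[OF u n b that, of c] *[of c] by simp
    show "pot u c \<le> max K0 (K0 / ?m)" for c
      using *[of c] m by (simp add: field_simps le_max_iff_disj)
  qed
qed

lemma pot_pos:
  fixes u :: "real^'n \<Rightarrow> real"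
  assumes u: "obst u" and n: "CARD('n) \<ge> 3" and b: "bounded {y. u y = 0}" and i: "interior {y. u y = 0} \<noteq> {}"
  shows "pot u c > 0"
proof -
  obtain r where "r > 0" "deficit u r c > 0" using deficit_pos[OF u b i] by blast
  with deficit_le_pot[OF u n b, of r c] have "bmass TYPE('n) 2 * pot u c > 0" by linarith
  then show ?thesis using bmass_pos[where 'n='n, of 2] by (simp add: zero_less_mult_iff)
qed

text \<open>Far out, the ball of radius rho about c misses the zero set, so its deficit is 0 and
  only the tail M / (2 rho) in \<open>pot_le\<close> remains. The choice of rho makes this tail at
  most half of m e.\<close>

lemma pot_vanishes_at_infinity:
  fixes u :: "real^'n \<Rightarrow> real"
  assumes u: "obst u" and n: "CARD('n) \<ge> 3" and b: "bounded {y. u y = 0}" and e: "e > 0"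
  shows "\<exists>R. \<forall>c. norm c \<ge> R \<longrightarrow> pot u c < e"
proof -
  let ?m = "bmass TYPE('n) 2" and ?M = "measure lborel {y. u y = 0}"
  have m: "?m > 0" by (rule bmass_pos)
  obtain B where B: "\<And>y. u y = 0 \<Longrightarrow> norm y \<le> B" using b unfolding bounded_iff by auto
  define \<rho> where "\<rho> = max 1 (?M / (?m * e))"
  have \<rho>: "\<rho> \<ge> 1" "?M / (?m * e) \<le> \<rho>" by (auto simp: \<rho>_def)
  have "pot u c < e" if c: "norm c \<ge> B + \<rho>" for c
  proof -
    have "ball c \<rho> \<inter> {y. u y = 0} = {}"
    proof (safe)
      fix y assume "y \<in> ball c \<rho>" "u y = 0"
      then show "y \<in> {}" using B[of y] c norm_triangle_ineq2[of c y] by (auto simp: dist_norm)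
    qed
    then have "deficit u \<rho> c = 0" using \<rho> by (intro deficit_eq_0[OF u]) auto
    then have "?m * pot u c \<le> ?M / 2 / \<rho>" using pot_le[OF u n b \<rho>(1), of c] by simp
    also have "\<dots> \<le> ?m * e / 2" using \<rho> m e by (simp add: field_simps)
    also have "\<dots> < ?m * e" using m e by simp
    finally show ?thesis using m by simp
  qed
  then show ?thesis by blast
qed

section \<open>Finite differences and quadratic polynomials\<close>

definition fdiff :: "'a::ab_group_add \<Rightarrow> ('a \<Rightarrow> real) \<Rightarrow> 'a \<Rightarrow> real" where
  "fdiff h f x = f (x + h) - f x"

lemma fdiff_add: "fdiff (h + k) f x = fdiff h f (x + k) + fdiff k f x"
  by (simp add: fdiff_def algebra_simps)

lemma fdiff_commute: "fdiff h (fdiff k f) x = fdiff k (fdiff h f) x"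
  by (simp add: fdiff_def algebra_simps)

section \<open>Iterated differences and their bounds by partial derivatives\<close>

definition fdiffs :: "'a::ab_group_add list \<Rightarrow> ('a \<Rightarrow> real) \<Rightarrow> 'a \<Rightarrow> real" where
  "fdiffs hs f = foldr fdiff hs f"

lemma fdiffs_simps [simp]: "fdiffs [] f = f" "fdiffs (h # hs) f = fdiff h (fdiffs hs f)"
  by (simp_all add: fdiffs_def)

lemma fdiffs_has_derivative:
  fixes f :: "'a::real_normed_vector \<Rightarrow> real"
  assumes "\<And>x. (f has_derivative D x) (at x)"
  shows "(fdiffs hs f has_derivative (\<lambda>v. fdiffs hs (\<lambda>x. D x v) x)) (at x)"
proof (induction hs arbitrary: x)
  case Nil
  then show ?case using assms by simp
next
  case (Cons h hs)
  have "((\<lambda>x. x + h) has_derivative (\<lambda>v. v)) (at x)"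
    by (auto intro!: derivative_eq_intros)
  from has_derivative_compose[OF this Cons[of "x + h"]]
  have "((\<lambda>x. fdiffs hs f (x + h)) has_derivative (\<lambda>v. fdiffs hs (\<lambda>x. D x v) (x + h))) (at x)" .
  from has_derivative_diff[OF this Cons[of x]] show ?case by (simp add: fdiff_def[abs_def])
qed

text \<open>Only the partial derivatives of the top order n have to be bounded; these are the ones
  that control differences of order n.\<close>

fun bounded_partials :: "nat \<Rightarrow> (real^'n \<Rightarrow> real) \<Rightarrow> bool" where
  "bounded_partials 0 f \<longleftrightarrow> (\<exists>M. \<forall>x. \<bar>f x\<bar> \<le> M)"
| "bounded_partials (Suc n) f \<longleftrightarrow> (\<exists>D. (\<forall>x. (f has_derivative D x) (at x)) \<and>
     (\<forall>i. bounded_partials n (\<lambda>x. D x (axis i 1))))"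

text \<open>Mean value theorem in the outermost increment. The differential of an iterated
  difference is the iterated difference of the differential, to whose components the induction
  hypothesis applies.\<close>

lemma fdiffs_bound:
  fixes f :: "real^'n \<Rightarrow> real"
  assumes "bounded_partials n f"
  shows "\<exists>C. \<forall>hs x. length hs = n \<longrightarrow> \<bar>fdiffs hs f x\<bar> \<le> C * (\<Prod>h\<leftarrow>hs. norm h)"
  using assms
proof (induction n arbitrary: f)
  case 0
  then show ?case by auto
next
  case (Suc n)
  then obtain D where D: "\<And>x. (f has_derivative D x) (at x)"
    and B: "\<And>i. bounded_partials n (\<lambda>x. D x (axis i 1))" by auto
  have "\<exists>C. \<forall>hs x. length hs = n \<longrightarrow> \<bar>fdiffs hs (\<lambda>x. D x (axis i 1)) x\<bar> \<le> C * (\<Prod>h\<leftarrow>hs. norm h)" for i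
    by (rule Suc.IH[OF B])
  then obtain C where C: "\<And>i hs x. length hs = n \<Longrightarrow>
      \<bar>fdiffs hs (\<lambda>x. D x (axis i 1)) x\<bar> \<le> C i * (\<Prod>h\<leftarrow>hs. norm h)" by metis
  have "\<bar>fdiffs hs f x\<bar> \<le> (\<Sum>i\<in>UNIV. C i) * (\<Prod>h\<leftarrow>hs. norm h)" if len: "length hs = Suc n" for hs x
  proof -
    obtain h ks where hs: "hs = h # ks" "length ks = n" using len by (cases hs) auto
    define P where "P = (\<Prod>h\<leftarrow>ks. norm h)"
    have der: "(fdiffs ks f has_derivative (\<lambda>v. fdiffs ks (\<lambda>x. D x v) x)) (at x)" for x
      by (rule fdiffs_has_derivative[OF D])
    have on: "\<bar>fdiffs ks (\<lambda>x. D x v) x\<bar> \<le> (\<Sum>i\<in>UNIV. C i) * P * norm v" for x v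
    proof -
      interpret bounded_linear "\<lambda>v. fdiffs ks (\<lambda>x. D x v) x"
        using der has_derivative_bounded_linear by blast
      have "fdiffs ks (\<lambda>x. D x v) x = fdiffs ks (\<lambda>x. D x (\<Sum>i\<in>UNIV. v $ i *\<^sub>R axis i 1)) x"
        using basis_expansion[of v] by (simp add: scalar_mult_eq_scaleR)
      also have "\<dots> = (\<Sum>i\<in>UNIV. v $ i * fdiffs ks (\<lambda>x. D x (axis i 1)) x)"
        by (simp add: sum scaleR)
      also have "\<bar>\<dots>\<bar> \<le> (\<Sum>i\<in>UNIV. \<bar>v $ i * fdiffs ks (\<lambda>x. D x (axis i 1)) x\<bar>)" by (rule sum_abs)
      also have "\<dots> \<le> (\<Sum>i\<in>UNIV. norm v * (C i * P))"
        unfolding abs_mult P_def by (intro sum_mono mult_mono component_le_norm_cart C hs) auto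
      finally show ?thesis by (simp add: sum_distrib_left sum_distrib_right mult_ac)
    qed
    have "norm (fdiffs ks f (x + h) - fdiffs ks f x) \<le> (\<Sum>i\<in>UNIV. C i) * P * norm ((x + h) - x)"
    proof (rule differentiable_bound[of UNIV])
      show "onorm (\<lambda>v. fdiffs ks (\<lambda>x. D x v) y) \<le> (\<Sum>i\<in>UNIV. C i) * P" for y
        by (rule onorm_le) (use on in auto)
    qed (use der in auto)
    then show ?thesis by (simp add: hs fdiff_def P_def mult_ac)
  qed
  then show ?case by blast
qed

lemma smooth_fun_has_derivative:
  "smooth_fun f \<Longrightarrow> \<exists>D. (\<forall>x. (f has_derivative D x) (at x)) \<and> (\<forall>i. smooth_fun (\<lambda>x. D x (axis i 1)))"
  by (erule smooth_fun.cases) blast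

lemma bounded_partials_smooth:
  fixes f :: "real^'n \<Rightarrow> real"
  assumes "smooth_fun f" "\<And>x. x \<notin> cball c r \<Longrightarrow> f x = 0"
  shows "bounded_partials n f"
  using assms
proof (induction n arbitrary: f)
  case 0
  from 0(1) obtain D where D: "\<And>x. (f has_derivative D x) (at x)"
    using smooth_fun_has_derivative by blast
  have "continuous_on (cball c r) f"
    using D has_derivative_continuous continuous_at_imp_continuous_on by blast
  then have "bounded (f ` cball c r)" by (intro compact_imp_bounded compact_continuous_image) auto
  then obtain M where M: "\<And>x. x \<in> cball c r \<Longrightarrow> \<bar>f x\<bar> \<le> M"
    unfolding bounded_iff by (auto simp del: mem_cball)
  have "\<bar>f x\<bar> \<le> max M 0" for x
    using M[of x] 0(2)[of x] by (cases "x \<in> cball c r") (auto simp: le_max_iff_disj)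
  then show ?case by auto
next
  case (Suc n)
  from Suc(2) obtain D where D: "\<And>x. (f has_derivative D x) (at x)" 
    and s: "\<And>i. smooth_fun (\<lambda>x. D x (axis i 1))" using smooth_fun_has_derivative by blast
  have "D x (axis i 1) = 0" if "x \<notin> cball c r" for x i
  proof -
    have "(f has_derivative (\<lambda>_. 0)) (at x)"
      by (rule has_derivative_transform_within_open[of "\<lambda>_. 0" _ _ _ "- cball c r"])
        (use that Suc(3) in \<open>auto simp del: mem_cball\<close>)
    then have "D x = (\<lambda>_. 0)" using D has_derivative_unique by blast
    then show ?thesis by simp
  qed
  then have "bounded_partials n (\<lambda>x. D x (axis i 1))" for i
    by (rule Suc.IH[OF s])
  with D show ?case by auto
qed

section \<open>From vanishing third differences to quadratic polynomials\<close>

lemma additive_imp_linear: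
  fixes f :: "'a::real_normed_vector \<Rightarrow> real"
  assumes add: "\<And>x y. f (x + y) = f x + f y"
    and bdd: "\<And>R. \<exists>M. \<forall>x. norm x \<le> R \<longrightarrow> \<bar>f x\<bar> \<le> M"
  shows "linear f"
proof (rule linearI)
  have zero: "f 0 = 0" using add[of 0 0] by simp
  have neg: "f (- x) = - f x" for x using add[of x "- x"] zero by simp
  have nat: "f (real n *\<^sub>R x) = real n * f x" for n x
    by (induction n) (auto simp: zero add algebra_simps)
  have int: "f (real_of_int n *\<^sub>R x) = real_of_int n * f x" for n x
  proof (cases "n \<ge> 0")
    case True
    then show ?thesis using nat[of "nat n" x] by simp
  next
    case False
    then show ?thesis using nat[of "nat (- n)" x] neg[of "real_of_int n *\<^sub>R x"] by simp
  qed
  fix t :: real and x :: 'a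
  obtain M where M: "\<And>y. norm y \<le> norm x \<Longrightarrow> \<bar>f y\<bar> \<le> M" using bdd by blast
  \<comment> \<open>Rounding n t to an integer leaves a remainder r in [0,1], so the error is
    bounded uniformly in n; this forces f(t x) = t f(x).\<close>
  have "real n * \<bar>f (t *\<^sub>R x) - t * f x\<bar> \<le> 2 * M" for n
  proof -
    define r where "r = real n * t - real_of_int \<lfloor>real n * t\<rfloor>"
    have r: "0 \<le> r" "r \<le> 1" unfolding r_def by linarith+
    have "f (real n *\<^sub>R (t *\<^sub>R x)) = f (real_of_int \<lfloor>real n * t\<rfloor> *\<^sub>R x + r *\<^sub>R x)"
      by (simp add: r_def flip: scaleR_add_left)
    also have "\<dots> = real_of_int \<lfloor>real n * t\<rfloor> * f x + f (r *\<^sub>R x)" by (simp only: add int)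
    finally have "real n * (f (t *\<^sub>R x) - t * f x) = f (r *\<^sub>R x) - r * f x"
      by (simp add: nat r_def algebra_simps del: scaleR_scaleR)
    then have "real n * \<bar>f (t *\<^sub>R x) - t * f x\<bar> = \<bar>f (r *\<^sub>R x) - r * f x\<bar>"
      by (metis abs_mult abs_of_nat)
    also have "\<dots> \<le> \<bar>f (r *\<^sub>R x)\<bar> + \<bar>r * f x\<bar>" by (rule abs_triangle_ineq4)
    also have "\<bar>f (r *\<^sub>R x)\<bar> \<le> M" using r by (intro M) (simp add: mult_left_le_one_le)
    also have "\<bar>r * f x\<bar> \<le> M" using r M[of x] mult_left_le_one_le[of "\<bar>f x\<bar>" r] by (simp add: abs_mult)
    finally show ?thesis by simp
  qed
  then have "\<bar>f (t *\<^sub>R x) - t * f x\<bar> = 0"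
    using reals_Archimedean3[of "\<bar>f (t *\<^sub>R x) - t * f x\<bar>"] abs_ge_zero
    by (metis less_le_not_le order_le_less)
  then show "f (t *\<^sub>R x) = t *\<^sub>R f x" by simp
qed (rule add)

text \<open>Second differences do not depend on the base point, which makes them biadditive;
  subtracting B x x / 2 leaves an additive remainder. Local boundedness turns additive into linear,
  so no differentiability of q is involved.\<close>

lemma fdiff3_zero_imp_quadratic:
  fixes q :: "'a::real_normed_vector \<Rightarrow> real"
  assumes z: "\<And>h k l x. fdiff h (fdiff k (fdiff l q)) x = 0"
    and bdd: "\<And>R. \<exists>M. \<forall>x. norm x \<le> R \<longrightarrow> \<bar>q x\<bar> \<le> M"
  obtains L B where "linear L" "\<And>h. linear (B h)" "\<And>h k. B h k = B k h"
    "\<And>x. q x = q 0 + L x + B x x / 2"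
proof -
  define B where "B h k = fdiff h (fdiff k q) 0" for h k
  have B: "fdiff h (fdiff k q) x = B h k" for h k x
  proof -
    have "fdiff x (fdiff h (fdiff k q)) 0 = 0" by (rule z)
    then show ?thesis by (simp add: fdiff_def B_def)
  qed
  have sym: "B h k = B k h" for h k unfolding B_def by (rule fdiff_commute)
  have addB: "B h (k + l) = B h k + B h l" for h k l
    using fdiff_add[of k l "fdiff h q" 0] B[of k h] B[of l h] B[of "k + l" h] by (simp add: sym)
  have exp: "q (x + y) = q x + q y - q 0 + B x y" for x y
    by (simp add: B_def fdiff_def add.commute)
  have linB: "linear (B h)" for h
  proof (rule additive_imp_linear)
    fix R
    obtain M where M: "\<And>x. norm x \<le> norm h + \<bar>R\<bar> \<Longrightarrow> \<bar>q x\<bar> \<le> M" using bdd by blast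
    have "\<bar>B h k\<bar> \<le> 4 * M" if "norm k \<le> R" for k
    proof -
      have n: "norm (h + k) \<le> norm h + \<bar>R\<bar>" using norm_triangle_ineq[of h k] that by linarith
      have "norm h \<le> norm h + \<bar>R\<bar>" "norm k \<le> norm h + \<bar>R\<bar>" "norm (0::'a) \<le> norm h + \<bar>R\<bar>"
        using that norm_ge_zero[of h] abs_ge_self[of R] abs_ge_zero[of R] by (auto intro: order_trans)
      with n have "\<bar>q (h + k)\<bar> \<le> M" "\<bar>q h\<bar> \<le> M" "\<bar>q k\<bar> \<le> M" "\<bar>q 0\<bar> \<le> M" using M by blast+
      then show ?thesis using exp[of h k] by linarith
    qed
    then show "\<exists>M. \<forall>x. norm x \<le> R \<longrightarrow> \<bar>B h x\<bar> \<le> M" by blast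
  qed (rule addB)
  define L where "L x = q x - q 0 - B x x / 2" for x
  have "linear L"
  proof (rule additive_imp_linear)
    show "L (x + y) = L x + L y" for x y
      using exp[of x y] addB[of x x y] addB[of y x y] addB[of "x + y" x y] sym[of "x + y" x] sym[of "x + y" y] sym[of x y]
      by (simp add: L_def field_simps)
    fix R
    obtain M where M: "\<And>x. norm x \<le> 2 * \<bar>R\<bar> \<Longrightarrow> \<bar>q x\<bar> \<le> M" using bdd by blast
    have "\<bar>L x\<bar> \<le> 4 * M" if "norm x \<le> R" for x
    proof -
      have n: "norm (x + x) \<le> 2 * \<bar>R\<bar>" using norm_triangle_ineq[of x x] that by linarith
      have "norm x \<le> 2 * \<bar>R\<bar>" "norm (0::'a) \<le> 2 * \<bar>R\<bar>" using that by auto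
      with n have "\<bar>q (x + x)\<bar> \<le> M" "\<bar>q x\<bar> \<le> M" "\<bar>q 0\<bar> \<le> M" using M by blast+
      then show ?thesis using exp[of x x] unfolding L_def by linarith
    qed
    then show "\<exists>M. \<forall>x. norm x \<le> R \<longrightarrow> \<bar>L x\<bar> \<le> M" by blast
  qed
  then show thesis using that[of L B] linB sym by (simp add: L_def)
qed

section \<open>Orthonormal diagonalisation of a symmetric bilinear form\<close>

text \<open>The invariant \<open>B e v = 0\<close> for all \<open>v\<close> orthogonal to \<open>E\<close> makes the greedy choice of the
  next eigenvector (a maximiser of \<open>B v v\<close> on the unit sphere of the orthogonal complement) work
  without any dimension count.\<close>

lemma symmetric_form_partial_diagonalization:
  fixes B :: "'a::euclidean_space \<Rightarrow> 'a \<Rightarrow> real"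
  assumes lin: "\<And>h. linear (B h)" and sym: "\<And>h k. B h k = B k h" and "k \<le> DIM('a)"
  shows "\<exists>E. finite E \<and> card E = k \<and> (\<forall>e\<in>E. norm e = 1) \<and> pairwise orthogonal E \<and>
    (\<forall>e\<in>E. \<forall>f\<in>E. e \<noteq> f \<longrightarrow> B e f = 0) \<and> (\<forall>v. (\<forall>e\<in>E. e \<bullet> v = 0) \<longrightarrow> (\<forall>e\<in>E. B e v = 0))"
  using assms(3)
proof (induction k)
  case 0
  then show ?case by (intro exI[of _ "{}"]) auto
next
  case (Suc k)
  then obtain E where E: "finite E" "card E = k" "\<forall>e\<in>E. norm e = 1" "pairwise orthogonal E"
    "\<forall>e\<in>E. \<forall>f\<in>E. e \<noteq> f \<longrightarrow> B e f = 0" "\<And>v e. (\<forall>e\<in>E. e \<bullet> v = 0) \<Longrightarrow> e \<in> E \<Longrightarrow> B e v = 0"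
    by auto
  define S where "S = {v. \<forall>e\<in>E. e \<bullet> v = 0}"
  have "dim E < DIM('a)" using dim_le_card'[OF E(1)] E(2) Suc.prems by linarith
  then obtain x where x: "x \<noteq> 0" "\<And>y. y \<in> span E \<Longrightarrow> orthogonal x y"
    using orthogonal_to_subspace_exists by blast
  then have "x /\<^sub>R norm x \<in> S \<inter> sphere 0 1"
    by (auto simp: S_def orthogonal_def span_base inner_commute)
  then have ne: "S \<inter> sphere 0 1 \<noteq> {}" by blast
  have S_alt: "S = (\<Inter>e\<in>E. {v. e \<bullet> v = 0})" by (auto simp: S_def)
  have "closed S" unfolding S_alt by (intro closed_INT ballI closed_hyperplane)
  then have comp: "compact (S \<inter> sphere 0 1)" by (intro closed_Int_compact) auto
  have linL: "linear (\<lambda>h. B h k)" for k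
  proof -
    have "(\<lambda>h. B h k) = B k" using sym by auto
    then show ?thesis using lin by simp
  qed
  have "bilinear B" using lin linL by (simp add: bilinear_def)
  then have bb: "bounded_bilinear B" by (simp add: bilinear_conv_bounded_bilinear)
  have "continuous_on (S \<inter> sphere 0 1) (\<lambda>v. B v v)"
    by (intro bounded_bilinear.continuous_on[OF bb] continuous_on_id)
  then obtain e where e: "e \<in> S" "norm e = 1" and max: "\<And>v. v \<in> S \<Longrightarrow> norm v = 1 \<Longrightarrow> B v v \<le> B e e"
    using continuous_attains_sup[OF comp ne] by force
  interpret bounded_bilinear B by (rule bb)
  have le: "B v v \<le> B e e * (norm v)\<^sup>2" if "v \<in> S" for v
  proof (cases "v = 0")
    case False
    have "v /\<^sub>R norm v \<in> S" using that by (auto simp: S_def)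
    moreover have "norm (v /\<^sub>R norm v) = 1" using False by simp
    ultimately have "B (v /\<^sub>R norm v) (v /\<^sub>R norm v) \<le> B e e" by (rule max)
    then have "B v v / (norm v)\<^sup>2 \<le> B e e"
      by (simp add: scaleR_left scaleR_right power2_eq_square field_simps)
    then show ?thesis using False by (simp add: field_simps)
  qed (simp add: zero_left)
  have orth: "B e v = 0" if v: "v \<in> S" "e \<bullet> v = 0" for v
  proof (rule ccontr)
    assume nz: "B e v \<noteq> 0"
    define C where "C = B e e * (norm v)\<^sup>2 - B v v"
    have C: "2 * t * B e v \<le> t\<^sup>2 * C" for t
    proof -
      have "e + t *\<^sub>R v \<in> S" using e v by (auto simp: S_def inner_add_right)
      from le[OF this] have "B (e + t *\<^sub>R v) (e + t *\<^sub>R v) \<le> B e e * ((e + t *\<^sub>R v) \<bullet> (e + t *\<^sub>R v))"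
        by (simp add: power2_norm_eq_inner)
      also have "(e + t *\<^sub>R v) \<bullet> (e + t *\<^sub>R v) = 1 + t\<^sup>2 * (norm v)\<^sup>2"
      proof -
        have "(e + t *\<^sub>R v) \<bullet> (e + t *\<^sub>R v) = e \<bullet> e + 2 * t * (e \<bullet> v) + t\<^sup>2 * (v \<bullet> v)"
          by (simp add: inner_add_left inner_add_right inner_commute power2_eq_square algebra_simps)
        then show ?thesis using v(2) e(2) by (simp add: dot_square_norm)
      qed
      also have "B (e + t *\<^sub>R v) (e + t *\<^sub>R v) = B e e + 2 * t * B e v + t\<^sup>2 * B v v"
        by (simp add: add_left add_right scaleR_left scaleR_right sym[of v e] power2_eq_square algebra_simps)
      finally show ?thesis by (simp add: C_def algebra_simps)
    qed
    have "C \<ge> 0" using le[OF v(1)] by (simp add: C_def)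
    \<comment> \<open>With b = \<open>B e v\<close>, the inequality 2 t b <= t^2 C fails for this t:
      its right side is at most half of the left, which is positive. The summand 1 avoids division
      by 0.\<close>
    define t where "t = B e v / (C + 1)"
    have "2 * (B e v)\<^sup>2 / (C + 1) \<le> (B e v)\<^sup>2 / (C + 1) * (C / (C + 1))"
      using C[of t] by (simp add: t_def power2_eq_square)
    also have "\<dots> \<le> (B e v)\<^sup>2 / (C + 1) * 1" using \<open>C \<ge> 0\<close> by (intro mult_left_mono) auto
    finally have "2 * (B e v)\<^sup>2 / (C + 1) \<le> (B e v)\<^sup>2 / (C + 1)" by simp
    moreover have "(B e v)\<^sup>2 / (C + 1) > 0" using nz \<open>C \<ge> 0\<close> by simp
    ultimately show False by simp
  qed
  have eE: "f \<bullet> e = 0" "B f e = 0" if "f \<in> E" for f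
    using e(1) that E(6)[of e f] by (auto simp: S_def)
  have "e \<notin> E" using eE(1)[of e] e(2) by auto
  then show ?case
  proof (intro exI[of _ "insert e E"] conjI)
    show "pairwise orthogonal (insert e E)" using E(4) eE
      by (auto simp: pairwise_insert orthogonal_def inner_commute)
    show "\<forall>a\<in>insert e E. \<forall>f\<in>insert e E. a \<noteq> f \<longrightarrow> B a f = 0"
      using E(5) eE sym by (metis insertE)
    show "\<forall>v. (\<forall>a\<in>insert e E. a \<bullet> v = 0) \<longrightarrow> (\<forall>a\<in>insert e E. B a v = 0)"
      using E(6) orth by (auto simp: S_def)
  qed (use E e in auto)
qed

lemma symmetric_form_diagonalization:
  fixes B :: "real^'n \<Rightarrow> real^'n \<Rightarrow> real"
  assumes lin: "\<And>h. linear (B h)" and sym: "\<And>h k. B h k = B k h"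
  obtains e :: "'n \<Rightarrow> real^'n" where "\<And>i j. e i \<bullet> e j = (if i = j then 1 else 0)"
    "\<And>i j. i \<noteq> j \<Longrightarrow> B (e i) (e j) = 0"
proof -
  obtain E where E: "finite E" "card E = CARD('n)" "\<forall>e\<in>E. norm e = 1" "pairwise orthogonal E"
    "\<forall>e\<in>E. \<forall>f\<in>E. e \<noteq> f \<longrightarrow> B e f = 0"
    using symmetric_form_partial_diagonalization[OF lin sym, of "CARD('n)"] by auto
  obtain e where e: "bij_betw e (UNIV :: 'n set) E"
    using finite_same_card_bij[of "UNIV :: 'n set" E] E by auto
  then have inj: "e i = e j \<longleftrightarrow> i = j" and mem: "e i \<in> E" for i j
    by (auto simp: bij_betw_def inj_on_def)
  show thesis
  proof (rule that[of e])
    show "e i \<bullet> e j = (if i = j then 1 else 0)" for i j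
      using E(3,4) mem inj by (auto simp: pairwise_def orthogonal_def norm_eq_1)
    show "B (e i) (e j) = 0" if "i \<noteq> j" for i j using E(5) mem inj that by blast
  qed
qed

lemma orthonormal_expansion:
  fixes e :: "'n \<Rightarrow> real^'n"
  assumes on: "\<And>i j. e i \<bullet> e j = (if i = j then 1 else 0)"
  shows "x = (\<Sum>i\<in>UNIV. (e i \<bullet> x) *\<^sub>R e i)"
proof -
  have inj: "inj e"
  proof (rule injI)
    fix i j assume "e i = e j"
    then have "e i \<bullet> e j = 1" using on[of j j] by simp
    then show "i = j" using on[of i j] by (auto split: if_splits)
  qed
  have "pairwise orthogonal (range e)" "0 \<notin> range e"
    using on by (auto simp: pairwise_def orthogonal_def) (metis inner_zero_left zero_neq_one)
  then have "independent (range e)" by (rule pairwise_orthogonal_independent)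
  moreover have "card (range e) = CARD('n)" using inj by (simp add: card_image)
  ultimately have sp: "span (range e) = UNIV"
    using card_ge_dim_independent[of "range e" UNIV] by auto
  define y where "y = x - (\<Sum>i\<in>UNIV. (e i \<bullet> x) *\<^sub>R e i)"
  have "y \<bullet> e j = 0" for j
    by (simp add: y_def inner_diff_left inner_sum_left on inner_commute[of x] if_distrib[of "\<lambda>a. _ * a"] cong: if_cong)
  then have "orthogonal y z" if "z \<in> range e" for z using that by (auto simp: orthogonal_def)
  then have "orthogonal y y" using orthogonal_to_span[of y "range e" y] sp by auto
  then show ?thesis by (simp add: orthogonal_def y_def)
qed

section \<open>The solution minus its potential is quadratic\<close>

text \<open>A third difference of kernels of radius R lives in the ball of radius 2R; this bound
  lets one nonnegative kernel of radius 4R dominate it. There 1 - |x - c|^2 / (4R)^2 >= 3/4, which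
  produces exp(-4/3).\<close>

lemma bump_lower_bound:
  assumes "R > 0" "x \<in> ball c (2 * R)"
  shows "exp (- 4 / 3) \<le> bump 2 c (4 * R) x"
proof -
  define t where "t = 1 - (x - c) \<bullet> (x - c) / (4 * R)\<^sup>2"
  have "(x - c) \<bullet> (x - c) = (dist c x)\<^sup>2"
    by (simp add: dist_norm norm_minus_commute dot_square_norm)
  also have "\<dots> \<le> (2 * R)\<^sup>2" using assms by (intro power_mono) auto
  finally have "(x - c) \<bullet> (x - c) \<le> 4 * R\<^sup>2" by (simp add: power_mult_distrib)
  then have t: "3 / 4 \<le> t" "t \<le> 1" using assms(1) by (auto simp: t_def field_simps power_mult_distrib)
  have "exp (- 4 / 3) \<le> exp (- 1 / t)" using t by (simp add: field_simps)
  also have "\<dots> \<le> exp (- 1 / t) / t\<^sup>2"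
  proof -
    have "t\<^sup>2 \<le> 1" "t\<^sup>2 > 0" using t by (auto simp: power_le_one)
    then show ?thesis by (simp add: field_simps)
  qed
  also have "\<dots> = bump 2 c (4 * R) x" 
  proof -
    have "bump 2 c (4 * R) x = flat_exp 2 t" by (simp only: bump_def t_def)
    then show ?thesis using t by (simp add: flat_exp_def)
  qed
  finally show ?thesis .
qed

lemma fdiff_integral:
  fixes g :: "'a::euclidean_space \<Rightarrow> 'a \<Rightarrow> real"
  assumes "\<And>c. integrable lborel (\<lambda>y. u y * g c y)"
  shows "integrable lborel (\<lambda>y. u y * fdiff h (\<lambda>c. g c y) c)"
    and "fdiff h (\<lambda>c. LBINT y. u y * g c y) c = (LBINT y. u y * fdiff h (\<lambda>c. g c y) c)"
  using assms[of "c + h"] assms[of c]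
  by (simp_all add: fdiff_def right_diff_distrib Bochner_Integration.integral_diff)

lemma fdiff_affine:
  fixes g :: "'a::real_vector \<Rightarrow> real"
  shows "fdiff h (\<lambda>c. g (a *\<^sub>R (c - y))) = (\<lambda>c. fdiff (a *\<^sub>R h) g (a *\<^sub>R (c - y)))"
  by (auto simp: fdiff_def fun_eq_iff algebra_simps)

lemma fdiff_tendsto:
  assumes "\<And>x. (\<lambda>k::nat. f k x) \<longlonglongrightarrow> F x"
  shows "(\<lambda>k. fdiff h (f k) x) \<longlonglongrightarrow> fdiff h F x"
  unfolding fdiff_def by (intro tendsto_diff assms)

lemma fdiff_cmult_const: "fdiff h (\<lambda>x. f x / a) = (\<lambda>x. fdiff h f x / a)"
  by (auto simp: fdiff_def fun_eq_iff diff_divide_distrib)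

lemma fdiff_cmult: "fdiff h (\<lambda>x. a * f x) = (\<lambda>x. a * fdiff h f x)"
  by (auto simp: fdiff_def fun_eq_iff right_diff_distrib)

lemma fdiff_diff_const: "fdiff h (\<lambda>x. f x - a) = fdiff h f"
  by (auto simp: fdiff_def fun_eq_iff)

lemma obst_bavg_le:
  fixes u :: "real^'n \<Rightarrow> real"
  assumes "obst u" "r > 0"
  shows "bavg 2 u r c \<le> bmass TYPE('n) 2 * u c + bmass TYPE('n) 0 * r\<^sup>2 / 4"
  using deficit_nonneg[OF assms, of c] by (simp add: deficit_def)

text \<open>Three differences of the rescaled kernel gain R^-3. Since u >= 0, the result is
  dominated by an average of u at radius 4R, which grows at most like R^2 by
  \<open>obst_bavg_le\<close>; one factor 1/R is left over.\<close>

lemma bavg_fdiff3_bound: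
  fixes u :: "real^'n \<Rightarrow> real"
  assumes u: "obst u"
  obtains K where "\<And>R c. R \<ge> 1 \<Longrightarrow> norm h + norm k + norm l \<le> R \<Longrightarrow>
    \<bar>fdiff h (fdiff k (fdiff l (bavg 2 u R))) c\<bar> \<le>
       K * (bmass TYPE('n) 2 * u c + 4 * bmass TYPE('n) 0) * inverse R"
    "K \<ge> 0"
proof -
  define g where "g = bump 2 (0::real^'n) 1"
  have "bounded_partials 3 g" unfolding g_def
    by (rule bounded_partials_smooth[OF smooth_fun_bump, of 0 1]) (rule bump_eq_0, simp_all)
  then obtain C0 where C0: "\<And>hs x. length hs = 3 \<Longrightarrow> \<bar>fdiffs hs g x\<bar> \<le> C0 * (\<Prod>h\<leftarrow>hs. norm h)"
    using fdiffs_bound by blast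
  define C where "C = max C0 0"
  have C: "C \<ge> 0" "C0 \<le> C" by (auto simp: C_def)
  \<comment> \<open>The factor exp(4/3) comes from \<open>bump_lower_bound\<close>, and 4^n from
    replacing the normalisation R^n by (4R)^n.\<close>
  define K where "K = C * (norm h * norm k * norm l) * exp (4 / 3) * 4 ^ CARD('n)"
  have K: "K \<ge> 0" using C by (simp add: K_def)
  have "\<bar>fdiff h (fdiff k (fdiff l (bavg 2 u R))) c\<bar> \<le>
       K * (bmass TYPE('n) 2 * u c + 4 * bmass TYPE('n) 0) * inverse R"
    if R1: "R \<ge> 1" and hR: "norm h + norm k + norm l \<le> R" for R c
  proof -
    have R: "R > 0" using R1 by simp
    define D where "D y = fdiff h (fdiff k (fdiff l (\<lambda>c. bump 2 c R y))) c" for y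
    have int0: "integrable lborel (\<lambda>y. u y * bump j c r y)" if "r > 0" for c r j
      by (intro integrable_continuous_cball[of _ c r] continuous_on_mult obst_continuous[OF u] continuous_on_bump)
        (use bump_eq_0[OF that] in \<open>auto simp del: mem_cball\<close>)
    note 1 = fdiff_integral[OF int0[OF R]]
    note 2 = fdiff_integral[OF 1(1)]
    note 3 = fdiff_integral[OF 2(1)]
    have eq: "fdiff h (fdiff k (fdiff l (bavg 2 u R))) c = (LBINT y. u y * D y) / R ^ CARD('n)"
    proof -
      have "bavg 2 u R = (\<lambda>c. (LBINT y. u y * bump 2 c R y) / R ^ CARD('n))"
        by (simp add: bavg_def fun_eq_iff)
      then show ?thesis
        unfolding D_def by (simp add: fdiff_cmult_const 1(2)[abs_def] 2(2)[abs_def] 3(2))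
    qed
    define M where "M = C * (norm h * norm k * norm l) / R ^ 3 * exp (4 / 3)"
    have M: "M \<ge> 0" using C R by (simp add: M_def)
    have bd: "\<bar>D y\<bar> \<le> M * bump 2 c (4 * R) y" for y
    proof (cases "y \<in> ball c (2 * R)")
      case True
      have "bump 2 c R y = g (inverse R *\<^sub>R (c - y))" for c
      proof -
        have "(c - y) \<bullet> (c - y) = (y - c) \<bullet> (y - c)"
          by (metis inner_minus_left inner_minus_right minus_diff_eq minus_minus)
        then have "(inverse R *\<^sub>R (c - y)) \<bullet> (inverse R *\<^sub>R (c - y)) = (y - c) \<bullet> (y - c) / R\<^sup>2"
          by (simp only: inner_scaleR_left inner_scaleR_right) (simp add: power2_eq_square field_simps)
        then show ?thesis by (simp add: bump_def g_def)
      qed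
      then have "D y = fdiffs [inverse R *\<^sub>R h, inverse R *\<^sub>R k, inverse R *\<^sub>R l] g (inverse R *\<^sub>R (c - y))"
        unfolding D_def by (simp add: fdiff_affine)
      also have "\<bar>\<dots>\<bar> \<le> C0 * (norm h * norm k * norm l / R ^ 3)"
        using R C0[of "[inverse R *\<^sub>R h, inverse R *\<^sub>R k, inverse R *\<^sub>R l]"]
        by (simp add: field_simps power3_eq_cube)
      also have "\<dots> \<le> C * (norm h * norm k * norm l / R ^ 3) * 1"
        using C R by (simp del: times_divide_eq_right add: mult_right_mono)
      also have "\<dots> \<le> C * (norm h * norm k * norm l / R ^ 3) * (exp (4 / 3) * bump 2 c (4 * R) y)"
      proof (rule mult_left_mono)
        have "exp (4 / 3) * exp (- 4 / 3) \<le> exp (4 / 3) * bump 2 c (4 * R) y"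
          by (intro mult_left_mono bump_lower_bound R True) simp
        then show "1 \<le> exp (4 / 3) * bump 2 c (4 * R) y" by (simp flip: exp_add)
      qed (use C R in simp)
      finally show ?thesis by (simp add: M_def mult_ac)
    next
      case False
      \<comment> \<open>Outside the ball of radius 2R all eight translates of the kernel vanish,
        because every shift has norm at most R.\<close>
      have z: "bump 2 (c + s) R y = 0" if "norm s \<le> R" for s
      proof (rule bump_eq_0_ball[OF R])
        have "dist c y \<le> dist (c + s) y + norm s"
          using dist_triangle[of c y "c + s"] by (simp add: dist_norm add.commute)
        then show "y \<notin> ball (c + s) R" using False that by auto
      qed
      have n: "norm (h + k + l) \<le> R" "norm (h + k) \<le> R" "norm (h + l) \<le> R" "norm (k + l) \<le> R"
        "norm h \<le> R" "norm k \<le> R" "norm l \<le> R"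
        using hR norm_triangle_ineq[of "h + k" l] norm_triangle_ineq[of h k] norm_triangle_ineq[of h l]
          norm_triangle_ineq[of k l] norm_ge_zero[of h] norm_ge_zero[of k] norm_ge_zero[of l] by linarith+
      have "D y = 0" unfolding D_def fdiff_def
        using z[OF n(1)] z[OF n(2)] z[OF n(3)] z[OF n(4)] z[OF n(5)] z[OF n(6)] z[OF n(7)] z[of 0] R
        by (simp add: add_ac)
      then show ?thesis using M by simp
    qed
    have "\<bar>\<integral>y. u y * D y \<partial>lborel\<bar> \<le> (LBINT y. M * (u y * bump 2 c (4 * R) y))"
    proof (rule integral_abs_bound_integral)
      show "integrable lborel (\<lambda>y. u y * D y)" unfolding D_def by (rule 3(1))
      show "integrable lborel (\<lambda>y. M * (u y * bump 2 c (4 * R) y))" using R int0[of "4 * R"] by simp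
      show "\<bar>u y * D y\<bar> \<le> M * (u y * bump 2 c (4 * R) y)" for y
        using mult_left_mono[OF bd obst_nonneg[OF u], of y y] obst_nonneg[OF u, of y] by (simp add: abs_mult mult_ac)
    qed
    also have "\<dots> = M * (4 * R) ^ CARD('n) * bavg 2 u (4 * R) c" using R by (simp add: bavg_def)
    also have "\<dots> \<le> M * (4 * R) ^ CARD('n) * (bmass TYPE('n) 2 * u c + bmass TYPE('n) 0 * (4 * R)\<^sup>2 / 4)"
      using R M by (intro mult_left_mono obst_bavg_le[OF u]) auto
    also have "\<dots> \<le> M * (4 * R) ^ CARD('n) * ((bmass TYPE('n) 2 * u c + 4 * bmass TYPE('n) 0) * R\<^sup>2)"
    proof (rule mult_left_mono)
      have "bmass TYPE('n) 2 * u c * 1 \<le> bmass TYPE('n) 2 * u c * R\<^sup>2"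
        using bmass_pos[where 'n='n, of 2] obst_nonneg[OF u, of c] R1 by (intro mult_left_mono) auto
      then show "bmass TYPE('n) 2 * u c + bmass TYPE('n) 0 * (4 * R)\<^sup>2 / 4 \<le>
          (bmass TYPE('n) 2 * u c + 4 * bmass TYPE('n) 0) * R\<^sup>2"
        by (simp add: algebra_simps power_mult_distrib)
    qed (use R M in simp)
    finally have "\<bar>\<integral>y. u y * D y \<partial>lborel\<bar> / R ^ CARD('n) \<le>
       M * (4 * R) ^ CARD('n) * ((bmass TYPE('n) 2 * u c + 4 * bmass TYPE('n) 0) * R\<^sup>2) / R ^ CARD('n)"
      by (rule divide_right_mono) (use R in simp)
    also have "\<dots> = K * (bmass TYPE('n) 2 * u c + 4 * bmass TYPE('n) 0) * inverse R"
      using R by (simp add: M_def K_def power_mult_distrib field_simps eval_nat_numeral)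
    finally show ?thesis unfolding eq using R by simp
  qed
  with K show thesis using that by blast
qed

text \<open>Up to the factor \<open>bmass 2\<close>, u - pot is the limit of averages of u minus
  terms constant in the centre. Differences remove the constants, and the third differences of the
  averages are O(1/R).\<close>

lemma obst_minus_pot_fdiff3:
  fixes u :: "real^'n \<Rightarrow> real"
  assumes u: "obst u" and n: "CARD('n) \<ge> 3" and b: "bounded {y. u y = 0}"
  shows "fdiff h (fdiff k (fdiff l (\<lambda>x. u x - pot u x))) c = 0"
proof -
  let ?m = "bmass TYPE('n) 2"
  define F where "F j x = bavg 2 u (real (Suc j)) x - bmass TYPE('n) 0 * (real (Suc j))\<^sup>2 / 4" for j x
  have "(\<lambda>j. F j x) \<longlonglongrightarrow> ?m * (u x - pot u x)" for x
  proof -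
    have "(\<lambda>j. ?m * u x - deficit u (real (Suc j)) x) \<longlonglongrightarrow> ?m * u x - ?m * pot u x"
      by (rule tendsto_diff[OF tendsto_const pot_tendsto[OF u n b]])
    moreover have "(\<lambda>j. ?m * u x - deficit u (real (Suc j)) x) = (\<lambda>j. F j x)"
      by (rule ext) (simp add: F_def deficit_def)
    ultimately show ?thesis by (simp only: right_diff_distrib)
  qed
  then have lim1: "(\<lambda>j. fdiff h (fdiff k (fdiff l (F j))) c) \<longlonglongrightarrow>
      fdiff h (fdiff k (fdiff l (\<lambda>x. ?m * (u x - pot u x)))) c"
    by (rule fdiff_tendsto[OF fdiff_tendsto[OF fdiff_tendsto]])
  have eq: "(\<lambda>j. fdiff h (fdiff k (fdiff l (F j))) c) = (\<lambda>j. fdiff h (fdiff k (fdiff l (bavg 2 u (real (Suc j))))) c)"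
    by (simp only: F_def[abs_def] fdiff_diff_const)
  have lim0: "(\<lambda>j. fdiff h (fdiff k (fdiff l (bavg 2 u (real (Suc j))))) c) \<longlonglongrightarrow> 0"
  proof -
    obtain K where K: "\<And>R. R \<ge> 1 \<Longrightarrow> norm h + norm k + norm l \<le> R \<Longrightarrow>
      \<bar>fdiff h (fdiff k (fdiff l (bavg 2 u R))) c\<bar> \<le> K * (?m * u c + 4 * bmass TYPE('n) 0) * inverse R"
      using bavg_fdiff3_bound[OF u, of h k l] by metis
    obtain N where N: "norm h + norm k + norm l \<le> real N" using real_arch_simple by blast
    show ?thesis
    proof (rule Lim_null_comparison)
      show "\<forall>\<^sub>F j in sequentially. norm (fdiff h (fdiff k (fdiff l (bavg 2 u (real (Suc j))))) c)
         \<le> K * (?m * u c + 4 * bmass TYPE('n) 0) * inverse (real (Suc j))"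
      proof (rule eventually_sequentiallyI)
        fix j assume "N \<le> j"
        then have "norm h + norm k + norm l \<le> real (Suc j)" using N by linarith
        then show "norm (fdiff h (fdiff k (fdiff l (bavg 2 u (real (Suc j))))) c)
         \<le> K * (?m * u c + 4 * bmass TYPE('n) 0) * inverse (real (Suc j))"
          unfolding real_norm_def by (intro K) auto
      qed
      show "(\<lambda>j. K * (?m * u c + 4 * bmass TYPE('n) 0) * inverse (real (Suc j))) \<longlonglongrightarrow> 0"
        by (rule tendsto_mult_right_zero[OF LIMSEQ_inverse_real_of_nat])
    qed
  qed
  have "fdiff h (fdiff k (fdiff l (\<lambda>x. ?m * (u x - pot u x)))) c = 0"
    using LIMSEQ_unique[OF lim1[unfolded eq] lim0] by simp
  moreover have "fdiff h (fdiff k (fdiff l (\<lambda>x. ?m * (u x - pot u x)))) c =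
     ?m * fdiff h (fdiff k (fdiff l (\<lambda>x. u x - pot u x))) c"
    by (simp only: fdiff_cmult)
  ultimately show ?thesis using bmass_pos[where 'n='n, of 2] by simp
qed

text \<open>The quadratic polynomial q = u - pot is diagonalised and its square completed. The signs
  come from u >= 0, the decay of \<open>pot\<close>, and q < 0 at a zero of u.\<close>

lemma obst_normal_form:
  fixes u :: "real^'n \<Rightarrow> real"
  assumes u: "obst u" and n: "CARD('n) \<ge> 3" and b: "bounded {y. u y = 0}" and i: "interior {y. u y = 0} \<noteq> {}"
  obtains e :: "'n \<Rightarrow> real^'n" and p c m where "\<And>i j. e i \<bullet> e j = (if i = j then 1 else 0)"
    "\<And>i. p i > 0" "m > 0" "\<And>x. u x = (\<Sum>i\<in>UNIV. p i * (e i \<bullet> (x - c))\<^sup>2) - m + pot u x"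
proof -
  define q where "q x = u x - pot u x" for x
  obtain K where K: "\<And>c. pot u c \<le> K" using pot_bounded[OF u n b] by metis
  have pos: "pot u x > 0" for x by (rule pot_pos[OF u n b i])
  have bdd: "\<exists>M. \<forall>x. norm x \<le> R \<longrightarrow> \<bar>q x\<bar> \<le> M" for R
  proof -
    have "bounded (u ` cball 0 R)"
      by (intro compact_imp_bounded compact_continuous_image continuous_on_subset[OF obst_continuous[OF u]]) auto
    then obtain M where M: "norm y \<le> M" if "y \<in> u ` cball 0 R" for y
      by (auto simp only: bounded_iff Ball_def)
    have "\<bar>q x\<bar> \<le> M + K" if "norm x \<le> R" for x
    proof -
      have "\<bar>u x\<bar> \<le> M" using M[OF imageI, of x] that by simp
      then show ?thesis using K[of x] pos[of x] unfolding q_def by linarith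
    qed
    then show ?thesis by blast
  qed
  obtain L B where LB: "linear L" "\<And>h. linear (B h)" "\<And>h k. B h k = B k h"
    "\<And>x. q x = q 0 + L x + B x x / 2"
  proof -
    have "fdiff h (fdiff k (fdiff l q)) x = 0" for h k l x
      unfolding q_def[abs_def] by (rule obst_minus_pot_fdiff3[OF u n b])
    from fdiff3_zero_imp_quadratic[OF this bdd] show thesis using that by metis
  qed
  obtain e :: "'n \<Rightarrow> real^'n" where e: "\<And>i j. e i \<bullet> e j = (if i = j then 1 else 0)"
    "\<And>i j. i \<noteq> j \<Longrightarrow> B (e i) (e j) = 0"
    using symmetric_form_diagonalization[OF LB(2,3)] by blast
  have linL: "linear (\<lambda>h. B h k)" for k
  proof -
    have "(\<lambda>h. B h k) = B k" using LB(3) by auto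
    then show ?thesis using LB(2) by simp
  qed
  obtain x0 where x0: "u x0 = 0" using i interior_subset by blast
  have qx0: "q x0 < 0" using x0 pos[of x0] by (simp add: q_def)
  define p where "p i = B (e i) (e i) / 2" for i
  \<comment> \<open>On the line through the zero x0, q is at least -pot, which far out exceeds q(x0)
    < 0. Adding the inequalities at T and -T cancels the linear term.\<close>
  have p: "p i > 0" for i
  proof -
    define \<beta> where "\<beta> = L (e i) + B x0 (e i)"
    have line: "q (x0 + t *\<^sub>R e i) = q x0 + \<beta> * t + p i * t\<^sup>2" for t
      using LB(4)[of "x0 + t *\<^sub>R e i"] LB(4)[of x0] LB(3)[of "e i" x0]
      by (simp add: linear_add[OF LB(1)] linear_scale[OF LB(1)] linear_add[OF LB(2)] linear_scale[OF LB(2)]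
          linear_add[OF linL] linear_scale[OF linL] \<beta>_def p_def power2_eq_square algebra_simps)
    obtain R where R: "\<And>c. norm c \<ge> R \<Longrightarrow> pot u c < - q x0"
      using pot_vanishes_at_infinity[OF u n b, of "- q x0"] qx0 by auto
    have "norm (e i) = 1" using e(1)[of i i] by (simp add: norm_eq_1)
    define T where "T = \<bar>R\<bar> + norm x0 + 1"
    have T: "T > 0" by (simp add: T_def add_nonneg_pos)
    have "\<beta> * t + p i * t\<^sup>2 > 0" if "\<bar>t\<bar> = T" for t
    proof -
      have "norm (x0 + t *\<^sub>R e i) \<ge> norm (t *\<^sub>R e i) - norm x0"
        using norm_triangle_ineq2[of "t *\<^sub>R e i" "- x0"] by (simp add: add.commute)
      then have "norm (x0 + t *\<^sub>R e i) \<ge> R" using that \<open>norm (e i) = 1\<close> by (simp add: T_def)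
      then have "pot u (x0 + t *\<^sub>R e i) < - q x0" by (rule R)
      moreover have "q (x0 + t *\<^sub>R e i) \<ge> - pot u (x0 + t *\<^sub>R e i)"
        using obst_nonneg[OF u] by (simp add: q_def)
      ultimately show ?thesis unfolding line by linarith
    qed
    from this[of T] this[of "- T"] T have "2 * (p i * T\<^sup>2) > 0" by simp
    then show ?thesis using T by (simp add: zero_less_mult_iff)
  qed
  define l where "l i = L (e i)" for i
  \<comment> \<open>The critical point of q, found by completing the square in each
    direction.\<close>
  define c where "c = (\<Sum>i\<in>UNIV. (- l i / (2 * p i)) *\<^sub>R e i)"
  have ec: "e i \<bullet> c = - l i / (2 * p i)" for i
    by (simp add: c_def inner_sum_right e(1) sum_negf if_distrib[of "\<lambda>a. _ * a"] cong: if_cong)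
  define m where "m = (\<Sum>i\<in>UNIV. (l i)\<^sup>2 / (4 * p i)) - q 0"
  have form: "q x = (\<Sum>i\<in>UNIV. p i * (e i \<bullet> (x - c))\<^sup>2) - m" for x
  proof -
    have x: "x = (\<Sum>i\<in>UNIV. (e i \<bullet> x) *\<^sub>R e i)" by (rule orthonormal_expansion[OF e(1)])
    have Lx: "L x = (\<Sum>i\<in>UNIV. (e i \<bullet> x) * l i)"
      by (subst x) (simp add: linear_sum[OF LB(1)] linear_scale[OF LB(1)] l_def)
    have "B (e j) x = (e j \<bullet> x) * (2 * p j)" for j
    proof -
      have "B (e j) x = (\<Sum>i\<in>UNIV. (e i \<bullet> x) * B (e j) (e i))"
        by (subst x) (simp add: linear_sum[OF LB(2)] linear_scale[OF LB(2)])
      also have "\<dots> = (\<Sum>i\<in>UNIV. if i = j then (e j \<bullet> x) * (2 * p j) else 0)"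
        by (rule sum.cong) (auto simp: e(2) p_def)
      finally show ?thesis by simp
    qed
    moreover have "B x x = (\<Sum>i\<in>UNIV. (e i \<bullet> x) * B (e i) x)"
    proof -
      have "B x x = B (\<Sum>i\<in>UNIV. (e i \<bullet> x) *\<^sub>R e i) x" using x by simp
      then show ?thesis by (simp add: linear_sum[OF linL] linear_scale[OF linL])
    qed
    ultimately have Bx: "B x x / 2 = (\<Sum>i\<in>UNIV. p i * (e i \<bullet> x)\<^sup>2)"
      by (simp add: power2_eq_square mult_ac sum_distrib_left sum_divide_distrib)
    have "p i * (e i \<bullet> (x - c))\<^sup>2 = p i * (e i \<bullet> x)\<^sup>2 + (e i \<bullet> x) * l i + (l i)\<^sup>2 / (4 * p i)" for i
      using p[of i] by (simp add: inner_diff_right ec power2_eq_square field_simps)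
    then show ?thesis using LB(4)[of x] Lx Bx by (simp add: m_def sum.distrib)
  qed
  have "m > 0"
  proof -
    have "(\<Sum>i\<in>UNIV. p i * (e i \<bullet> (x0 - c))\<^sup>2) \<ge> 0"
      using p by (intro sum_nonneg mult_nonneg_nonneg) (auto intro: less_imp_le)
    then show ?thesis using form[of x0] qx0 by linarith
  qed
  then show thesis using that[of e p m c] e(1) p form unfolding q_def by (metis diff_eq_eq)
qed

section \<open>Kernel integrals and Green's formula\<close>

lemma has_bochner_integral_FTC_atLeast:
  fixes f :: "real \<Rightarrow> real"
  assumes "f \<in> borel_measurable borel" "\<And>x. a \<le> x \<Longrightarrow> (F has_real_derivative f x) (at x)"
    "\<And>x. a \<le> x \<Longrightarrow> 0 \<le> f x" "(F \<longlongrightarrow> T) at_top"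
  shows "has_bochner_integral lborel (\<lambda>x. indicator {a..} x * f x) (T - F a)"
proof (rule has_bochner_integral_nn_integral)
  have "F a \<le> F x" if "a \<le> x" for x
    by (rule DERIV_nonneg_imp_nondecreasing[OF that]) (use assms(2,3) in blast)
  then have "F a \<le> T"
    by (intro tendsto_lowerbound[OF assms(4)] eventually_mono[OF eventually_ge_at_top[of a]]) auto
  then show "0 \<le> T - F a" by simp
  show "(\<integral>\<^sup>+x. ennreal (indicator {a..} x * f x) \<partial>lborel) = ennreal (T - F a)"
  proof -
    have "(\<integral>\<^sup>+x. ennreal (indicator {a..} x * f x) \<partial>lborel) = (\<integral>\<^sup>+x. ennreal (f x) * indicator {a..} x \<partial>lborel)"
      by (intro nn_integral_cong) (auto simp: indicator_def)
    also have "\<dots> = ennreal (T - F a)" by (rule nn_integral_FTC_atLeast[OF assms])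
    finally show ?thesis .
  qed
  show "AE x in lborel. 0 \<le> indicator {a..} x * f x"
    using assms(3) by (auto simp: indicator_def)
  show "(\<lambda>x. indicator {a..} x * f x) \<in> borel_measurable lborel"
    using assms(1) by measurable
qed

lemma has_bochner_integral_powr_atLeast:
  fixes \<epsilon> p a :: real
  assumes "\<epsilon> > 0" "p > 1" "a \<ge> 0"
  shows "has_bochner_integral lborel (\<lambda>s. indicator {a..} s * (\<epsilon> + s) powr (- p)) ((\<epsilon> + a) powr (1 - p) / (p - 1))"
proof -
  have "((\<lambda>s. - ((\<epsilon> + s) powr (1 - p) / (p - 1))) has_real_derivative (\<epsilon> + x) powr (- p)) (at x)" if "a \<le> x" for x
  proof -
    have "((\<lambda>s. - ((\<epsilon> + s) powr (1 - p) / (p - 1))) has_real_derivative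
       - ((1 - p) * (\<epsilon> + x) powr (1 - p - 1) / (p - 1))) (at x)"
      using assms that by (auto intro!: derivative_eq_intros has_real_derivative_powr[THEN DERIV_chain2])
    moreover have "- ((1 - p) * (\<epsilon> + x) powr (1 - p - 1) / (p - 1)) = (\<epsilon> + x) powr (- p)"
      using assms(2) by (simp add: field_simps)
    ultimately show ?thesis by metis
  qed
  moreover have "((\<lambda>s. - ((\<epsilon> + s) powr (1 - p) / (p - 1))) \<longlongrightarrow> - (0 / (p - 1))) at_top"
  proof -
    have "filterlim (\<lambda>s::real. \<epsilon> + s) at_top at_top"
      by (rule filterlim_tendsto_add_at_top[OF tendsto_const filterlim_ident])
    then have "((\<lambda>s. (\<epsilon> + s) powr (1 - p)) \<longlongrightarrow> 0) at_top"
      using assms(2) by (intro tendsto_neg_powr) auto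
    then show ?thesis using assms(2) by (intro tendsto_intros) auto
  qed
  ultimately have "has_bochner_integral lborel (\<lambda>s. indicator {a..} s * (\<epsilon> + s) powr (- p))
     (- (0 / (p - 1)) - - ((\<epsilon> + a) powr (1 - p) / (p - 1)))"
    by (intro has_bochner_integral_FTC_atLeast) auto
  then show ?thesis by simp
qed

text \<open>For t_i + s > 0 this is prod (t_i + s)^(-1/2), the density in the classical potential of
  an ellipsoid with squared semi-axes t_i. The exponential form is positive and measurable for all
  arguments and turns differentiation and convexity into statements about a sum of
  logarithms.\<close>

definition ell_kernel :: "('n::finite \<Rightarrow> real) \<Rightarrow> real \<Rightarrow> real" where
  "ell_kernel t s = exp (- (\<Sum>i\<in>UNIV. ln (t i + s)) / 2)"

lemma ell_kernel_pos [simp]: "ell_kernel t s > 0" "ell_kernel t s \<ge> 0" "ell_kernel t s \<noteq> 0"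
  by (simp_all add: ell_kernel_def)

lemma borel_measurable_ell_kernel [measurable]: "ell_kernel t \<in> borel_measurable borel"
  unfolding ell_kernel_def[abs_def] by measurable

lemma ell_kernel_le:
  fixes t :: "'n::finite \<Rightarrow> real"
  assumes "\<And>i. \<epsilon> \<le> t i" "\<epsilon> > 0" "s \<ge> 0"
  shows "ell_kernel t s \<le> (\<epsilon> + s) powr (- (real CARD('n) / 2))"
proof -
  have "real CARD('n) * ln (\<epsilon> + s) = (\<Sum>i\<in>(UNIV::'n set). ln (\<epsilon> + s))" by simp
  also have "\<dots> \<le> (\<Sum>i\<in>UNIV. ln (t i + s))"
  proof (rule sum_mono)
    fix i show "ln (\<epsilon> + s) \<le> ln (t i + s)" using assms(1)[of i] assms(2,3) by simp
  qed
  finally have "ell_kernel t s \<le> exp (- (real CARD('n) * ln (\<epsilon> + s)) / 2)" by (simp add: ell_kernel_def)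
  also have "\<dots> = (\<epsilon> + s) powr (- (real CARD('n) / 2))" using assms(2,3) by (simp add: powr_def)
  finally show ?thesis .
qed

text \<open>The common majorant of all kernels with every t_i >= epsilon; its exponent n/2 exceeds 1
  because n >= 3.\<close>

lemma integrable_dominating_kernel:
  assumes "CARD('n::finite) \<ge> 3" "\<epsilon> > 0"
  shows "integrable lborel (\<lambda>s. indicator {0..} s * (\<epsilon> + s) powr (- (real CARD('n) / 2)))"
  using has_bochner_integral_powr_atLeast[of \<epsilon> "real CARD('n) / 2" 0] assms
  by (auto simp: has_bochner_integral_iff)

lemma pos_lower_bound:
  fixes t :: "'n::finite \<Rightarrow> real"
  assumes "\<And>i. t i > 0"
  obtains \<epsilon> where "\<epsilon> > 0" "\<And>i. \<epsilon> \<le> t i"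
proof
  show "Min (range t) > 0" using assms by (subst Min_gr_iff) auto
  show "Min (range t) \<le> t i" for i by (rule Min_le) auto
qed

lemma integrable_ell_kernel_mult:
  fixes t :: "'n::finite \<Rightarrow> real"
  assumes n: "CARD('n) \<ge> 3" and t: "\<And>i. t i > 0" and f: "f \<in> borel_measurable borel"
    and le: "\<And>s. s \<ge> 0 \<Longrightarrow> \<bar>f s\<bar> \<le> M"
  shows "integrable lborel (\<lambda>s. indicator {0..} s * (f s * ell_kernel t s))"
proof -
  obtain \<epsilon> where \<epsilon>: "\<epsilon> > 0" "\<And>i. \<epsilon> \<le> t i" using pos_lower_bound[of t] t by blast
  have M: "M \<ge> 0" using le[of 0] by simp
  have "integrable lborel (\<lambda>s. M * (indicator {0..} s * (\<epsilon> + s) powr (- (real CARD('n) / 2))))"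
    by (intro integrable_mult_right integrable_dominating_kernel n \<epsilon>)
  then show ?thesis
  proof (rule Bochner_Integration.integrable_bound)
    show "(\<lambda>s. indicator {0..} s * (f s * ell_kernel t s)) \<in> borel_measurable lborel"
      using f by measurable
    have "norm (indicator {0..} s * (f s * ell_kernel t s)) \<le>
        norm (M * (indicator {0..} s * (\<epsilon> + s) powr (- (real CARD('n) / 2))))" for s
    proof (cases "s \<ge> 0")
      case True
      have "\<bar>f s\<bar> * ell_kernel t s \<le> M * (\<epsilon> + s) powr (- (real CARD('n) / 2))"
        using True M \<epsilon> by (intro mult_mono le ell_kernel_le) auto
      then show ?thesis using True M by (simp add: abs_mult)
    qed simp
    then show "AE s in lborel. norm (indicator {0..} s * (f s * ell_kernel t s)) \<le>
        norm (M * (indicator {0..} s * (\<epsilon> + s) powr (- (real CARD('n) / 2))))" by simp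
  qed
qed

lemma integrable_ell_kernel:
  fixes t :: "'n::finite \<Rightarrow> real"
  assumes "CARD('n) \<ge> 3" "\<And>i. t i > 0"
  shows "integrable lborel (\<lambda>s. indicator {0..} s * ell_kernel t s)"
  using integrable_ell_kernel_mult[of t "\<lambda>_. 1" 1] assms by simp

lemma ell_kernel_has_real_derivative:
  fixes t :: "'n::finite \<Rightarrow> real"
  assumes "\<And>i. t i > 0" "s \<ge> 0"
  shows "(ell_kernel t has_real_derivative - (\<Sum>i\<in>UNIV. 1 / (t i + s)) / 2 * ell_kernel t s) (at s)"
proof -
  have p: "t i + s > 0" for i using assms(1)[of i] assms(2) by simp
  have "((\<lambda>s. ln (t i + s)) has_real_derivative 1 / (t i + s)) (at s)" for i
    using p[of i] by (auto intro!: derivative_eq_intros)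
  then have "((\<lambda>s. \<Sum>i\<in>UNIV. ln (t i + s)) has_real_derivative (\<Sum>i\<in>UNIV. 1 / (t i + s))) (at s)"
    by (intro DERIV_sum) auto
  then have "((\<lambda>s. exp (- (\<Sum>i\<in>UNIV. ln (t i + s)) / 2)) has_real_derivative
      exp (- (\<Sum>i\<in>UNIV. ln (t i + s)) / 2) * (- (\<Sum>i\<in>UNIV. 1 / (t i + s)) / 2)) (at s)"
    by (intro DERIV_fun_exp DERIV_cdivide DERIV_minus)
  then show ?thesis unfolding ell_kernel_def[abs_def] by (simp add: mult.commute)
qed

lemma ell_kernel_tendsto_0:
  fixes t :: "'n::finite \<Rightarrow> real"
  assumes n: "CARD('n) \<ge> 3" and t: "\<And>i. t i > 0"
  shows "(ell_kernel t \<longlongrightarrow> 0) at_top"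
proof -
  obtain \<epsilon> where \<epsilon>: "\<epsilon> > 0" "\<And>i. \<epsilon> \<le> t i" using pos_lower_bound[of t] t by blast
  have "filterlim (\<lambda>s::real. \<epsilon> + s) at_top at_top"
    by (rule filterlim_tendsto_add_at_top[OF tendsto_const filterlim_ident])
  then have "((\<lambda>s. (\<epsilon> + s) powr (- (real CARD('n) / 2))) \<longlongrightarrow> 0) at_top"
    by (intro tendsto_neg_powr) auto
  then show ?thesis
    by (rule Lim_null_comparison[rotated])
      (auto intro!: eventually_mono[OF eventually_ge_at_top[of 0]] ell_kernel_le \<epsilon>)
qed

text \<open>The majorant has an explicit tail integral that tends to 0. This controls the decay of
  the potential of the ellipsoid in \<open>w_asymptotic\<close>.\<close>

lemma ell_kernel_tail:
  fixes t :: "'n::finite \<Rightarrow> real"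
  assumes n: "CARD('n) \<ge> 3" and t: "\<And>i. t i > 0" and d: "d > 0"
  shows "\<exists>A\<ge>0. \<forall>a\<ge>A. (LBINT s. indicator {a..} s * ell_kernel t s) < d"
proof -
  obtain \<epsilon> where \<epsilon>: "\<epsilon> > 0" "\<And>i. \<epsilon> \<le> t i" using pos_lower_bound[of t] t by blast
  define p where "p = real CARD('n) / 2"
  have p: "p > 1" using n by (simp add: p_def)
  have "filterlim (\<lambda>s::real. \<epsilon> + s) at_top at_top"
    by (rule filterlim_tendsto_add_at_top[OF tendsto_const filterlim_ident])
  then have "((\<lambda>s. (\<epsilon> + s) powr (1 - p)) \<longlongrightarrow> 0) at_top"
    using p by (intro tendsto_neg_powr) auto
  then have "((\<lambda>s. (\<epsilon> + s) powr (1 - p) / (p - 1)) \<longlongrightarrow> 0 / (p - 1)) at_top"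
    using p by (intro tendsto_intros) auto
  then have "\<forall>\<^sub>F s in at_top. (\<epsilon> + s) powr (1 - p) / (p - 1) < d"
    using d by (intro order_tendstoD) auto
  then obtain A where A: "\<And>a. a \<ge> A \<Longrightarrow> (\<epsilon> + a) powr (1 - p) / (p - 1) < d"
    unfolding eventually_at_top_linorder by blast
  have "(LBINT s. indicator {a..} s * ell_kernel t s) < d" if a: "a \<ge> max A 0" for a
  proof -
    have a0: "a \<ge> 0" using a by simp
    note hb = has_bochner_integral_powr_atLeast[OF \<epsilon>(1) p a0]
    have "(LBINT s. indicator {a..} s * ell_kernel t s) \<le> (LBINT s. indicator {a..} s * (\<epsilon> + s) powr (- p))"
    proof (rule integral_mono')
      show "integrable lborel (\<lambda>s. indicator {a..} s * (\<epsilon> + s) powr (- p))"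
        using hb by (simp add: has_bochner_integral_iff)
      show "indicator {a..} s * ell_kernel t s \<le> indicator {a..} s * (\<epsilon> + s) powr (- p)" for s
        using ell_kernel_le[OF \<epsilon>(2,1), of s] a0 by (auto simp: indicator_def p_def)
      show "0 \<le> indicator {a..} s * (\<epsilon> + s) powr (- p)" for s by simp
    qed
    also have "\<dots> = (\<epsilon> + a) powr (1 - p) / (p - 1)" using hb by (simp add: has_bochner_integral_iff)
    also have "\<dots> < d" using A a by simp
    finally show ?thesis .
  qed
  then show ?thesis by (intro exI[of _ "max A 0"]) auto
qed

lemma integrable_lborel_product:
  fixes a :: "'a::euclidean_space \<Rightarrow> real" and b :: "real \<Rightarrow> real"
  assumes "integrable lborel a" "integrable lborel b"
  shows "integrable (lborel \<Otimes>\<^sub>M lborel) (\<lambda>(x, y). a x * b y)"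
proof (rule lborel_pair.Fubini_integrable)
  have [measurable]: "a \<in> borel_measurable borel" "b \<in> borel_measurable borel"
    using assms borel_measurable_integrable by force+
  show "(\<lambda>(x, y). a x * b y) \<in> borel_measurable (lborel \<Otimes>\<^sub>M lborel)" by measurable
  show "integrable lborel (\<lambda>x. LINT y|lborel. norm (case (x, y) of (x, y) \<Rightarrow> a x * b y))"
    using assms by (simp add: abs_mult)
  show "AE x in lborel. integrable lborel (\<lambda>y. case (x, y) of (x, y) \<Rightarrow> a x * b y)"
    using assms by simp
qed

text \<open>Translating \<open>P\<close> along a direction does not change its integral; differentiate in the shift.\<close>

lemma integral_directional_derivative_eq_0:
  fixes P :: "real^'n \<Rightarrow> real"
  assumes der: "\<And>x. (P has_derivative DP x) (at x)" and cont: "continuous_on UNIV (\<lambda>x. DP x v)"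
    and supp: "\<And>x. x \<notin> cball c r \<Longrightarrow> P x = 0"
  shows "(LBINT x. DP x v) = 0"
proof -
  \<comment> \<open>Translates by s v with |s| <= 1 have their support in the ball of this
    radius.\<close>
  define \<rho> where "\<rho> = r + norm v"
  have contP: "continuous_on UNIV P"
    by (intro continuous_at_imp_continuous_on ballI has_derivative_continuous[OF der])
  obtain a b where ab: "cball c \<rho> \<subseteq> cbox a b" using cball_subset_cbox .
  have supp': "P (x + s *\<^sub>R v) = 0" if "x \<notin> cball c \<rho>" "\<bar>s\<bar> \<le> 1" for x s
  proof (rule supp)
    have "norm (s *\<^sub>R v) \<le> norm v" using mult_right_mono[OF that(2) norm_ge_zero[of v]] by simp
    moreover have "dist (x + s *\<^sub>R v) x = norm (s *\<^sub>R v)" by (simp add: dist_norm)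
    then have "dist c x \<le> dist c (x + s *\<^sub>R v) + norm (s *\<^sub>R v)"
      using dist_triangle[of c x "x + s *\<^sub>R v"] by linarith
    ultimately show "x + s *\<^sub>R v \<notin> cball c r" using that(1) by (auto simp: \<rho>_def)
  qed
  have suppD: "DP x v = 0" if "x \<notin> cball c \<rho>" for x
  proof -
    have "x \<notin> cball c r" using that norm_ge_zero[of v] unfolding mem_cball \<rho>_def by linarith
    then have x: "x \<in> - cball c r" by blast
    have "(P has_derivative (\<lambda>_. 0)) (at x)"
    proof (rule has_derivative_transform_within_open[OF _ _ x])
      show "0 = P y" if "y \<in> - cball c r" for y using supp[of y] that by (simp del: mem_cball)
    qed auto
    then have "DP x = (\<lambda>_. 0)" using der has_derivative_unique by blast
    then show ?thesis by simp
  qed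
  let ?U = "{-1<..<1::real}"
  have line: "((\<lambda>s. P (x + s *\<^sub>R v)) has_real_derivative DP (x + s *\<^sub>R v) v) (at s within ?U)" for x s
  proof -
    have "((\<lambda>s. x + s *\<^sub>R v) has_derivative (\<lambda>h. h *\<^sub>R v)) (at s)"
      by (auto intro!: derivative_eq_intros)
    from has_derivative_compose[OF this der[of "x + s *\<^sub>R v"]]
    have "((\<lambda>s. P (x + s *\<^sub>R v)) has_derivative (\<lambda>h. DP (x + s *\<^sub>R v) (h *\<^sub>R v))) (at s)" .
    moreover have "(\<lambda>h. DP (x + s *\<^sub>R v) (h *\<^sub>R v)) = (*) (DP (x + s *\<^sub>R v) v)"
      by (rule ext) (simp only: linear_scale[OF has_derivative_linear[OF der[of "x + s *\<^sub>R v"]]] real_scaleR_def mult.commute)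
    ultimately have "((\<lambda>s. P (x + s *\<^sub>R v)) has_derivative (*) (DP (x + s *\<^sub>R v) v)) (at s)" by (simp only:)
    then show ?thesis unfolding has_field_derivative_def by (rule has_derivative_at_withinI)
  qed
  have L: "((\<lambda>s. integral (cbox a b) (\<lambda>x. P (x + s *\<^sub>R v))) has_field_derivative
      integral (cbox a b) (\<lambda>x. DP (x + 0 *\<^sub>R v) v)) (at 0 within ?U)"
  proof (rule leibniz_rule_field_derivative)
    show "((\<lambda>s. P (x + s *\<^sub>R v)) has_real_derivative DP (x + s *\<^sub>R v) v) (at s within ?U)" for x s
      by (rule line)
    show "(\<lambda>x. P (x + s *\<^sub>R v)) integrable_on cbox a b" for s
      by (rule integrable_continuous, rule continuous_on_compose2[OF contP]) (auto intro!: continuous_intros)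
    have "continuous_on (?U \<times> cbox a b) (\<lambda>z. DP (snd z + fst z *\<^sub>R v) v)"
      by (rule continuous_on_compose2[OF cont]) (auto intro!: continuous_intros)
    then show "continuous_on (?U \<times> cbox a b) (\<lambda>(s, x). DP (x + s *\<^sub>R v) v)" by (simp add: split_beta)
  qed auto
  have D1: "((\<lambda>s. integral (cbox a b) (\<lambda>x. P (x + s *\<^sub>R v))) has_field_derivative
      integral (cbox a b) (\<lambda>x. DP x v)) (at 0)"
  proof -
    have "at 0 within ?U = at 0" by (rule at_within_open) auto
    then show ?thesis using L by (simp only: scaleR_zero_left add_0_right)
  qed
  have "integral (cbox a b) (\<lambda>x. P (x + s *\<^sub>R v)) = (LBINT x. P x)" if "s \<in> ?U" for s
  proof -
    have "continuous_on UNIV (\<lambda>x. P (x + s *\<^sub>R v))"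
      by (rule continuous_on_compose2[OF contP]) (auto intro!: continuous_intros)
    then have "integral (cbox a b) (\<lambda>x. P (x + s *\<^sub>R v)) = (LBINT x. P (x + s *\<^sub>R v))"
    proof (intro lborel_integral_eq_integral_cbox[symmetric, OF _ _ ab])
      show "P (x + s *\<^sub>R v) = 0" if "x \<notin> cball c \<rho>" for x
        by (rule supp'[OF that]) (use \<open>s \<in> ?U\<close> in auto)
    qed
    also have "\<dots> = (LBINT x. P x)"
      using integral_affine_euclidean[of 1 P "s *\<^sub>R v"] borel_measurable_continuous_onI[OF contP]
      by (simp add: add.commute)
    finally show ?thesis .
  qed
  then have "((\<lambda>s. LBINT x. P x) has_field_derivative integral (cbox a b) (\<lambda>x. DP x v)) (at 0)"
  proof (intro has_field_derivative_transform_within_open[OF D1])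
    show "open ?U" "0 \<in> ?U" by auto
  qed
  then have "integral (cbox a b) (\<lambda>x. DP x v) = 0" using DERIV_unique DERIV_const by blast
  moreover have "(LBINT x. DP x v) = integral (cbox a b) (\<lambda>x. DP x v)"
    by (rule lborel_integral_eq_integral_cbox[OF cont suppD ab])
  ultimately show ?thesis by simp
qed

text \<open>Green's formula one coordinate at a time: with b the bump, P = f b_j - f_j b has compact
  support and its j-th derivative is f b_jj - f_jj b, so the integral of the latter
  vanishes.\<close>

lemma integral_mult_bump_lap:
  fixes f :: "real^'n \<Rightarrow> real"
  assumes r: "r > 0"
    and f: "\<And>x. (f has_derivative Df x) (at x)"
    and f2: "\<And>j x. ((\<lambda>x. Df x (axis j 1)) has_derivative D2 j x) (at x)"
    and cont: "\<And>j. continuous_on UNIV (\<lambda>x. D2 j x (axis j 1))"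
  shows "(LBINT x. f x * bump_lap c r x) = (LBINT x. (\<Sum>j\<in>UNIV. D2 j x (axis j 1)) * bump 0 c r x)"
proof -
  have contf: "continuous_on UNIV f" "\<And>j. continuous_on UNIV (\<lambda>x. Df x (axis j 1))"
    by (intro continuous_at_imp_continuous_on ballI has_derivative_continuous[OF f] has_derivative_continuous[OF f2])+
  have z: "x \<notin> cball c r \<Longrightarrow> bump k c r x = 0" for x k using bump_eq_0 r by blast
  have zp: "x \<notin> cball c r \<Longrightarrow> partial (bump 0 c r) j x = 0" for x j by (simp add: partial_bump z)
  have zpp: "x \<notin> cball c r \<Longrightarrow> partial (partial (bump 0 c r) j) j x = 0" for x j by (simp add: partial_partial_bump z)
  have int1: "integrable lborel (\<lambda>x. f x * partial (partial (bump 0 c r) j) j x)" for j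
    by (rule integrable_continuous_cball[of _ c r], intro continuous_on_mult contf continuous_on_partial_partial_bump)
      (simp add: zpp del: mem_cball)
  have int2: "integrable lborel (\<lambda>x. D2 j x (axis j 1) * bump 0 c r x)" for j
    by (rule integrable_continuous_cball[of _ c r], intro continuous_on_mult cont continuous_on_bump)
      (simp add: z del: mem_cball)
  have "(LBINT x. f x * partial (partial (bump 0 c r) j) j x) = (LBINT x. D2 j x (axis j 1) * bump 0 c r x)" for j
  proof -
    let ?b = "bump 0 c r"
    define Db where "Db x = frechet_derivative ?b (at x)" for x
    define Dp where "Dp x = frechet_derivative (partial ?b j) (at x)" for x
    have Db: "(?b has_derivative Db x) (at x)" "Db x (axis j 1) = partial ?b j x" for x
    proof -
      show "(?b has_derivative Db x) (at x)" unfolding Db_def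
        using has_derivative_bump frechet_derivative_works differentiableI by blast
      show "Db x (axis j 1) = partial ?b j x" by (simp only: Db_def partial_def)
    qed
    have Dp: "(partial ?b j has_derivative Dp x) (at x)" "Dp x (axis j 1) = partial (partial ?b j) j x" for x
    proof -
      show "(partial ?b j has_derivative Dp x) (at x)" unfolding Dp_def
        using has_derivative_partial_bump_0 frechet_derivative_works differentiableI by blast
      show "Dp x (axis j 1) = partial (partial ?b j) j x" by (simp only: Dp_def partial_def[of "partial ?b j"])
    qed
    define P where "P x = f x * partial ?b j x - Df x (axis j 1) * ?b x" for x
    define DP where "DP x v = (f x * Dp x v + Df x v * partial ?b j x) - (Df x (axis j 1) * Db x v + D2 j x v * ?b x)" for x v
    have "(P has_derivative DP x) (at x)" for x
      unfolding P_def[abs_def] DP_def[abs_def]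
      by (intro has_derivative_diff has_derivative_mult f f2 Db Dp)
    moreover have DP: "DP x (axis j 1) = f x * partial (partial ?b j) j x - D2 j x (axis j 1) * ?b x" for x
      by (simp add: DP_def Db Dp)
    moreover have "continuous_on UNIV (\<lambda>x. DP x (axis j 1))"
      unfolding DP by (intro continuous_on_diff continuous_on_mult contf cont continuous_on_partial_partial_bump continuous_on_bump)
    moreover have "P x = 0" if "x \<notin> cball c r" for x using z[OF that] zp[OF that] by (simp add: P_def)
    ultimately have "(LBINT x. DP x (axis j 1)) = 0"
      using integral_directional_derivative_eq_0[of P DP "axis j 1" c r] by blast
    then show ?thesis unfolding DP using int1[of j] int2[of j] by simp
  qed
  then have "(\<Sum>j\<in>UNIV. LBINT x. f x * partial (partial (bump 0 c r) j) j x) =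
     (\<Sum>j\<in>UNIV. LBINT x. D2 j x (axis j 1) * bump 0 c r x)" by simp
  then have "(LBINT x. (\<Sum>j\<in>UNIV. f x * partial (partial (bump 0 c r) j) j x)) =
     (LBINT x. (\<Sum>j\<in>UNIV. D2 j x (axis j 1) * bump 0 c r x))"
    using int1 int2 by (simp add: Bochner_Integration.integral_sum)
  then show ?thesis
    by (simp add: sum_partial_partial_bump flip: sum_distrib_left sum_distrib_right)
qed

section \<open>The obstacle solution of an ellipsoid\<close>

text \<open>A smooth convex approximation of the positive part, shifted so that its derivative at \<open>0\<close>
  tends to \<open>0\<close>; no null-set argument for the boundary of the ellipsoid is then needed.\<close>

definition pospart :: "real \<Rightarrow> real \<Rightarrow> real" where
  "pospart d y = ((y - d) + sqrt ((y - d)\<^sup>2 + d ^ 4)) / 2"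

definition pospart1 :: "real \<Rightarrow> real \<Rightarrow> real" where
  "pospart1 d y = (1 + (y - d) / sqrt ((y - d)\<^sup>2 + d ^ 4)) / 2"

definition pospart2 :: "real \<Rightarrow> real \<Rightarrow> real" where
  "pospart2 d y = d ^ 4 / (2 * ((y - d)\<^sup>2 + d ^ 4) * sqrt ((y - d)\<^sup>2 + d ^ 4))"

lemma borel_measurable_pospart [measurable]:
  "pospart d \<in> borel_measurable borel" "pospart1 d \<in> borel_measurable borel" "pospart2 d \<in> borel_measurable borel"
  unfolding pospart_def[abs_def] pospart1_def[abs_def] pospart2_def[abs_def] by measurable

lemma pospart_has_real_derivative:
  assumes "d > 0"
  shows "(pospart d has_real_derivative pospart1 d y) (at y)"
    "(pospart1 d has_real_derivative pospart2 d y) (at y)"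
proof -
  define Q where "Q = (y - d)\<^sup>2 + d ^ 4"
  have Q: "Q > 0" using assms by (simp add: Q_def add_nonneg_pos)
  have D: "((\<lambda>y. sqrt ((y - d)\<^sup>2 + d ^ 4)) has_real_derivative (y - d) / sqrt Q) (at y)"
    using Q unfolding Q_def by (auto intro!: derivative_eq_intros simp: field_simps)
  have I: "((\<lambda>y. y - d) has_real_derivative 1) (at y)" by (auto intro!: derivative_eq_intros)
  from DERIV_cdivide[OF DERIV_add[OF I D], of 2]
  show "(pospart d has_real_derivative pospart1 d y) (at y)"
    unfolding pospart_def[abs_def] pospart1_def Q_def by simp
  have nz: "sqrt ((y - d)\<^sup>2 + d ^ 4) \<noteq> 0" using Q unfolding Q_def by simp
  have "((\<lambda>y. (y - d) / sqrt ((y - d)\<^sup>2 + d ^ 4)) has_real_derivative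
      (1 * sqrt Q - (y - d) * ((y - d) / sqrt Q)) / (sqrt Q * sqrt Q)) (at y)"
    using DERIV_divide[OF I D nz] unfolding Q_def .
  moreover have "(1 * sqrt Q - (y - d) * ((y - d) / sqrt Q)) / (sqrt Q * sqrt Q) = d ^ 4 / (Q * sqrt Q)"
  proof -
    have "1 * sqrt Q - (y - d) * ((y - d) / sqrt Q) = (Q - (y - d)\<^sup>2) / sqrt Q"
      using Q by (simp add: field_simps power2_eq_square)
    also have "Q - (y - d)\<^sup>2 = d ^ 4" by (simp add: Q_def)
    finally show ?thesis using Q by (simp add: field_simps)
  qed
  ultimately have "((\<lambda>y. (y - d) / sqrt ((y - d)\<^sup>2 + d ^ 4)) has_real_derivative d ^ 4 / (Q * sqrt Q)) (at y)" by simp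
  from DERIV_cdivide[OF DERIV_add[OF DERIV_const this], of 1 2]
  show "(pospart1 d has_real_derivative pospart2 d y) (at y)"
    unfolding pospart1_def[abs_def] pospart2_def Q_def[symmetric] by (simp add: mult_ac)
qed

lemma pospart1_bounds:
  assumes "d > 0"
  shows "0 \<le> pospart1 d y" "pospart1 d y \<le> 1"
proof -
  define z where "z = y - d"
  have "\<bar>z\<bar> \<le> sqrt (z\<^sup>2 + d ^ 4)" by (rule real_le_rsqrt) simp
  moreover have "sqrt (z\<^sup>2 + d ^ 4) > 0" using assms by (simp add: add_nonneg_pos)
  ultimately have "\<bar>z / sqrt (z\<^sup>2 + d ^ 4)\<bar> \<le> 1" by (simp add: abs_div)
  then show "0 \<le> pospart1 d y" "pospart1 d y \<le> 1"
    unfolding pospart1_def z_def[symmetric] abs_le_iff by simp_all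
qed

lemma pospart2_bounds:
  assumes "d > 0"
  shows "0 \<le> pospart2 d y" "pospart2 d y \<le> 1 / (2 * d\<^sup>2)"
proof -
  define Q where "Q = (y - d)\<^sup>2 + d ^ 4"
  have Q: "Q \<ge> d ^ 4" "Q > 0" using assms by (auto simp: Q_def add_nonneg_pos)
  have d4: "d ^ 4 = (d\<^sup>2)\<^sup>2" by simp
  have s: "sqrt Q \<ge> d\<^sup>2" using Q(1) unfolding d4 by (rule real_le_rsqrt)
  show "0 \<le> pospart2 d y" unfolding pospart2_def Q_def[symmetric] using Q assms by simp
  have "pospart2 d y = (d ^ 4 / Q) * (1 / (2 * sqrt Q))" unfolding pospart2_def Q_def[symmetric] by simp
  also have "\<dots> \<le> 1 * (1 / (2 * d\<^sup>2))"
    using Q s assms by (intro mult_mono) (auto simp: frac_le)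
  finally show "pospart2 d y \<le> 1 / (2 * d\<^sup>2)" by simp
qed

text \<open>The shift costs at most d, and the smoothing, of width d^2 <= d, at most another
  d.\<close>

lemma pospart_approx:
  assumes "d > 0" "d \<le> 1"
  shows "\<bar>pospart d y - max 0 y\<bar> \<le> 2 * d"
proof -
  define z where "z = y - d"
  have lo: "\<bar>z\<bar> \<le> sqrt (z\<^sup>2 + d ^ 4)" by (rule real_le_rsqrt) simp
  have "sqrt (z\<^sup>2 + d ^ 4) \<le> \<bar>z\<bar> + d\<^sup>2"
  proof (rule real_le_lsqrt)
    show "z\<^sup>2 + d ^ 4 \<le> (\<bar>z\<bar> + d\<^sup>2)\<^sup>2" by (simp add: power2_sum)
  qed auto
  moreover have "d\<^sup>2 \<le> d" using assms by (simp add: power2_eq_square mult_left_le_one_le)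
  ultimately have hi: "sqrt (z\<^sup>2 + d ^ 4) \<le> \<bar>z\<bar> + d" by linarith
  have "pospart d y = (z + sqrt (z\<^sup>2 + d ^ 4)) / 2" by (simp add: pospart_def z_def)
  with lo hi assms(1) show ?thesis by (simp add: z_def max_def abs_if split: if_splits)
qed


text \<open>The ellipsoid with centre c, axis directions e_i and squared semi-axes t_i.\<close>

locale ellipsoid_data =
  fixes e :: "'n::finite \<Rightarrow> real^'n" and t :: "'n \<Rightarrow> real" and c :: "real^'n"
  assumes on: "e i \<bullet> e j = (if i = j then 1 else 0)" and tpos: "t i > 0" and card: "CARD('n) \<ge> 3"
begin

abbreviation y :: "'n \<Rightarrow> real^'n \<Rightarrow> real" where
  "y i x \<equiv> e i \<bullet> (x - c)"

text \<open>The set where this vanishes, for fixed s >= 0, is the boundary of the confocal ellipsoid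
  with squared semi-axes t_i + s.\<close>

definition F :: "real^'n \<Rightarrow> real \<Rightarrow> real" where
  "F x s = (\<Sum>i\<in>UNIV. (y i x)\<^sup>2 / (t i + s)) - 1"

text \<open>The gradient of \<open>F\<close> in x.\<close>

definition G :: "real^'n \<Rightarrow> real \<Rightarrow> real^'n" where
  "G x s = (\<Sum>i\<in>UNIV. (2 * y i x / (t i + s)) *\<^sub>R e i)"

text \<open>The Laplacian in x of \<open>pospart d (F x s)\<close>: the first sum is the Laplacian
  of \<open>F\<close>, the second one the squared norm of its gradient.\<close>

definition lap :: "real \<Rightarrow> real^'n \<Rightarrow> real \<Rightarrow> real" where
  "lap d x s = pospart1 d (F x s) * (\<Sum>i\<in>UNIV. 2 / (t i + s)) +
     pospart2 d (F x s) * (\<Sum>i\<in>UNIV. (2 * y i x / (t i + s))\<^sup>2)"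

abbreviation K :: "real \<Rightarrow> real" where "K \<equiv> ell_kernel t"

text \<open>The classical formula for the potential of an ellipsoid integrates \<open>- F x s\<close> over the confocal
  ellipsoids that contain the point \<open>x\<close>; adding the quadratic polynomial leaves the integral of the
  positive part of \<open>F x s\<close>.\<close>

definition w :: "real^'n \<Rightarrow> real" where
  "w x = (LBINT s. indicator {0..} s * (max 0 (F x s) * K s)) / (4 * K 0)"

definition w_approx :: "real \<Rightarrow> real^'n \<Rightarrow> real" where
  "w_approx d x = (LBINT s. indicator {0..} s * (pospart d (F x s) * K s)) / (4 * K 0)"

text \<open>A bound for |F x s| uniform in s >= 0, used to dominate the integrals over s.\<close>

definition A :: "real^'n \<Rightarrow> real" where
  "A x = (\<Sum>i\<in>UNIV. (y i x)\<^sup>2 / t i) + 1"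

lemma ts_pos: "s \<ge> 0 \<Longrightarrow> t i + s > 0" and ts_nz: "s \<ge> 0 \<Longrightarrow> t i + s \<noteq> 0"
  using tpos[of i] by auto

lemma K_pos [simp]: "K s > 0" "K s \<ge> 0" by simp_all

lemma integrable_K: "integrable lborel (\<lambda>s. indicator {0..} s * K s)"
  by (rule integrable_ell_kernel) (use card tpos in auto)

lemma measurable_F [measurable]: "(\<lambda>z. F (fst z) (snd z)) \<in> borel_measurable (borel \<Otimes>\<^sub>M borel)"
  unfolding F_def by measurable

lemma measurable_F_s [measurable]: "F x \<in> borel_measurable borel"
  unfolding F_def[abs_def] by measurable

lemma measurable_lap [measurable]: "(\<lambda>z. lap d (fst z) (snd z)) \<in> borel_measurable (borel \<Otimes>\<^sub>M borel)"
  unfolding lap_def by measurable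

lemma measurable_lap_s [measurable]: "lap d x \<in> borel_measurable borel"
  unfolding lap_def[abs_def] by measurable

lemma divide_ts_le: "s \<ge> 0 \<Longrightarrow> a \<ge> 0 \<Longrightarrow> a / (t i + s) \<le> a / t i"
  using tpos[of i] by (intro divide_left_mono) auto

lemma F_bounds:
  assumes "s \<ge> 0"
  shows "-1 \<le> F x s" "\<bar>F x s\<bar> \<le> A x"
proof -
  have "0 \<le> (\<Sum>i\<in>UNIV. (y i x)\<^sup>2 / (t i + s))"
    using ts_pos[OF assms] by (intro sum_nonneg divide_nonneg_pos) auto
  moreover have "(\<Sum>i\<in>UNIV. (y i x)\<^sup>2 / (t i + s)) \<le> (\<Sum>i\<in>UNIV. (y i x)\<^sup>2 / t i)"
    by (intro sum_mono divide_ts_le assms) auto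
  ultimately show "-1 \<le> F x s" "\<bar>F x s\<bar> \<le> A x" by (auto simp: F_def A_def)
qed

lemma A_nonneg: "A x \<ge> 0"
  using F_bounds(2)[of 0 x] by linarith

lemma continuous_on_A: "continuous_on S A"
  unfolding A_def[abs_def] using tpos by (intro continuous_intros) (auto simp: less_imp_neq[symmetric])

lemma integrable_mult_K:
  assumes "f \<in> borel_measurable borel" "\<And>s. s \<ge> 0 \<Longrightarrow> \<bar>f s\<bar> \<le> M"
  shows "integrable lborel (\<lambda>s. indicator {0..} s * (f s * K s))"
  by (rule integrable_ell_kernel_mult[OF card tpos assms]) 

lemma integrable_w: "integrable lborel (\<lambda>s. indicator {0..} s * (max 0 (F x s) * K s))"
proof (rule integrable_mult_K[where M="A x"])
  show "\<bar>max 0 (F x s)\<bar> \<le> A x" if "s \<ge> 0" for s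
    using F_bounds(2)[OF that, of x] by (auto simp: max_def)
qed measurable

lemma integrable_w_approx:
  assumes "0 < d" "d \<le> 1"
  shows "integrable lborel (\<lambda>s. indicator {0..} s * (pospart d (F x s) * K s))"
proof (rule integrable_mult_K[where M="A x + 2"])
  fix s :: real assume "s \<ge> 0"
  then show "\<bar>pospart d (F x s)\<bar> \<le> A x + 2"
    using pospart_approx[OF assms, of "F x s"] F_bounds(2)[of s x] assms(2) by (auto simp: max_def split: if_splits)
qed measurable

lemma integral_abs_diff_K_le:
  assumes f: "integrable lborel (\<lambda>s. indicator {0..} s * (f s * K s))"
    and g: "integrable lborel (\<lambda>s. indicator {0..} s * (g s * K s))"
    and le: "\<And>s. s \<ge> 0 \<Longrightarrow> \<bar>f s - g s\<bar> \<le> M"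
  shows "\<bar>(LBINT s. indicator {0..} s * (f s * K s)) - (LBINT s. indicator {0..} s * (g s * K s))\<bar>
     \<le> M * (LBINT s. indicator {0..} s * K s)"
proof -
  have "(LBINT s. indicator {0..} s * (f s * K s)) - (LBINT s. indicator {0..} s * (g s * K s))
     = (LBINT s. indicator {0..} s * (f s * K s) - indicator {0..} s * (g s * K s))"
    using f g by simp
  also have "\<bar>\<dots>\<bar> \<le> (LBINT s. M * (indicator {0..} s * K s))"
  proof (rule integral_abs_bound_integral)
    show "integrable lborel (\<lambda>s. indicator {0..} s * (f s * K s) - indicator {0..} s * (g s * K s))"
      using f g by simp
    show "integrable lborel (\<lambda>s. M * (indicator {0..} s * K s))" using integrable_K by simp
    fix s :: real
    have "\<bar>f s - g s\<bar> * K s \<le> M * K s" if "s \<ge> 0" using le[OF that] by (intro mult_right_mono) auto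
    then show "\<bar>indicator {0..} s * (f s * K s) - indicator {0..} s * (g s * K s)\<bar> \<le> M * (indicator {0..} s * K s)"
      by (auto simp: indicator_def abs_mult simp flip: left_diff_distrib)
  qed
  finally show ?thesis by simp
qed

lemma w_approx_diff:
  assumes "0 < d" "d \<le> 1"
  shows "\<bar>w_approx d x - w x\<bar> \<le> 2 * d * ((LBINT s. indicator {0..} s * K s) / (4 * K 0))"
proof -
  have "\<bar>(LBINT s. indicator {0..} s * (pospart d (F x s) * K s)) - (LBINT s. indicator {0..} s * (max 0 (F x s) * K s))\<bar>
     \<le> 2 * d * (LBINT s. indicator {0..} s * K s)"
    by (intro integral_abs_diff_K_le integrable_w integrable_w_approx pospart_approx assms)
  then have "\<bar>(LBINT s. indicator {0..} s * (pospart d (F x s) * K s)) - (LBINT s. indicator {0..} s * (max 0 (F x s) * K s))\<bar> / (4 * K 0)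
     \<le> 2 * d * (LBINT s. indicator {0..} s * K s) / (4 * K 0)"
    by (rule divide_right_mono) simp
  then show ?thesis unfolding w_def w_approx_def by (simp flip: diff_divide_distrib)
qed

lemma w_nonneg: "w x \<ge> 0"
  unfolding w_def by (intro divide_nonneg_pos Bochner_Integration.integral_nonneg) auto

text \<open>The positive part is 1-Lipschitz, and |F z s - F x s| is at most \<open>D z\<close>,
  uniformly in s >= 0, where \<open>D\<close> is continuous and vanishes at x.\<close>

lemma continuous_on_w: "continuous_on UNIV w"
proof (rule continuous_at_imp_continuous_on, rule ballI)
  fix x
  define C where "C = (LBINT s. indicator {0..} s * K s) / (4 * K 0)"
  define D where "D z = (\<Sum>i\<in>UNIV. \<bar>(y i z)\<^sup>2 - (y i x)\<^sup>2\<bar> / t i)" for z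
  have "\<bar>w z - w x\<bar> \<le> D z * C" for z
  proof -
    have "\<bar>max 0 (F z s) - max 0 (F x s)\<bar> \<le> D z" if s: "s \<ge> 0" for s
    proof -
      have "\<bar>F z s - F x s\<bar> = \<bar>\<Sum>i\<in>UNIV. ((y i z)\<^sup>2 - (y i x)\<^sup>2) / (t i + s)\<bar>"
        by (simp add: F_def sum_subtractf diff_divide_distrib)
      also have "\<dots> \<le> (\<Sum>i\<in>UNIV. \<bar>((y i z)\<^sup>2 - (y i x)\<^sup>2) / (t i + s)\<bar>)" by (rule sum_abs)
      also have "\<dots> \<le> D z" unfolding D_def
      proof (rule sum_mono)
        fix i
        show "\<bar>((y i z)\<^sup>2 - (y i x)\<^sup>2) / (t i + s)\<bar> \<le> \<bar>(y i z)\<^sup>2 - (y i x)\<^sup>2\<bar> / t i"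
          using divide_ts_le[OF s, of "\<bar>(y i z)\<^sup>2 - (y i x)\<^sup>2\<bar>" i] ts_pos[OF s, of i] by (simp add: abs_div)
      qed
      finally have "\<bar>F z s - F x s\<bar> \<le> D z" .
      then show ?thesis by (auto simp: max_def abs_if split: if_splits)
    qed
    from integral_abs_diff_K_le[OF integrable_w integrable_w this]
    have "\<bar>(LBINT s. indicator {0..} s * (max 0 (F z s) * K s)) - (LBINT s. indicator {0..} s * (max 0 (F x s) * K s))\<bar> / (4 * K 0)
     \<le> D z * (LBINT s. indicator {0..} s * K s) / (4 * K 0)"
      by (intro divide_right_mono) auto
    then show ?thesis unfolding w_def C_def by (simp flip: diff_divide_distrib)
  qed
  moreover have "continuous_on UNIV (\<lambda>z. D z * C)"
    unfolding D_def using tpos by (intro continuous_intros) (auto simp: less_imp_neq[symmetric])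
  then have "((\<lambda>z. D z * C) \<longlongrightarrow> D x * C) (at x)"
    by (simp add: continuous_on_def)
  then have "((\<lambda>z. D z * C) \<longlongrightarrow> 0) (at x)" by (simp add: D_def)
  ultimately have "((\<lambda>z. w z - w x) \<longlongrightarrow> 0) (at x)"
    by (intro Lim_null_comparison[of "\<lambda>z. w z - w x" "\<lambda>z. D z * C"]) auto
  then show "isCont w x" unfolding isCont_def by (rule LIM_zero_cancel)
qed

text \<open>\<open>F x s\<close> does not increase in s, so F x 0 <= 0 makes the integrand vanish
  identically. If F x 0 > 0, the integrand is positive on an interval next to 0.\<close>

lemma w_eq_0_iff: "w x = 0 \<longleftrightarrow> F x 0 \<le> 0"
proof
  assume "F x 0 \<le> 0"
  have "F x s \<le> 0" if "s \<ge> 0" for s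
  proof -
    have "F x s \<le> F x 0" unfolding F_def using divide_ts_le[OF that] by (simp add: sum_mono)
    with \<open>F x 0 \<le> 0\<close> show ?thesis by simp
  qed
  then have "indicator {0..} s * (max 0 (F x s) * K s) = 0" for s
    by (cases "s \<ge> 0") (auto simp: max_absorb1)
  then show "w x = 0" unfolding w_def by (simp only:) simp
next
  assume w0: "w x = 0"
  show "F x 0 \<le> 0"
  proof (rule ccontr)
    assume "\<not> ?thesis"
    then have pos: "F x 0 > 0" by simp
    have "continuous_on {0..} (F x)" unfolding F_def[abs_def]
      by (intro continuous_intros) (use ts_nz in auto)
    then have "(F x \<longlongrightarrow> F x 0) (at 0 within {0..})" by (simp add: continuous_on_def)
    then have "\<forall>\<^sub>F s in at 0 within {0..}. F x s > 0" using pos by (rule order_tendstoD)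
    then obtain \<delta> where \<delta>: "\<delta> > 0" "\<And>s. s \<ge> 0 \<Longrightarrow> s \<noteq> 0 \<Longrightarrow> dist s 0 < \<delta> \<Longrightarrow> F x s > 0"
      unfolding eventually_at by auto
    have "(LBINT s. indicator {0..} s * (max 0 (F x s) * K s)) = 0" using w0 by (simp add: w_def)
    then have "AE s in lborel. indicator {0..} s * (max 0 (F x s) * K s) = 0"
      using integral_nonneg_eq_0_iff_AE[OF integrable_w[of x]] by simp
    then have "AE s in lborel. s \<notin> {0<..<\<delta>}"
    proof eventually_elim
      case (elim s)
      show ?case
      proof
        assume "s \<in> {0<..<\<delta>}"
        then have "F x s > 0" "s \<ge> 0" by (auto intro!: \<delta>)
        with elim show False by (simp add: max_def)
      qed
    qed
    then have "{0<..<\<delta>} \<in> null_sets lborel" by (subst (asm) AE_iff_null_sets[symmetric]) auto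
    then show False using \<delta>(1) by (auto simp: null_sets_def)
  qed
qed


section \<open>The weak equation for the regularised ellipsoid solution\<close>

lemma y_has_derivative: "((\<lambda>x. y i x) has_derivative (\<lambda>v. e i \<bullet> v)) (at x)"
  by (auto intro!: derivative_eq_intros)

lemma F_has_derivative: 
  assumes s: "s \<ge> 0"
  shows "((\<lambda>x. F x s) has_derivative (\<lambda>v. G x s \<bullet> v)) (at x)"
proof -
  have "((\<lambda>x. (y i x)\<^sup>2 / (t i + s)) has_derivative (\<lambda>v. (2 * y i x / (t i + s)) * (e i \<bullet> v))) (at x)" for i
  proof -
    have "((\<lambda>x. (y i x)\<^sup>2) has_derivative (\<lambda>v. 2 * y i x * (e i \<bullet> v))) (at x)"
      using y_has_derivative[of i x] by (auto intro!: derivative_eq_intros)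
    from has_derivative_mult_left[OF this, of "inverse (t i + s)"]
    show ?thesis by (simp add: divide_inverse mult_ac)
  qed
  then have "((\<lambda>x. (\<Sum>i\<in>UNIV. (y i x)\<^sup>2 / (t i + s)) - 1) has_derivative
      (\<lambda>v. (\<Sum>i\<in>UNIV. (2 * y i x / (t i + s)) * (e i \<bullet> v)) - 0)) (at x)"
    by (intro has_derivative_diff has_derivative_sum has_derivative_const)
  moreover have "(\<Sum>i\<in>UNIV. (2 * y i x / (t i + s)) * (e i \<bullet> v)) - 0 = G x s \<bullet> v" for v
    by (simp add: G_def inner_sum_left)
  ultimately show ?thesis unfolding F_def[abs_def] by simp
qed

lemma G_component_has_derivative:
  "((\<lambda>x. G x s \<bullet> a) has_derivative (\<lambda>v. \<Sum>i\<in>UNIV. 2 * (e i \<bullet> v) * (e i \<bullet> a) / (t i + s))) (at x)"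
proof -
  have "((\<lambda>x. (2 * (e i \<bullet> a) / (t i + s)) * y i x) has_derivative (\<lambda>v. (2 * (e i \<bullet> a) / (t i + s)) * (e i \<bullet> v))) (at x)" for i
    by (intro has_derivative_mult_right y_has_derivative)
  then have "((\<lambda>x. \<Sum>i\<in>UNIV. (2 * (e i \<bullet> a) / (t i + s)) * y i x) has_derivative
     (\<lambda>v. \<Sum>i\<in>UNIV. (2 * (e i \<bullet> a) / (t i + s)) * (e i \<bullet> v))) (at x)"
    by (rule has_derivative_sum)
  then show ?thesis by (simp add: G_def inner_sum_left mult_ac)
qed

lemma sum_axis_inner: "(\<Sum>j\<in>UNIV. (v \<bullet> axis j 1)\<^sup>2) = v \<bullet> (v :: real^'n)"
  by (simp only: inner_axis) (simp add: inner_vec_def power2_eq_square)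

lemma G_inner_G: "G x s \<bullet> G x s = (\<Sum>i\<in>UNIV. (2 * y i x / (t i + s))\<^sup>2)"
  unfolding G_def by (simp add: inner_sum_left inner_sum_right on power2_eq_square if_distrib[of "\<lambda>a. _ * a"] cong: if_cong)

lemma continuous_on_F: "s \<ge> 0 \<Longrightarrow> continuous_on UNIV (\<lambda>x. F x s)"
  by (intro continuous_at_imp_continuous_on ballI has_derivative_continuous[OF F_has_derivative])

lemma integral_pospart_bump_lap:
  assumes d: "d > 0" and s: "s \<ge> 0" and r: "r > 0"
  shows "(LBINT x. pospart d (F x s) * bump_lap a r x) = (LBINT x. lap d x s * bump 0 a r x)"
proof -
  define Df where "Df x v = (G x s \<bullet> v) * pospart1 d (F x s)" for x v
  define D2 where "D2 j x v = (G x s \<bullet> axis j 1) * ((G x s \<bullet> v) * pospart2 d (F x s)) +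
     (\<Sum>i\<in>UNIV. 2 * (e i \<bullet> v) * (e i \<bullet> axis j 1) / (t i + s)) * pospart1 d (F x s)" for j x and v :: "real^'n"
  have 1: "((\<lambda>x. pospart d (F x s)) has_derivative Df x) (at x)" for x
    unfolding Df_def[abs_def]
    by (rule DERIV_compose_FDERIV[OF pospart_has_real_derivative(1)[OF d] F_has_derivative[OF s]])
  have p1: "((\<lambda>x. pospart1 d (F x s)) has_derivative (\<lambda>v. (G x s \<bullet> v) * pospart2 d (F x s))) (at x)" for x
    by (rule DERIV_compose_FDERIV[OF pospart_has_real_derivative(2)[OF d] F_has_derivative[OF s]])
  have 2: "((\<lambda>x. Df x (axis j 1)) has_derivative D2 j x) (at x)" for j x
    unfolding Df_def D2_def[abs_def] by (rule has_derivative_mult[OF G_component_has_derivative p1])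
  have cG: "continuous_on UNIV (\<lambda>x. G x s \<bullet> a)" for a
    by (intro continuous_at_imp_continuous_on ballI has_derivative_continuous[OF G_component_has_derivative])
  have c1: "continuous_on UNIV (\<lambda>x. pospart1 d (F x s))"
    by (intro continuous_at_imp_continuous_on ballI has_derivative_continuous[OF p1])
  have c2: "continuous_on UNIV (\<lambda>x. pospart2 d (F x s))"
  proof -
    have nz: "sqrt ((F x s - d)\<^sup>2 + d ^ 4) \<noteq> 0" "(F x s - d)\<^sup>2 + d ^ 4 \<noteq> 0" for x
      using d add_nonneg_pos[of "(F x s - d)\<^sup>2" "d ^ 4"] by auto
    show ?thesis unfolding pospart2_def
      by (intro continuous_intros continuous_on_F[OF s]) (rule ballI, simp only: mult_eq_0_iff nz, simp)
  qed
  have 3: "continuous_on UNIV (\<lambda>x. D2 j x (axis j 1))" for j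
    unfolding D2_def by (intro continuous_on_add continuous_on_mult cG c1 c2 continuous_on_const)
  have "(\<Sum>j\<in>UNIV. D2 j x (axis j 1)) = lap d x s" for x
  proof -
    \<comment> \<open>The squared components of each unit vector \<open>e i\<close> add up to 1,
      which removes the sum over coordinates.\<close>
    have "(\<Sum>j\<in>UNIV. \<Sum>i\<in>UNIV. 2 * (e i \<bullet> axis j 1) * (e i \<bullet> axis j 1) / (t i + s))
        = (\<Sum>i\<in>UNIV. \<Sum>j\<in>UNIV. 2 / (t i + s) * (e i \<bullet> axis j 1)\<^sup>2)"
      by (subst sum.swap) (simp add: power2_eq_square mult_ac)
    also have "\<dots> = (\<Sum>i\<in>UNIV. 2 / (t i + s))"
      by (simp only: sum_distrib_left[symmetric] sum_axis_inner on) simp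
    finally have a: "(\<Sum>j\<in>UNIV. \<Sum>i\<in>UNIV. 2 * (e i \<bullet> axis j 1) * (e i \<bullet> axis j 1) / (t i + s))
       = (\<Sum>i\<in>UNIV. 2 / (t i + s))" .
    have b: "(\<Sum>j\<in>UNIV. (G x s \<bullet> axis j 1) * ((G x s \<bullet> axis j 1) * pospart2 d (F x s)))
       = (\<Sum>i\<in>UNIV. (2 * y i x / (t i + s))\<^sup>2) * pospart2 d (F x s)"
      unfolding G_inner_G[symmetric] sum_axis_inner[symmetric] sum_distrib_right
      by (simp add: power2_eq_square mult_ac)
    show ?thesis unfolding D2_def sum.distrib b sum_distrib_right[symmetric] a lap_def by simp
  qed
  then show ?thesis using integral_mult_bump_lap[OF r 1 2 3, of a] by simp
qed

lemma lap_nonneg: "d > 0 \<Longrightarrow> s \<ge> 0 \<Longrightarrow> lap d x s \<ge> 0"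
  unfolding lap_def using pospart1_bounds pospart2_bounds ts_pos
  by (intro add_nonneg_nonneg mult_nonneg_nonneg sum_nonneg divide_nonneg_pos) auto

lemma lap_le:
  assumes d: "d > 0" and s: "s \<ge> 0"
  shows "lap d x s \<le> (\<Sum>i\<in>UNIV. 2 / t i) + 1 / (2 * d\<^sup>2) * (\<Sum>i\<in>UNIV. (2 * y i x / t i)\<^sup>2)"
proof -
  have "pospart1 d (F x s) * (\<Sum>i\<in>UNIV. 2 / (t i + s)) \<le> 1 * (\<Sum>i\<in>UNIV. 2 / t i)"
    using ts_pos[OF s] tpos
    by (intro mult_mono pospart1_bounds d sum_mono divide_ts_le s sum_nonneg divide_nonneg_pos) auto
  moreover have "pospart2 d (F x s) * (\<Sum>i\<in>UNIV. (2 * y i x / (t i + s))\<^sup>2)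
     \<le> 1 / (2 * d\<^sup>2) * (\<Sum>i\<in>UNIV. (2 * y i x / t i)\<^sup>2)"
  proof (intro mult_mono pospart2_bounds d sum_mono sum_nonneg)
    fix i
    have "\<bar>2 * y i x / (t i + s)\<bar> \<le> \<bar>2 * y i x / t i\<bar>"
      using divide_ts_le[OF s, of "\<bar>2 * y i x\<bar>" i] ts_pos[OF s, of i] tpos[of i] by (simp add: abs_div)
    then show "(2 * y i x / (t i + s))\<^sup>2 \<le> (2 * y i x / t i)\<^sup>2" by (simp only: abs_le_square_iff)
  qed (use d in auto)
  ultimately show ?thesis unfolding lap_def by simp
qed

text \<open>The Laplacian of the integrand is an exact derivative in the confocal parameter \<open>s\<close>.\<close>

lemma integral_lap:
  assumes d: "d > 0"
  shows "has_bochner_integral lborel (\<lambda>s. indicator {0..} s * (lap d x s * K s)) (4 * K 0 * pospart1 d (F x 0))"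
proof -
  have der: "((\<lambda>s. - 4 * (pospart1 d (F x s) * K s)) has_real_derivative lap d x s * K s) (at s)" if s: "s \<ge> 0" for s
  proof -
    have "((\<lambda>s. (y i x)\<^sup>2 / (t i + s)) has_real_derivative - ((y i x)\<^sup>2 / (t i + s)\<^sup>2)) (at s)" for i
      using ts_pos[OF s, of i] by (auto intro!: derivative_eq_intros simp: power2_eq_square field_simps)
    then have "((\<lambda>s. (\<Sum>i\<in>UNIV. (y i x)\<^sup>2 / (t i + s)) - 1) has_real_derivative (\<Sum>i\<in>UNIV. - ((y i x)\<^sup>2 / (t i + s)\<^sup>2)) - 0) (at s)"
      by (intro DERIV_diff DERIV_sum DERIV_const)
    moreover define S where "S = (\<Sum>i\<in>UNIV. (y i x)\<^sup>2 / (t i + s)\<^sup>2)"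
    ultimately have Fs: "(F x has_real_derivative - S) (at s)"
      unfolding F_def[abs_def] by (simp add: sum_negf)
    define T where "T = (\<Sum>i\<in>UNIV. 1 / (t i + s))"
    have "(K has_real_derivative - T / 2 * K s) (at s)"
      unfolding T_def by (rule ell_kernel_has_real_derivative[OF tpos s])
    from DERIV_mult[OF DERIV_chain2[OF pospart_has_real_derivative(2)[OF d] Fs] this]
    have "((\<lambda>s. pospart1 d (F x s) * K s) has_real_derivative
       pospart2 d (F x s) * - S * K s + - T / 2 * K s * pospart1 d (F x s)) (at s)" .
    from DERIV_cmult[OF this, of "- 4"]
    have "((\<lambda>s. - 4 * (pospart1 d (F x s) * K s)) has_real_derivative
      - 4 * (pospart2 d (F x s) * - S * K s + - T / 2 * K s * pospart1 d (F x s))) (at s)" .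
    moreover have "(\<Sum>i\<in>UNIV. 2 / (t i + s)) = 2 * T" unfolding T_def sum_distrib_left by simp
    moreover have "(\<Sum>i\<in>UNIV. (2 * y i x / (t i + s))\<^sup>2) = 4 * S"
      unfolding S_def sum_distrib_left by (simp add: power_divide power_mult_distrib)
    ultimately show ?thesis unfolding lap_def by (simp add: algebra_simps)
  qed
  have lim: "((\<lambda>s. - 4 * (pospart1 d (F x s) * K s)) \<longlongrightarrow> 0) at_top"
  proof (rule Lim_null_comparison)
    show "\<forall>\<^sub>F s in at_top. norm (- 4 * (pospart1 d (F x s) * K s)) \<le> 4 * K s"
    proof (rule always_eventually, rule allI)
      fix s
      have "pospart1 d (F x s) * K s \<le> 1 * K s" by (intro mult_right_mono pospart1_bounds d) auto
      then show "norm (- 4 * (pospart1 d (F x s) * K s)) \<le> 4 * K s"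
        using pospart1_bounds(1)[OF d, of "F x s"] by (simp add: abs_mult)
    qed
    show "((\<lambda>s. 4 * K s) \<longlongrightarrow> 0) at_top"
      using tendsto_mult_right_zero[OF ell_kernel_tendsto_0[OF card tpos]] .
  qed
  have "has_bochner_integral lborel (\<lambda>s. indicator {0..} s * (lap d x s * K s)) (0 - - 4 * (pospart1 d (F x 0) * K 0))"
    by (rule has_bochner_integral_FTC_atLeast[OF _ der _ lim]) (use lap_nonneg[OF d] in auto)
  then show ?thesis by (simp add: mult_ac)
qed

text \<open>Fubini brings the bump Laplacian inside the s-integral, Green's formula applies for each
  fixed s, and after a second exchange \<open>integral_lap\<close> leaves only the boundary term at
  s = 0. The denominator 4 K(0) of \<open>w_approx\<close> normalises that term.\<close>

lemma integral_w_approx_bump_lap: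
  assumes d: "0 < d" "d \<le> 1" and r: "r > 0"
  shows "integrable lborel (\<lambda>x. w_approx d x * bump_lap a r x)"
    "(LBINT x. w_approx d x * bump_lap a r x) = (LBINT x. pospart1 d (F x 0) * bump 0 a r x)"
proof -
  have [measurable]: "bump_lap a r \<in> borel_measurable borel"
    by (intro borel_measurable_continuous_onI continuous_on_bump_lap)
  define J where "J = (\<lambda>(x, s). (indicator {0..} s * (pospart d (F x s) * K s)) * bump_lap a r x)"
  define L where "L = (\<lambda>(x, s). (indicator {0..} s * (lap d x s * K s)) * bump 0 a r x)"
  have J: "integrable (lborel \<Otimes>\<^sub>M lborel) J"
  proof (rule Bochner_Integration.integrable_bound)
    show "integrable (lborel \<Otimes>\<^sub>M lborel) (\<lambda>(x, s). ((A x + 2) * \<bar>bump_lap a r x\<bar>) * (indicator {0..} s * K s))"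
    proof (rule integrable_lborel_product[OF _ integrable_K])
      show "integrable lborel (\<lambda>x. (A x + 2) * \<bar>bump_lap a r x\<bar>)"
        by (rule integrable_continuous_cball[of _ a r])
          (use r in \<open>auto intro!: continuous_intros continuous_on_A simp: bump_lap_eq_0\<close>)
    qed
    show "J \<in> borel_measurable (lborel \<Otimes>\<^sub>M lborel)" unfolding J_def split_beta by measurable
    have "norm (J z) \<le> norm (case z of (x, s) \<Rightarrow> ((A x + 2) * \<bar>bump_lap a r x\<bar>) * (indicator {0..} s * K s))" for z
    proof (cases "snd z \<ge> 0")
      case True
      have "\<bar>pospart d (F (fst z) (snd z))\<bar> \<le> A (fst z) + 2"
        using pospart_approx[OF d, of "F (fst z) (snd z)"] F_bounds(2)[OF True, of "fst z"] d by (auto simp: max_def split: if_splits)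
      then have "\<bar>pospart d (F (fst z) (snd z))\<bar> * (K (snd z) * \<bar>bump_lap a r (fst z)\<bar>) \<le> (A (fst z) + 2) * (K (snd z) * \<bar>bump_lap a r (fst z)\<bar>)"
        by (intro mult_right_mono) auto
      then show ?thesis using True A_nonneg[of "fst z"]
        by (simp add: J_def split_beta abs_mult mult_ac)
    qed (simp add: J_def split_beta)
    then show "AE z in lborel \<Otimes>\<^sub>M lborel. norm (J z) \<le> norm (case z of (x, s) \<Rightarrow> ((A x + 2) * \<bar>bump_lap a r x\<bar>) * (indicator {0..} s * K s))"
      by simp
  qed
  have L: "integrable (lborel \<Otimes>\<^sub>M lborel) L"
  proof (rule Bochner_Integration.integrable_bound)
    \<comment> \<open>The bound of \<open>lap_le\<close>; its factor 1/d^2 is harmless because d is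
      fixed here.\<close>
    define b where "b x = ((\<Sum>i\<in>UNIV. 2 / t i) + 1 / (2 * d\<^sup>2) * (\<Sum>i\<in>UNIV. (2 * y i x / t i)\<^sup>2))" for x
    have b: "lap d x s \<le> b x" if "s \<ge> 0" for x s using lap_le[OF d(1) that] by (simp add: b_def)
    have cb: "continuous_on UNIV b" unfolding b_def[abs_def] divide_inverse by (intro continuous_intros)
    show "integrable (lborel \<Otimes>\<^sub>M lborel) (\<lambda>(x, s). (b x * bump 0 a r x) * (indicator {0..} s * K s))"
    proof (rule integrable_lborel_product[OF _ integrable_K])
      show "integrable lborel (\<lambda>x. b x * bump 0 a r x)"
        by (rule integrable_continuous_cball[of _ a r], intro continuous_on_mult cb continuous_on_bump)
          (simp add: bump_eq_0[OF r] del: mem_cball)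
    qed
    show "L \<in> borel_measurable (lborel \<Otimes>\<^sub>M lborel)" unfolding L_def split_beta by measurable
    have "norm (L z) \<le> norm (case z of (x, s) \<Rightarrow> (b x * bump 0 a r x) * (indicator {0..} s * K s))" for z
    proof (cases "snd z \<ge> 0")
      case True
      have l0: "0 \<le> lap d (fst z) (snd z)" by (rule lap_nonneg[OF d(1) True])
      have l1: "lap d (fst z) (snd z) \<le> b (fst z)" by (rule b[OF True])
      have "lap d (fst z) (snd z) * (K (snd z) * bump 0 a r (fst z)) \<le> b (fst z) * (K (snd z) * bump 0 a r (fst z))"
        using l1 by (intro mult_right_mono) auto
      then show ?thesis using True l0 l1
        by (simp add: L_def split_beta abs_mult mult_ac)
    qed (simp add: L_def split_beta)
    then show "AE z in lborel \<Otimes>\<^sub>M lborel. norm (L z) \<le> norm (case z of (x, s) \<Rightarrow> (b x * bump 0 a r x) * (indicator {0..} s * K s))"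
      by simp
  qed
  have wJ: "w_approx d x * bump_lap a r x = (LBINT s. J (x, s)) / (4 * K 0)" for x
    by (simp add: w_approx_def J_def)
  show "integrable lborel (\<lambda>x. w_approx d x * bump_lap a r x)"
    unfolding wJ using lborel_pair.integrable_fst'[OF J] by simp
  have "(LBINT x. (LBINT s. J (x, s))) = (LBINT s. (LBINT x. J (x, s)))"
    using lborel_pair.Fubini_integral[of "\<lambda>x s. J (x, s)"] J by simp
  also have "\<dots> = (LBINT s. (LBINT x. L (x, s)))"
  proof (rule Bochner_Integration.integral_cong[OF refl])
    fix s :: real
    have "(LBINT x. J (x, s)) = (indicator {0..} s * K s) * (LBINT x. pospart d (F x s) * bump_lap a r x)"
      unfolding integral_mult_right_zero[symmetric] by (simp add: J_def mult_ac)
    also have "\<dots> = (indicator {0..} s * K s) * (LBINT x. lap d x s * bump 0 a r x)"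
      using integral_pospart_bump_lap[OF d(1) _ r, of s a] by (cases "s \<ge> 0") auto
    also have "\<dots> = (LBINT x. L (x, s))"
      unfolding integral_mult_right_zero[symmetric] by (simp add: L_def mult_ac)
    finally show "(LBINT x. J (x, s)) = (LBINT x. L (x, s))" .
  qed
  also have "\<dots> = (LBINT x. (LBINT s. L (x, s)))"
    using lborel_pair.Fubini_integral[of "\<lambda>x s. L (x, s)"] L by simp
  also have "\<dots> = (LBINT x. 4 * K 0 * (pospart1 d (F x 0) * bump 0 a r x))"
    using integral_lap[OF d(1)] by (intro Bochner_Integration.integral_cong) (auto simp: L_def has_bochner_integral_iff)
  finally have "(LBINT x. (LBINT s. J (x, s))) = 4 * K 0 * (LBINT x. pospart1 d (F x 0) * bump 0 a r x)"
    by simp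
  then show "(LBINT x. w_approx d x * bump_lap a r x) = (LBINT x. pospart1 d (F x 0) * bump 0 a r x)"
    unfolding wJ by simp
qed

end

text \<open>At y = 0 the shift d outweighs the smoothing width d^2: the value is (1 - 1/sqrt(1 +
  d^2))/2, which tends to 0. This explains the exponent 4 in \<open>pospart\<close>.\<close>

lemma pospart1_tendsto:
  "(\<lambda>k. pospart1 (inverse (real (Suc k))) y) \<longlonglongrightarrow> indicator {0<..} y"
proof -
  let ?d = "\<lambda>k. inverse (real (Suc k))"
  have d: "?d \<longlonglongrightarrow> 0" by (rule LIMSEQ_inverse_real_of_nat)
  show ?thesis
  proof (cases "y = 0")
    case False
    have "(\<lambda>k. pospart1 (?d k) y) \<longlonglongrightarrow> (1 + (y - 0) / sqrt ((y - 0)\<^sup>2 + 0 ^ 4)) / 2"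
      unfolding pospart1_def using False by (intro tendsto_intros d) auto
    moreover have "(1 + (y - 0) / sqrt ((y - 0)\<^sup>2 + 0 ^ 4)) / 2 = indicator {0<..} y"
      using False by (auto simp: indicator_def)
    ultimately show ?thesis by simp
  next
    case True
    have "pospart1 a 0 = (1 - 1 / sqrt (1 + a\<^sup>2)) / 2" if "a > 0" for a
    proof -
      have "(0 - a)\<^sup>2 + a ^ 4 = a\<^sup>2 * (1 + a\<^sup>2)" by (simp add: eval_nat_numeral algebra_simps)
      then have "sqrt ((0 - a)\<^sup>2 + a ^ 4) = a * sqrt (1 + a\<^sup>2)" using that by (simp add: real_sqrt_mult)
      then show ?thesis using that by (simp add: pospart1_def)
    qed
    then have "(\<lambda>k. pospart1 (?d k) 0) = (\<lambda>k. (1 - 1 / sqrt (1 + (?d k)\<^sup>2)) / 2)" by auto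
    moreover have "(\<lambda>k. (1 - 1 / sqrt (1 + (?d k)\<^sup>2)) / 2) \<longlonglongrightarrow> (1 - 1 / sqrt (1 + 0\<^sup>2)) / 2"
      by (intro tendsto_intros d) auto
    ultimately show ?thesis using True by simp
  qed
qed

context ellipsoid_data
begin

text \<open>Dominated convergence on both sides of the identity for \<open>w_approx\<close>. On the
  right the limit is the indicator of F x 0 > 0, which is the positivity set of w by
  \<open>w_eq_0_iff\<close>.\<close>

lemma obst_w: "obst w"
  unfolding obst_def
proof (intro conjI allI impI continuous_on_w w_nonneg)
  fix a :: "real^'n" and r :: real
  assume r: "r > 0"
  let ?d = "\<lambda>k. inverse (real (Suc k))"
  define C where "C = (LBINT s. indicator {0..} s * K s) / (4 * K 0)"
  have d: "0 < ?d k" "?d k \<le> 1" for k by (auto simp: field_simps)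
  have C: "C \<ge> 0" unfolding C_def by (intro divide_nonneg_pos Bochner_Integration.integral_nonneg) auto
  have [measurable]: "w \<in> borel_measurable borel" "bump_lap a r \<in> borel_measurable borel"
    by (intro borel_measurable_continuous_onI continuous_on_w continuous_on_bump_lap)+
  have "(\<lambda>k. LBINT x. w_approx (?d k) x * bump_lap a r x) \<longlonglongrightarrow> (LBINT x. w x * bump_lap a r x)"
  proof (rule integral_dominated_convergence)
    show "integrable lborel (\<lambda>x. (w x + 2 * C) * \<bar>bump_lap a r x\<bar>)"
      by (rule integrable_continuous_cball[of _ a r])
        (use r in \<open>auto intro!: continuous_intros continuous_on_w simp: bump_lap_eq_0\<close>)
    show "(\<lambda>x. w_approx (?d k) x * bump_lap a r x) \<in> borel_measurable lborel" for k
      by (rule borel_measurable_integrable[OF integral_w_approx_bump_lap(1)[OF d r]])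
    show "AE x in lborel. norm (w_approx (?d k) x * bump_lap a r x) \<le> (w x + 2 * C) * \<bar>bump_lap a r x\<bar>" for k
    proof (rule AE_I2)
      fix x
      have "2 * ?d k * C \<le> 2 * 1 * C" using d C by (intro mult_right_mono) auto
      then have "\<bar>w_approx (?d k) x\<bar> \<le> w x + 2 * C"
        using w_approx_diff[OF d, of k x] w_nonneg[of x] unfolding C_def by linarith
      then show "norm (w_approx (?d k) x * bump_lap a r x) \<le> (w x + 2 * C) * \<bar>bump_lap a r x\<bar>"
        by (simp add: abs_mult mult_right_mono)
    qed
    have "(\<lambda>k. w_approx (?d k) x) \<longlonglongrightarrow> w x" for x
    proof -
      have "(\<lambda>k. 2 * ?d k * C) \<longlonglongrightarrow> 2 * 0 * C"
        by (intro tendsto_intros LIMSEQ_inverse_real_of_nat)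
      then have "(\<lambda>k. w_approx (?d k) x - w x) \<longlonglongrightarrow> 0"
        using w_approx_diff[OF d] unfolding C_def
        by (intro Lim_null_comparison[of "\<lambda>k. w_approx (?d k) x - w x" "\<lambda>k. 2 * ?d k * ((LBINT s. indicator {0..} s * K s) / (4 * K 0))"]) auto
      then show ?thesis by (rule LIM_zero_cancel)
    qed
    then show "AE x in lborel. (\<lambda>k. w_approx (?d k) x * bump_lap a r x) \<longlonglongrightarrow> w x * bump_lap a r x"
      by (intro AE_I2 tendsto_mult tendsto_const)
  qed measurable
  moreover have "(\<lambda>k. LBINT x. pospart1 (?d k) (F x 0) * bump 0 a r x) \<longlonglongrightarrow>
      (LBINT x. indicator {x. w x > 0} x * bump 0 a r x)"
  proof (rule integral_dominated_convergence)
    show "integrable lborel (bump 0 a r)" by (rule integrable_bump[OF r])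
    have [measurable]: "(\<lambda>x. F x 0) \<in> borel_measurable borel"
      by (intro borel_measurable_continuous_onI continuous_on_F) simp
    show "(\<lambda>x. pospart1 (?d k) (F x 0) * bump 0 a r x) \<in> borel_measurable lborel" for k by measurable
    show "AE x in lborel. norm (pospart1 (?d k) (F x 0) * bump 0 a r x) \<le> bump 0 a r x" for k
    proof (rule AE_I2)
      fix x
      have "pospart1 (?d k) (F x 0) * bump 0 a r x \<le> 1 * bump 0 a r x"
        by (intro mult_right_mono pospart1_bounds d) auto
      then show "norm (pospart1 (?d k) (F x 0) * bump 0 a r x) \<le> bump 0 a r x"
        using pospart1_bounds(1)[OF d(1), of k "F x 0"] by (simp add: abs_mult)
    qed
    have "indicator {0<..} (F x 0) = (indicator {x. w x > 0} x :: real)" for x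
      using w_eq_0_iff[of x] w_nonneg[of x] by (auto simp: indicator_def)
    then show "AE x in lborel. (\<lambda>k. pospart1 (?d k) (F x 0) * bump 0 a r x) \<longlonglongrightarrow> indicator {x. w x > 0} x * bump 0 a r x"
      using pospart1_tendsto by (intro AE_I2 tendsto_mult tendsto_const) metis
  qed measurable
  ultimately show "(LBINT x. w x * bump_lap a r x) = (LBINT x. indicator {x. w x > 0} x * bump 0 a r x)"
    unfolding integral_w_approx_bump_lap(2)[OF d r] by (rule LIMSEQ_unique)
qed

text \<open>With \<open>offset\<close>, the coefficients of the quadratic polynomial obtained by
  integrating \<open>F x s * K s\<close> over s >= 0 and dividing by 4 K(0).\<close>

definition coef :: "'n \<Rightarrow> real" where
  "coef i = (LBINT s. indicator {0..} s * (1 / (t i + s) * K s)) / (4 * K 0)"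

definition offset :: real where
  "offset = (LBINT s. indicator {0..} s * K s) / (4 * K 0)"

section \<open>Quadratic part, decay and zero set of the ellipsoid solution\<close>

lemma sum_y_square: "(\<Sum>i\<in>UNIV. (y i x)\<^sup>2) = (norm (x - c))\<^sup>2"
proof -
  have "(norm (x - c))\<^sup>2 = (x - c) \<bullet> (\<Sum>i\<in>UNIV. y i x *\<^sub>R e i)"
    using orthonormal_expansion[OF on, of "x - c"] by (simp add: power2_norm_eq_inner)
  also have "\<dots> = (\<Sum>i\<in>UNIV. (y i x)\<^sup>2)"
    by (simp only: inner_sum_right inner_scaleR_right power2_eq_square inner_commute[of "x - c"])
  finally show ?thesis by simp
qed

text \<open>Write max 0 F = F + max 0 (-F). The first summand integrates to the polynomial, the
  second one to the potential of the ellipsoid.\<close>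

lemma w_minus_quadratic:
  "integrable lborel (\<lambda>s. indicator {0..} s * (max 0 (- F x s) * K s))"
  "w x - ((\<Sum>i\<in>UNIV. coef i * (y i x)\<^sup>2) - offset) =
     (LBINT s. indicator {0..} s * (max 0 (- F x s) * K s)) / (4 * K 0)"
proof -
  have int1: "integrable lborel (\<lambda>s. indicator {0..} s * (1 / (t i + s) * K s))" for i
  proof (rule integrable_mult_K[where M="1 / t i"])
    show "\<bar>1 / (t i + s)\<bar> \<le> 1 / t i" if "s \<ge> 0" for s
      using divide_ts_le[OF that, of 1 i] ts_pos[OF that, of i] by simp
  qed measurable
  have intF: "integrable lborel (\<lambda>s. indicator {0..} s * (F x s * K s))"
    by (rule integrable_mult_K[where M="A x"]) (use F_bounds(2) in auto)
  have eq: "indicator {0..} s * (max 0 (- F x s) * K s) =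
     indicator {0..} s * (max 0 (F x s) * K s) - indicator {0..} s * (F x s * K s)" for s
    by (auto simp: max_def algebra_simps)
  show "integrable lborel (\<lambda>s. indicator {0..} s * (max 0 (- F x s) * K s))"
    unfolding eq by (intro Bochner_Integration.integrable_diff integrable_w intF)
  have "indicator {0..} s * (F x s * K s) =
     (\<Sum>i\<in>UNIV. (y i x)\<^sup>2 * (indicator {0..} s * (1 / (t i + s) * K s))) - indicator {0..} s * K s" for s :: real
    by (simp add: F_def left_diff_distrib right_diff_distrib sum_distrib_left sum_distrib_right mult_ac)
  then have "(LBINT s. indicator {0..} s * (F x s * K s)) =
    (LBINT s. (\<Sum>i\<in>UNIV. (y i x)\<^sup>2 * (indicator {0..} s * (1 / (t i + s) * K s))) - indicator {0..} s * K s)"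
    by (intro Bochner_Integration.integral_cong refl)
  also have "\<dots> = (\<Sum>i\<in>UNIV. (y i x)\<^sup>2 * (LBINT s. indicator {0..} s * (1 / (t i + s) * K s)))
     - (LBINT s. indicator {0..} s * K s)"
  proof -
    have i2: "integrable lborel (\<lambda>s. (y i x)\<^sup>2 * (indicator {0..} s * (1 / (t i + s) * K s)))" for i
      by (rule integrable_mult_right[OF int1])
    have "(LBINT s. (\<Sum>i\<in>UNIV. (y i x)\<^sup>2 * (indicator {0..} s * (1 / (t i + s) * K s))) - indicator {0..} s * K s)
      = (LBINT s. (\<Sum>i\<in>UNIV. (y i x)\<^sup>2 * (indicator {0..} s * (1 / (t i + s) * K s)))) - (LBINT s. indicator {0..} s * K s)"
      by (intro Bochner_Integration.integral_diff Bochner_Integration.integrable_sum i2 integrable_K)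
    also have "(LBINT s. (\<Sum>i\<in>UNIV. (y i x)\<^sup>2 * (indicator {0..} s * (1 / (t i + s) * K s))))
      = (\<Sum>i\<in>UNIV. LBINT s. (y i x)\<^sup>2 * (indicator {0..} s * (1 / (t i + s) * K s)))"
      by (intro Bochner_Integration.integral_sum i2)
    also have "\<dots> = (\<Sum>i\<in>UNIV. (y i x)\<^sup>2 * (LBINT s. indicator {0..} s * (1 / (t i + s) * K s)))"
      by (simp only: integral_mult_right_zero)
    finally show ?thesis .
  qed
  finally have "(LBINT s. indicator {0..} s * (F x s * K s)) / (4 * K 0) = (\<Sum>i\<in>UNIV. coef i * (y i x)\<^sup>2) - offset"
    by (simp add: coef_def offset_def diff_divide_distrib sum_divide_distrib mult_ac)
  moreover have "(LBINT s. indicator {0..} s * (max 0 (- F x s) * K s)) =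
     (LBINT s. indicator {0..} s * (max 0 (F x s) * K s)) - (LBINT s. indicator {0..} s * (F x s * K s))"
    unfolding eq by (intro Bochner_Integration.integral_diff integrable_w intF)
  ultimately show "w x - ((\<Sum>i\<in>UNIV. coef i * (y i x)\<^sup>2) - offset) =
     (LBINT s. indicator {0..} s * (max 0 (- F x s) * K s)) / (4 * K 0)"
    by (simp add: w_def diff_divide_distrib)
qed

lemma w_minus_quadratic_bounds:
  "0 \<le> w x - ((\<Sum>i\<in>UNIV. coef i * (y i x)\<^sup>2) - offset)"
  "w x - ((\<Sum>i\<in>UNIV. coef i * (y i x)\<^sup>2) - offset) \<le> offset"
proof -
  show "0 \<le> w x - ((\<Sum>i\<in>UNIV. coef i * (y i x)\<^sup>2) - offset)"
    unfolding w_minus_quadratic(2) by (intro divide_nonneg_pos Bochner_Integration.integral_nonneg) auto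
  have "(LBINT s. indicator {0..} s * (max 0 (- F x s) * K s)) \<le> (LBINT s. indicator {0..} s * K s)"
  proof (rule integral_mono[OF w_minus_quadratic(1) integrable_K])
    fix s :: real
    have "max 0 (- F x s) * K s \<le> 1 * K s" if "s \<ge> 0"
      using F_bounds(1)[OF that, of x] by (intro mult_right_mono) auto
    then show "indicator {0..} s * (max 0 (- F x s) * K s) \<le> indicator {0..} s * K s"
      by (auto simp: indicator_def)
  qed
  then show "w x - ((\<Sum>i\<in>UNIV. coef i * (y i x)\<^sup>2) - offset) \<le> offset"
    unfolding w_minus_quadratic(2) unfolding offset_def by (intro divide_right_mono) auto
qed

text \<open>If T bounds all t_i, then F x s >= |x - c|^2 / (T + s) - 1, which is nonnegative for s <
  |x - c|^2 - T. Hence only a far tail of the kernel contributes to the difference.\<close>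

lemma w_asymptotic:
  assumes "\<delta> > 0"
  shows "\<exists>R. \<forall>x. norm x \<ge> R \<longrightarrow> w x - ((\<Sum>i\<in>UNIV. coef i * (y i x)\<^sup>2) - offset) < \<delta>"
proof -
  obtain B where B: "B \<ge> 0" "\<And>a. a \<ge> B \<Longrightarrow> (LBINT s. indicator {a..} s * K s) < 4 * K 0 * \<delta>"
    using ell_kernel_tail[where t=t and d="4 * K 0 * \<delta>", OF card tpos] assms by auto
  define T where "T = (\<Sum>i\<in>UNIV. t i)"
  have T: "t i \<le> T" for i unfolding T_def by (rule member_le_sum) (auto intro: less_imp_le tpos)
  have Tpos: "T > 0" using T tpos less_le_trans by blast
  have "w x - ((\<Sum>i\<in>UNIV. coef i * (y i x)\<^sup>2) - offset) < \<delta>" if x: "norm x \<ge> norm c + B + T + 1" for x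
  proof -
    define a where "a = (norm (x - c))\<^sup>2 - T"
    have n: "norm (x - c) \<ge> B + T + 1" using x norm_triangle_ineq2[of x c] by linarith
    \<comment> \<open>The summand 1 in the lower bound for |x| ensures |x - c| >= 1, so that the
      square is at least B + T + 1 as well.\<close>
    have "norm (x - c) * 1 \<le> norm (x - c) * norm (x - c)"
      using n B(1) Tpos by (intro mult_left_mono) auto
    then have a: "a \<ge> B" using n by (simp add: a_def power2_eq_square)
    have Fpos: "F x s \<ge> 0" if "0 \<le> s" "s < a" for s
    proof -
      have "(norm (x - c))\<^sup>2 / (T + s) = (\<Sum>i\<in>UNIV. (y i x)\<^sup>2 / (T + s))"
        by (simp only: sum_y_square[symmetric] sum_divide_distrib)
      also have "\<dots> \<le> (\<Sum>i\<in>UNIV. (y i x)\<^sup>2 / (t i + s))"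
        using T tpos that(1) by (intro sum_mono divide_left_mono mult_pos_pos add_right_mono) (auto intro: add_pos_nonneg Tpos)
      finally have "(norm (x - c))\<^sup>2 / (T + s) - 1 \<le> F x s" by (simp add: F_def)
      moreover have "(norm (x - c))\<^sup>2 / (T + s) \<ge> 1" using that Tpos by (simp add: a_def field_simps)
      ultimately show ?thesis by linarith
    qed
    have "(LBINT s. indicator {0..} s * (max 0 (- F x s) * K s)) \<le> (LBINT s. indicator {a..} s * K s)"
    proof (rule integral_mono')
      show "integrable lborel (\<lambda>s. indicator {a..} s * K s)"
        by (rule Bochner_Integration.integrable_bound[OF integrable_K])
          (use a B(1) in \<open>auto simp: indicator_def\<close>)
      fix s :: real
      show "indicator {0..} s * (max 0 (- F x s) * K s) \<le> indicator {a..} s * K s"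
      proof (cases "0 \<le> s \<and> s < a")
        case True
        then show ?thesis using Fpos[of s] by (auto simp: max_def)
      next
        case False
        have "max 0 (- F x s) * K s \<le> 1 * K s" if "s \<ge> 0"
          using F_bounds(1)[OF that, of x] by (intro mult_right_mono) auto
        then show ?thesis using False by (auto simp: indicator_def)
      qed
      show "0 \<le> indicator {a..} s * K s" by simp
    qed
    also have "\<dots> < 4 * K 0 * \<delta>" using B(2)[OF a] .
    finally show ?thesis unfolding w_minus_quadratic(2) by (simp add: field_simps)
  qed
  then show ?thesis by blast
qed

lemma bounded_w_zero: "bounded {x. w x = 0}"
proof -
  define T where "T = (\<Sum>i\<in>UNIV. t i)"
  have T: "t i \<le> T" for i unfolding T_def by (rule member_le_sum) (auto intro: less_imp_le tpos)
  have Tpos: "T > 0" using T tpos less_le_trans by blast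
  have "dist c x \<le> sqrt T" if "w x = 0" for x
  proof -
    have "(norm (x - c))\<^sup>2 / T = (\<Sum>i\<in>UNIV. (y i x)\<^sup>2 / T)"
      by (simp only: sum_y_square[symmetric] sum_divide_distrib)
    also have "\<dots> \<le> (\<Sum>i\<in>UNIV. (y i x)\<^sup>2 / (t i + 0))"
      using T tpos Tpos by (intro sum_mono divide_left_mono mult_pos_pos) auto
    also have "\<dots> \<le> 1" using that unfolding w_eq_0_iff F_def by simp
    finally have "(norm (x - c))\<^sup>2 \<le> T" using Tpos by (simp add: field_simps)
    then show ?thesis by (simp add: dist_norm norm_minus_commute real_le_rsqrt)
  qed
  then show ?thesis unfolding bounded_def by (intro exI[of _ c] exI[of _ "sqrt T"]) auto
qed

lemma ellipsoid_w_zero: "ellipsoid ((\<lambda>x. x - c) ` {x. w x = 0})"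
  unfolding ellipsoid_def
proof (intro exI conjI)
  \<comment> \<open>The sum of the rank-one matrices e_i e_i^T / t_i, whose eigenvectors are the e_i
    with eigenvalues 1/t_i.\<close>
  let ?M = "\<chi> a b. \<Sum>i\<in>UNIV. e i $ a * e i $ b / t i"
  show "transpose ?M = ?M" by (simp add: transpose_def mult.commute)
  have "?M *v z = (\<Sum>i\<in>UNIV. ((e i \<bullet> z) / t i) *\<^sub>R e i)" for z
  proof -
    have "(\<Sum>b\<in>UNIV. (\<Sum>i\<in>UNIV. e i $ a * e i $ b / t i) * z $ b) = (\<Sum>i\<in>UNIV. (e i \<bullet> z) / t i * e i $ a)" for a
      unfolding sum_distrib_right inner_vec_def sum_divide_distrib
      by (subst sum.swap) (simp add: mult_ac)
    then show ?thesis by (simp add: vec_eq_iff matrix_vector_mult_def)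
  qed
  then have q: "z \<bullet> (?M *v z) = (\<Sum>i\<in>UNIV. (e i \<bullet> z)\<^sup>2 / t i)" for z
    by (simp add: inner_sum_right inner_commute[of z] power2_eq_square)
  show "\<forall>z. z \<noteq> 0 \<longrightarrow> z \<bullet> (?M *v z) > 0"
  proof (intro allI impI)
    fix z :: "real^'n" assume z: "z \<noteq> 0"
    have "\<exists>i. e i \<bullet> z \<noteq> 0"
    proof (rule ccontr)
      assume "\<not> ?thesis"
      then show False using orthonormal_expansion[OF on, of z] z by simp
    qed
    then obtain i where "e i \<bullet> z \<noteq> 0" by blast
    then have "(\<Sum>i\<in>UNIV. (e i \<bullet> z)\<^sup>2 / t i) > 0"
      using tpos by (intro sum_pos2[of _ i]) (auto intro!: divide_nonneg_pos)
    then show "z \<bullet> (?M *v z) > 0" by (simp only: q)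
  qed
  have "(\<lambda>x. x - c) ` {x. w x = 0} = {z. (\<Sum>i\<in>UNIV. (e i \<bullet> z)\<^sup>2 / t i) \<le> 1}"
  proof (intro set_eqI iffI)
    fix z assume "z \<in> {z. (\<Sum>i\<in>UNIV. (e i \<bullet> z)\<^sup>2 / t i) \<le> 1}"
    then have "w (z + c) = 0" by (simp add: w_eq_0_iff F_def)
    then show "z \<in> (\<lambda>x. x - c) ` {x. w x = 0}" by (intro image_eqI[of _ _ "z + c"]) auto
  qed (auto simp: w_eq_0_iff F_def)
  then show "(\<lambda>x. x - c) ` {x. w x = 0} = {z. z \<bullet> (?M *v z) \<le> 1}" by (simp only: q)
qed

end

text \<open>Strong maximum principle for d = u - w. Where d > 0 also u > 0, so locally {w > 0} lies
  in {u > 0} and averages of d do not decrease with the radius. The set where d attains a positive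
  maximum is then open and closed, hence the whole space, against the decay.\<close>

lemma obst_comparison:
  fixes u w :: "real^'n \<Rightarrow> real"
  assumes u: "obst u" and w: "obst w"
    and decay: "\<And>\<delta>. \<delta> > 0 \<Longrightarrow> \<exists>R. \<forall>x. norm x \<ge> R \<longrightarrow> u x - w x < \<delta>"
  shows "u x1 \<le> w x1"
proof (rule ccontr)
  assume neg: "\<not> u x1 \<le> w x1"
  define d where "d x = u x - w x" for x
  have x1: "d x1 > 0" using neg by (simp add: d_def)
  let ?m = "bmass TYPE('n) 2"
  have cd: "continuous_on UNIV d" unfolding d_def[abs_def]
    by (intro continuous_on_diff obst_continuous u w)
  obtain R where R: "\<And>x. norm x \<ge> R \<Longrightarrow> d x < d x1" using decay[OF x1] unfolding d_def by blast
  have "compact (cball (0::real^'n) (max R (norm x1)))" by simp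
  moreover have "continuous_on (cball (0::real^'n) (max R (norm x1))) d" using cd continuous_on_subset by blast
  moreover have "cball (0::real^'n) (max R (norm x1)) \<noteq> {}" by (auto simp: le_max_iff_disj)
  ultimately obtain x0 where x0': "\<forall>x\<in>cball 0 (max R (norm x1)). d x \<le> d x0"
    using continuous_attains_sup[of "cball 0 (max R (norm x1))" d] by blast
  have x0: "d x \<le> d x0" if "norm x \<le> max R (norm x1)" for x
    using x0' that by (simp del: max.bounded_iff le_max_iff_disj)
  have x01: "d x1 \<le> d x0" by (rule x0) simp
  define m where "m = d x0"
  have m: "m > 0" using x1 x01 by (simp add: m_def)
  have max: "d x \<le> m" for x
  proof (cases "norm x \<le> max R (norm x1)")
    case False
    then have "R \<le> norm x" using max.cobounded1[of R "norm x1"] by linarith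
    then show ?thesis using R[of x] x01 unfolding m_def by linarith
  qed (simp only: x0 m_def)
  define S where "S = {x. d x = m}"
  have "closed S" unfolding S_def using closed_Collect_eq[OF cd continuous_on_const] by simp
  moreover have "open S"
    unfolding open_contains_ball
  proof
    fix x assume x: "x \<in> S"
    have "open {x. 0 < d x}" using open_Collect_less[OF continuous_on_const cd] by simp
    moreover have "x \<in> {x. 0 < d x}" using x m by (simp add: S_def)
    ultimately obtain r0 where r0: "r0 > 0" "ball x r0 \<subseteq> {x. 0 < d x}" using open_contains_ball by metis
    define r where "r = r0 / 2"
    have r: "r > 0" "r < r0" using r0 by (auto simp: r_def)
    have mu: "{y. u y > 0} \<in> sets borel" "{y. w y > 0} \<in> sets borel"
      using obst_measurable[OF u] obst_measurable[OF w] by measurable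
    have mono: "bavg 2 u s x - bavg 2 w s x \<le> bavg 2 u r x - bavg 2 w r x" if s: "0 < s" "s \<le> r" for s
    proof (rule DERIV_nonneg_imp_nondecreasing[OF s(2)])
      fix h assume "s \<le> h" "h \<le> r"
      then have h: "h > 0" "h \<le> r" using s by auto
      have "bavg 0 (indicator {y. w y > 0}) h x \<le> bavg 0 (indicator {y. u y > 0}) h x"
      proof (rule bavg_indicator_mono[OF h(1) mu(2,1)])
        fix z assume "z \<in> ball x h"
        then have "z \<in> ball x r0" using h r by simp
        then have "0 < d z" using r0(2) by blast
        then show "z \<in> {y. u y > 0}" using obst_nonneg[OF w, of z] by (simp add: d_def)
      qed
      then have "0 \<le> h / 2 * bavg 0 (indicator {y. u y > 0}) h x - h / 2 * bavg 0 (indicator {y. w y > 0}) h x"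
        using h by (simp add: mult_left_mono flip: right_diff_distrib)
      then show "\<exists>y. ((\<lambda>s. bavg 2 u s x - bavg 2 w s x) has_real_derivative y) (at h) \<and> y \<ge> 0"
        using DERIV_diff[OF obst_bavg_has_real_derivative[OF u h(1), of x] obst_bavg_has_real_derivative[OF w h(1), of x]] by blast
    qed
    have lim: "((\<lambda>s. bavg 2 u s x - bavg 2 w s x) \<longlongrightarrow> u x * ?m - w x * ?m) (at_right 0)"
      by (intro tendsto_diff bavg_tendsto obst_continuous u w)
    have "\<forall>\<^sub>F s in at_right 0. bavg 2 u s x - bavg 2 w s x \<le> bavg 2 u r x - bavg 2 w r x"
      unfolding eventually_at_right_field using mono r by (intro exI[of _ r]) auto
    then have "u x * ?m - w x * ?m \<le> bavg 2 u r x - bavg 2 w r x"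
      by (rule tendsto_upperbound[OF lim]) simp
    moreover have "u x * ?m - w x * ?m = m * ?m" using x by (simp add: S_def d_def flip: left_diff_distrib)
    moreover have intb: "integrable lborel (\<lambda>y. v y * bump 2 x r y)" if "continuous_on UNIV v" for v
      by (rule integrable_continuous_cball[of _ x r], intro continuous_on_mult that continuous_on_bump)
        (simp add: bump_eq_0[OF r(1)] del: mem_cball)
    moreover have "(LBINT y. (m - d y) * bump 2 x r y) = (m * ?m - (bavg 2 u r x - bavg 2 w r x)) * r ^ CARD('n)"
    proof -
      have "(m - d y) * bump 2 x r y = m * bump 2 x r y - (u y * bump 2 x r y - w y * bump 2 x r y)" for y
        by (simp add: d_def algebra_simps)
      then have "(LBINT y. (m - d y) * bump 2 x r y) =
         (LBINT y. m * bump 2 x r y) - ((LBINT y. u y * bump 2 x r y) - (LBINT y. w y * bump 2 x r y))"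
        using intb[OF obst_continuous[OF u]] intb[OF obst_continuous[OF w]] integrable_bump[OF r(1), of 2 x]
        by (simp only: Bochner_Integration.integral_diff Bochner_Integration.integrable_diff integrable_mult_right)
      also have "(LBINT y. m * bump 2 x r y) = m * ?m * r ^ CARD('n)"
        using bavg_const[OF r(1), of 2 m x] r by (simp add: bavg_def field_simps)
      finally show ?thesis using r by (simp add: bavg_def left_diff_distrib)
    qed
    ultimately have "(LBINT y. (m - d y) * bump 2 x r y) \<le> 0"
      using r by (simp add: mult_nonpos_nonneg)
    moreover have nn: "(m - d y) * bump 2 x r y \<ge> 0" for y using max[of y] by simp
    then have "(LBINT y. (m - d y) * bump 2 x r y) \<ge> 0" by (intro Bochner_Integration.integral_nonneg)
    moreover have cmd: "continuous_on UNIV (\<lambda>y. m - d y)" by (intro continuous_on_diff cd continuous_on_const)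
    ultimately have z: "(m - d y) * bump 2 x r y = 0" for y
      by (intro continuous_nonneg_integral_eq_0[of "\<lambda>y. (m - d y) * bump 2 x r y"] nn intb continuous_on_mult continuous_on_bump) auto
    have "ball x r \<subseteq> S"
    proof
      fix y assume "y \<in> ball x r"
      then have "bump 2 x r y > 0" using bump_pos_iff[OF r(1)] by blast
      then show "y \<in> S" using z[of y] by (simp add: S_def)
    qed
    then show "\<exists>e>0. ball x e \<subseteq> S" using r by blast
  qed
  moreover have "x0 \<in> S" by (simp add: S_def m_def)
  ultimately have "S = UNIV" using clopen[of S] by auto
  then have dm: "d x = m" for x by (auto simp: S_def)
  obtain x :: "real^'n" where x: "norm x \<ge> R"
    using that[of "R *\<^sub>R axis undefined 1"] by simp
  show False using R[OF x] dm[of x] x01 unfolding m_def by linarith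
qed

section \<open>Existence of an ellipsoid with given quadratic part\<close>

definition kint :: "('n::finite \<Rightarrow> real) \<Rightarrow> real" where
  "kint t = (LBINT s. indicator {0..} s * ell_kernel t s)"

text \<open>Minus twice the partial derivative of \<open>kint\<close> in the i-th variable. Divided
  by four times the kernel at 0, \<open>kint1\<close> gives the quadratic coefficients and
  \<open>kint\<close> the offset of the ellipsoid solution.\<close>

definition kint1 :: "('n::finite \<Rightarrow> real) \<Rightarrow> 'n \<Rightarrow> real" where
  "kint1 t i = (LBINT s. indicator {0..} s * (1 / (t i + s) * ell_kernel t s))"

section \<open>Continuity, identities and estimates for the kernel integrals\<close>

lemma integral_ell_kernel_tendsto:
  fixes t :: "'n::finite \<Rightarrow> real" and T :: "nat \<Rightarrow> 'n \<Rightarrow> real"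
  assumes n: "CARD('n) \<ge> 3" and \<epsilon>: "\<epsilon> > 0" and T: "\<And>k i. \<epsilon> \<le> T k i" and t: "\<And>i. \<epsilon> \<le> t i"
    and lim: "\<And>i. (\<lambda>k. T k i) \<longlonglongrightarrow> t i"
    and f: "\<And>k. f k \<in> borel_measurable borel" "g \<in> borel_measurable borel"
    and fb: "\<And>k s. s \<ge> 0 \<Longrightarrow> \<bar>f k s\<bar> \<le> M" and flim: "\<And>s. s \<ge> 0 \<Longrightarrow> (\<lambda>k. f k s) \<longlonglongrightarrow> g s"
  shows "(\<lambda>k. LBINT s. indicator {0..} s * (f k s * ell_kernel (T k) s)) \<longlonglongrightarrow>
    (LBINT s. indicator {0..} s * (g s * ell_kernel t s))"
proof (rule integral_dominated_convergence)
  have M: "M \<ge> 0" using fb[of 0 0] by simp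
  show "integrable lborel (\<lambda>s. M * (indicator {0..} s * (\<epsilon> + s) powr (- (real CARD('n) / 2))))"
    by (intro integrable_mult_right integrable_dominating_kernel n \<epsilon>)
  show "(\<lambda>s. indicator {0..} s * (f k s * ell_kernel (T k) s)) \<in> borel_measurable lborel" for k
    using f by measurable
  show "(\<lambda>s. indicator {0..} s * (g s * ell_kernel t s)) \<in> borel_measurable lborel"
    using f by measurable
  show "AE s in lborel. norm (indicator {0..} s * (f k s * ell_kernel (T k) s)) \<le>
     M * (indicator {0..} s * (\<epsilon> + s) powr (- (real CARD('n) / 2)))" for k
  proof (rule AE_I2)
    fix s :: real
    have "\<bar>f k s\<bar> * ell_kernel (T k) s \<le> M * (\<epsilon> + s) powr (- (real CARD('n) / 2))" if "s \<ge> 0"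
      using that M \<epsilon> T by (intro mult_mono fb ell_kernel_le) auto
    then show "norm (indicator {0..} s * (f k s * ell_kernel (T k) s)) \<le>
     M * (indicator {0..} s * (\<epsilon> + s) powr (- (real CARD('n) / 2)))" by (auto simp: indicator_def abs_mult)
  qed
  have "(\<lambda>k. ell_kernel (T k) s) \<longlonglongrightarrow> ell_kernel t s" if "s \<ge> 0" for s
    unfolding ell_kernel_def
  proof (intro tendsto_intros lim)
    show "t i + s \<noteq> 0" for i using t[of i] \<epsilon> that by simp
  qed simp
  then have "(\<lambda>k. indicator {0..} s * (f k s * ell_kernel (T k) s)) \<longlonglongrightarrow> indicator {0..} s * (g s * ell_kernel t s)" for s
    using flim[of s] by (cases "s \<ge> 0") (auto intro!: tendsto_mult)
  then show "AE s in lborel. (\<lambda>k. indicator {0..} s * (f k s * ell_kernel (T k) s)) \<longlonglongrightarrow> indicator {0..} s * (g s * ell_kernel t s)"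
    by simp
qed

lemma kint_tendsto:
  fixes t :: "'n::finite \<Rightarrow> real" and T :: "nat \<Rightarrow> 'n \<Rightarrow> real"
  assumes "CARD('n) \<ge> 3" "\<epsilon> > 0" "\<And>k i. \<epsilon> \<le> T k i" "\<And>i. \<epsilon> \<le> t i" "\<And>i. (\<lambda>k. T k i) \<longlonglongrightarrow> t i"
  shows "(\<lambda>k. kint (T k)) \<longlonglongrightarrow> kint t"
  using integral_ell_kernel_tendsto[OF assms, of "\<lambda>_ _. 1" "\<lambda>_. 1" 1] by (simp add: kint_def)

lemma kint1_tendsto:
  fixes t :: "'n::finite \<Rightarrow> real" and T :: "nat \<Rightarrow> 'n \<Rightarrow> real"
  assumes "CARD('n) \<ge> 3" "\<epsilon> > 0" "\<And>k i. \<epsilon> \<le> T k i" "\<And>i. \<epsilon> \<le> t i" "\<And>i. (\<lambda>k. T k i) \<longlonglongrightarrow> t i"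
  shows "(\<lambda>k. kint1 (T k) i) \<longlonglongrightarrow> kint1 t i"
  unfolding kint1_def
proof (rule integral_ell_kernel_tendsto[OF assms, where M="1 / \<epsilon>"])
  fix s :: real assume s: "s \<ge> 0"
  show "\<bar>1 / (T k i + s)\<bar> \<le> 1 / \<epsilon>" for k
    using assms(2) assms(3)[of k i] s by (simp add: frac_le)
  have "t i + s \<noteq> 0" using assms(2) assms(4)[of i] s by simp
  then show "(\<lambda>k. 1 / (T k i + s)) \<longlonglongrightarrow> 1 / (t i + s)"
    by (intro tendsto_intros assms(5))
qed measurable

lemma integrable_kint1:
  fixes t :: "'n::finite \<Rightarrow> real"
  assumes n: "CARD('n) \<ge> 3" and t: "\<And>i. t i > 0"
  shows "integrable lborel (\<lambda>s. indicator {0..} s * (1 / (t i + s) * ell_kernel t s))"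
proof (rule integrable_ell_kernel_mult[OF n t, where M="1 / t i"])
  show "\<bar>1 / (t i + s)\<bar> \<le> 1 / t i" if "s \<ge> 0" for s
    using t[of i] that by (simp add: frac_le)
qed measurable

lemma kint_nonneg: "kint t \<ge> 0"
  unfolding kint_def by (intro Bochner_Integration.integral_nonneg) auto

text \<open>The sum of 1/(t_i + s) times the kernel is -2 times the derivative of the kernel. In
  terms of coefficients: they always add up to 1/2, so the quadratic part of each ellipsoid solution
  has Laplacian 1.\<close>

lemma sum_kint1:
  fixes t :: "'n::finite \<Rightarrow> real"
  assumes n: "CARD('n) \<ge> 3" and t: "\<And>i. t i > 0"
  shows "(\<Sum>i\<in>UNIV. kint1 t i) = 2 * ell_kernel t 0"
proof -
  have "has_bochner_integral lborel (\<lambda>s. indicator {0..} s * ((\<Sum>i\<in>UNIV. 1 / (t i + s)) * ell_kernel t s)) (0 - - 2 * ell_kernel t 0)"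
  proof (rule has_bochner_integral_FTC_atLeast)
    fix s :: real assume s: "0 \<le> s"
    show "((\<lambda>s. - 2 * ell_kernel t s) has_real_derivative (\<Sum>i\<in>UNIV. 1 / (t i + s)) * ell_kernel t s) (at s)"
      using DERIV_cmult[OF ell_kernel_has_real_derivative[OF t s], of "- 2"] by simp
    show "0 \<le> (\<Sum>i\<in>UNIV. 1 / (t i + s)) * ell_kernel t s"
      using t s by (intro mult_nonneg_nonneg sum_nonneg) (auto simp: add_pos_nonneg less_imp_le)
  next
    show "((\<lambda>s. - 2 * ell_kernel t s) \<longlongrightarrow> 0) at_top"
      by (rule tendsto_mult_right_zero[OF ell_kernel_tendsto_0[OF n t]])
  qed measurable
  moreover have "indicator {0..} s * ((\<Sum>i\<in>UNIV. 1 / (t i + s)) * ell_kernel t s) =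
     (\<Sum>i\<in>UNIV. indicator {0..} s * (1 / (t i + s) * ell_kernel t s))" for s :: real
    by (simp only: sum_distrib_left sum_distrib_right)
  ultimately have "(LBINT s. (\<Sum>i\<in>UNIV. indicator {0..} s * (1 / (t i + s) * ell_kernel t s))) = 2 * ell_kernel t 0"
    by (simp add: has_bochner_integral_iff)
  moreover have "(LBINT s. (\<Sum>i\<in>UNIV. indicator {0..} s * (1 / (t i + s) * ell_kernel t s))) = (\<Sum>i\<in>UNIV. kint1 t i)"
    unfolding kint1_def by (intro Bochner_Integration.integral_sum integrable_kint1 n t)
  ultimately show ?thesis by simp
qed

lemma kint1_le_kint:
  fixes t :: "'n::finite \<Rightarrow> real"
  assumes n: "CARD('n) \<ge> 3" and t: "\<And>i. t i > 0"
  shows "t i * kint1 t i \<le> kint t"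
proof -
  have "kint1 t i \<le> (LBINT s. (1 / t i) * (indicator {0..} s * ell_kernel t s))"
    unfolding kint1_def
  proof (rule integral_mono[OF integrable_kint1[OF n t]])
    show "integrable lborel (\<lambda>s. (1 / t i) * (indicator {0..} s * ell_kernel t s))"
      by (intro integrable_mult_right integrable_ell_kernel n t)
    fix s :: real
    have "1 / (t i + s) * ell_kernel t s \<le> 1 / t i * ell_kernel t s" if "s \<ge> 0"
      using t[of i] that by (intro mult_right_mono frac_le) auto
    then show "indicator {0..} s * (1 / (t i + s) * ell_kernel t s) \<le> (1 / t i) * (indicator {0..} s * ell_kernel t s)"
      by (auto simp: indicator_def)
  qed
  also have "\<dots> = (1 / t i) * kint t" unfolding kint_def by (rule integral_mult_right_zero)
  finally show ?thesis using t[of i] by (simp add: field_simps)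
qed

text \<open>Convexity in one variable, with the slope taken at the new point a. Pointwise in s it
  reduces to exp z >= 1 + z and ln z <= z - 1, so \<open>kint\<close> is never
  differentiated.\<close>

lemma kint_tangent:
  fixes t :: "'n::finite \<Rightarrow> real"
  assumes n: "CARD('n) \<ge> 3" and t: "\<And>i. t i > 0" and a: "a > 0"
  shows "kint (t(i := a)) - kint t \<le> - (a - t i) / 2 * kint1 (t(i := a)) i"
proof -
  let ?t = "t(i := a)"
  have t': "?t j > 0" for j using t a by simp
  have pt: "ell_kernel ?t s + (a - t i) / 2 * (1 / (a + s) * ell_kernel ?t s) \<le> ell_kernel t s" if s: "s \<ge> 0" for s
  proof -
    have p: "a + s > 0" "t i + s > 0" using a t[of i] s by auto
    have "(\<Sum>j\<in>UNIV. ln (?t j + s)) = ln (a + s) + (\<Sum>j\<in>UNIV - {i}. ln (t j + s))"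
      by (subst sum.remove[of _ i]) auto
    moreover have "(\<Sum>j\<in>UNIV. ln (t j + s)) = ln (t i + s) + (\<Sum>j\<in>UNIV - {i}. ln (t j + s))"
      by (subst sum.remove[of _ i]) auto
    ultimately have "- (\<Sum>j\<in>UNIV. ln (t j + s)) / 2 = - (\<Sum>j\<in>UNIV. ln (?t j + s)) / 2 + (- ln ((t i + s) / (a + s)) / 2)"
      using p by (simp add: ln_div field_simps)
    then have K: "ell_kernel t s = ell_kernel ?t s * exp (- ln ((t i + s) / (a + s)) / 2)"
      unfolding ell_kernel_def by (simp only: exp_add)
    have "ln ((t i + s) / (a + s)) \<le> (t i + s) / (a + s) - 1" using p by (intro ln_le_minus_one) simp
    also have "\<dots> = - ((a - t i) / (a + s))" using p by (simp add: field_simps)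
    finally have l: "ln ((t i + s) / (a + s)) \<le> - ((a - t i) / (a + s))" .
    have "(a - t i) / 2 / (a + s) = ((a - t i) / (a + s)) / 2" by (simp add: mult.commute)
    then have "1 + (a - t i) / 2 / (a + s) \<le> 1 + (- ln ((t i + s) / (a + s)) / 2)" using l by linarith
    also have "\<dots> \<le> exp (- ln ((t i + s) / (a + s)) / 2)" by (rule exp_ge_add_one_self)
    finally have "ell_kernel ?t s * (1 + (a - t i) / 2 / (a + s)) \<le> ell_kernel t s"
      unfolding K by (intro mult_left_mono) auto
    then show ?thesis by (simp add: algebra_simps)
  qed
  have i1: "integrable lborel (\<lambda>s. indicator {0..} s * ell_kernel ?t s)" by (rule integrable_ell_kernel[OF n t'])
  have i2: "integrable lborel (\<lambda>s. indicator {0..} s * (1 / (?t i + s) * ell_kernel ?t s))" by (rule integrable_kint1[OF n t'])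
  have i3: "integrable lborel (\<lambda>s. indicator {0..} s * ell_kernel t s)" by (rule integrable_ell_kernel[OF n t])
  have "kint ?t + (a - t i) / 2 * kint1 ?t i =
     (LBINT s. indicator {0..} s * ell_kernel ?t s + (a - t i) / 2 * (indicator {0..} s * (1 / (?t i + s) * ell_kernel ?t s)))"
    unfolding kint_def kint1_def integral_mult_right_zero[symmetric]
    by (rule Bochner_Integration.integral_add[symmetric, OF i1 integrable_mult_right[OF i2]])
  also have "\<dots> \<le> kint t"
    unfolding kint_def
  proof (rule integral_mono[OF _ i3])
    show "integrable lborel (\<lambda>s. indicator {0..} s * ell_kernel ?t s + (a - t i) / 2 * (indicator {0..} s * (1 / (?t i + s) * ell_kernel ?t s)))"
      by (intro Bochner_Integration.integrable_add integrable_mult_right i1 i2)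
    show "indicator {0..} s * ell_kernel ?t s + (a - t i) / 2 * (indicator {0..} s * (1 / (?t i + s) * ell_kernel ?t s))
      \<le> indicator {0..} s * ell_kernel t s" for s
      using pt[of s] by (auto simp: indicator_def)
  qed
  finally have "kint ?t + (a - t i) / 2 * kint1 ?t i \<le> kint t" .
  moreover have "- (a - t i) / 2 * kint1 ?t i = - ((a - t i) / 2 * kint1 ?t i)"
    by (simp only: minus_divide_left[symmetric] mult_minus_left)
  ultimately show ?thesis by linarith
qed

text \<open>For 0 <= s <= epsilon, t_i + s is at most 3 epsilon and every other t_j + s at most M +
  1, so the integrand is of order epsilon^(-3/2) on an interval of length epsilon. The blow-up keeps
  minimisers away from degenerate ellipsoids.\<close>

lemma kint1_lower_bound:
  fixes t :: "'n::finite \<Rightarrow> real"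
  assumes n: "CARD('n) \<ge> 3" and t: "\<And>j. t j > 0" and M: "\<And>j. t j \<le> M" "M \<ge> 0"
    and \<epsilon>: "t i = 2 * \<epsilon>" "\<epsilon> \<le> 1"
  shows "exp (- (real CARD('n) * ln (M + 1)) / 2) / (3 * sqrt (3 * \<epsilon>)) \<le> kint1 t i"
proof -
  have e0: "\<epsilon> > 0" using t[of i] \<epsilon>(1) by simp
  define c1 where "c1 = exp (- (real CARD('n) * ln (M + 1)) / 2)"
  have K: "c1 / sqrt (3 * \<epsilon>) \<le> ell_kernel t s" if s: "0 \<le> s" "s \<le> \<epsilon>" for s
  proof -
    have "(\<Sum>j\<in>UNIV - {i}. ln (t j + s)) \<le> (\<Sum>j\<in>UNIV - {i}. ln (M + 1))"
    proof (rule sum_mono)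
      fix j show "ln (t j + s) \<le> ln (M + 1)" using t[of j] M(1)[of j] s \<epsilon>(2) by simp
    qed
    also have "\<dots> = real (card (UNIV - {i})) * ln (M + 1)" by simp
    also have "\<dots> \<le> real CARD('n) * ln (M + 1)" using M(2) by (intro mult_right_mono) (auto intro: card_mono)
    finally have 1: "(\<Sum>j\<in>UNIV - {i}. ln (t j + s)) \<le> real CARD('n) * ln (M + 1)" .
    have "ln (t i + s) \<le> ln (3 * \<epsilon>)" using \<epsilon>(1) s e0 by simp
    moreover have "(\<Sum>j\<in>UNIV. ln (t j + s)) = ln (t i + s) + (\<Sum>j\<in>UNIV - {i}. ln (t j + s))"
      by (subst sum.remove[of _ i]) auto
    ultimately have "- (real CARD('n) * ln (M + 1)) / 2 + - ln (3 * \<epsilon>) / 2 \<le> - (\<Sum>j\<in>UNIV. ln (t j + s)) / 2"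
      using 1 by simp
    then have "exp (- (real CARD('n) * ln (M + 1)) / 2 + - ln (3 * \<epsilon>) / 2) \<le> ell_kernel t s"
      unfolding ell_kernel_def by (simp only: exp_le_cancel_iff)
    moreover have "exp (- ln (3 * \<epsilon>) / 2) = 1 / sqrt (3 * \<epsilon>)"
      using e0 by (simp add: ln_sqrt[symmetric] exp_minus inverse_eq_divide)
    ultimately show ?thesis unfolding c1_def exp_add by simp
  qed
  have "c1 / (3 * sqrt (3 * \<epsilon>)) = (LBINT s. indicator {0..\<epsilon>} s * (1 / (3 * \<epsilon>) * (c1 / sqrt (3 * \<epsilon>))))"
    using e0 by simp
  also have "\<dots> \<le> kint1 t i"
    unfolding kint1_def
  proof (rule integral_mono[OF _ integrable_kint1[OF n t]])
    show "integrable lborel (\<lambda>s. indicator {0..\<epsilon>} s * (1 / (3 * \<epsilon>) * (c1 / sqrt (3 * \<epsilon>))))"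
      using e0 by (intro integrable_mult_left) simp
    fix s :: real
    show "indicator {0..\<epsilon>} s * (1 / (3 * \<epsilon>) * (c1 / sqrt (3 * \<epsilon>))) \<le> indicator {0..} s * (1 / (t i + s) * ell_kernel t s)"
    proof (cases "0 \<le> s \<and> s \<le> \<epsilon>")
      case True
      have "1 / (3 * \<epsilon>) * (c1 / sqrt (3 * \<epsilon>)) \<le> 1 / (t i + s) * ell_kernel t s"
        using True e0 \<epsilon>(1) by (intro mult_mono K frac_le) (auto simp: c1_def)
      then show ?thesis using True by simp
    next
      case False
      then show ?thesis using t[of i] by (auto simp: indicator_def add_pos_nonneg less_imp_le)
    qed
  qed
  finally show ?thesis unfolding c1_def .
qed

text \<open>Stationarity of \<open>H\<close> in the i-th variable reads kint1 t i = 2 q i.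
  \<open>H\<close> is minimised over a box whose faces are ruled out by the linear term for large
  t_i and by the growth of \<open>kint1\<close> for small t_i.\<close>

lemma exists_kint1:
  fixes q :: "'n::finite \<Rightarrow> real"
  assumes n: "CARD('n) \<ge> 3" and q: "\<And>i. q i > 0"
  obtains t where "\<And>i. t i > 0" "\<And>i. kint1 t i = 2 * q i"
proof -
  define H where "H t = kint t + (\<Sum>i\<in>UNIV. q i * t i)" for t
  obtain q0 where q0: "q0 > 0" "\<And>i. q0 \<le> q i" using pos_lower_bound[of q] q by blast
  define g where "g = H (\<lambda>_. 1)"
  have g: "g \<ge> 0" unfolding g_def H_def using kint_nonneg q by (intro add_nonneg_nonneg sum_nonneg) (auto simp: less_imp_le)
  \<comment> \<open>Then q_i M exceeds the value g of \<open>H\<close> at (1,...,1), so a minimiser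
    has no coordinate equal to M.\<close>
  define M where "M = g / q0 + 1"
  have M: "M \<ge> 1" using g q0 by (simp add: M_def)
  have qM: "q i * M > g" for i
  proof -
    have "g < q0 * M" using q0 by (simp add: M_def field_simps)
    also have "\<dots> \<le> q i * M" using q0 M by (intro mult_right_mono) auto
    finally show ?thesis .
  qed
  define Q where "Q = (\<Sum>i\<in>UNIV. q i)"
  have Q: "q i \<le> Q" for i unfolding Q_def by (rule member_le_sum) (auto simp: q less_imp_le)
  have Qpos: "Q > 0" using Q q less_le_trans by blast
  define c1 where "c1 = exp (- (real CARD('n) * ln (M + 1)) / 2)"
  have c1: "c1 > 0" by (simp add: c1_def)
  \<comment> \<open>The second entry solves 4 Q <= c1 / (3 sqrt(3 epsilon)), to be used with
    \<open>kint1_lower_bound\<close>; the first keeps (1,...,1) and the trial value 2 epsilon in the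
    box.\<close>
  define \<epsilon> where "\<epsilon> = min (1 / 2) ((c1 / (12 * Q))\<^sup>2 / 3)"
  have \<epsilon>: "\<epsilon> > 0" "\<epsilon> \<le> 1 / 2" "3 * \<epsilon> \<le> (c1 / (12 * Q))\<^sup>2" using c1 Qpos by (auto simp: \<epsilon>_def)
  have "sqrt (3 * \<epsilon>) \<le> c1 / (12 * Q)"
    using \<epsilon>(3) c1 Qpos by (intro real_le_lsqrt) auto
  then have eps: "4 * Q \<le> c1 / (3 * sqrt (3 * \<epsilon>))"
    using \<epsilon>(1) c1 Qpos by (simp add: field_simps)
  define box where "box = cbox (\<chi> i::'n. \<epsilon>) (\<chi> i. M)"
  have box: "\<tau> \<in> box \<longleftrightarrow> (\<forall>i. \<epsilon> \<le> \<tau> $ i \<and> \<tau> $ i \<le> M)" for \<tau> by (simp add: box_def mem_box_cart)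
  have "continuous_on box (\<lambda>\<tau>. H (($) \<tau>))"
    unfolding continuous_on_sequentially
  proof (intro allI ballI impI)
    fix X a assume a: "a \<in> box" and X: "(\<forall>k. X k \<in> box) \<and> X \<longlonglongrightarrow> a"
    have l: "(\<lambda>k. X k $ i) \<longlonglongrightarrow> a $ i" for i using X by (intro tendsto_vec_nth) auto
    have "(\<lambda>k. kint (($) (X k))) \<longlonglongrightarrow> kint (($) a)"
      by (rule kint_tendsto[OF n \<epsilon>(1)]) (use X a l in \<open>auto simp: box\<close>)
    then have "(\<lambda>k. H (($) (X k))) \<longlonglongrightarrow> H (($) a)"
      unfolding H_def by (intro tendsto_add tendsto_sum tendsto_mult tendsto_const l)
    then show "((\<lambda>\<tau>. H (($) \<tau>)) \<circ> X) \<longlonglongrightarrow> H (($) a)" by (simp add: o_def)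
  qed
  moreover have "compact box" by (simp add: box_def)
  moreover have one: "(\<chi> i. 1) \<in> box" using M \<epsilon> by (simp add: box)
  ultimately obtain \<tau> where \<tau>: "\<tau> \<in> box" "\<And>\<sigma>. \<sigma> \<in> box \<Longrightarrow> H (($) \<tau>) \<le> H (($) \<sigma>)"
    using continuous_attains_inf[of box "\<lambda>\<tau>. H (($) \<tau>)"] by blast
  define t where "t = ($) \<tau>"
  have tb: "\<epsilon> \<le> t i" "t i \<le> M" for i using \<tau>(1) by (auto simp: box t_def)
  have tpos: "t i > 0" for i using tb(1)[of i] \<epsilon>(1) by simp
  have min: "H t \<le> H (t(i := a))" if "\<epsilon> \<le> a" "a \<le> M" for i a
  proof -
    have "(\<chi> j. (t(i := a)) j) \<in> box" using that tb by (simp add: box)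
    moreover have "($) (\<chi> j. (t(i := a)) j) = t(i := a)" by (rule ext) (simp only: vec_lambda_beta)
    ultimately show ?thesis using \<tau>(2)[of "\<chi> j. (t(i := a)) j"] unfolding t_def by simp
  qed
  have tM: "t i < M" for i
  proof (rule ccontr)
    assume "\<not> t i < M"
    then have ti: "t i = M" using tb(2)[of i] by simp
    have "($) (\<chi> i::'n. 1) = (\<lambda>_. 1 :: real)" by (rule ext) simp
    then have "H t \<le> g" using \<tau>(2)[OF one] by (simp only: t_def g_def)
    moreover have "q i * t i \<le> (\<Sum>i\<in>UNIV. q i * t i)"
      by (rule member_le_sum) (auto simp: q tpos less_imp_le)
    ultimately have "q i * M \<le> g" using kint_nonneg[of t] ti by (simp add: H_def)
    with qM[of i] show False by simp
  qed
  \<comment> \<open>Minimality and the tangent inequality give a variational inequality with the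
    slope at the displaced point.\<close>
  have step: "0 \<le> (a - t i) * (q i - kint1 (t(i := a)) i / 2)" if "\<epsilon> \<le> a" "a \<le> M" for i a
  proof -
    have "(\<Sum>j\<in>UNIV. q j * (t(i := a)) j) = q i * a + (\<Sum>j\<in>UNIV - {i}. q j * t j)"
      by (subst sum.remove[of _ i]) auto
    moreover have "(\<Sum>j\<in>UNIV. q j * t j) = q i * t i + (\<Sum>j\<in>UNIV - {i}. q j * t j)"
      by (subst sum.remove[of _ i]) auto
    ultimately have "H (t(i := a)) - H t = kint (t(i := a)) - kint t + q i * (a - t i)"
      by (simp add: H_def algebra_simps)
    also have "\<dots> \<le> - (a - t i) / 2 * kint1 (t(i := a)) i + q i * (a - t i)"
      using kint_tangent[where t=t and a=a and i=i, OF n tpos] that(1) \<epsilon>(1) by simp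
    also have "- (a - t i) / 2 * kint1 (t(i := a)) i + q i * (a - t i) = (a - t i) * (q i - kint1 (t(i := a)) i / 2)"
      by (simp add: field_simps)
    finally show ?thesis using min[OF that, of i] by linarith
  qed
  \<comment> \<open>The displaced coordinate is 2 epsilon: there the variational inequality gives
    \<open>kint1\<close> at most 2 q_i, while the lower bound gives at least 4 Q.\<close>
  have te: "t i > \<epsilon>" for i
  proof (rule ccontr)
    assume "\<not> t i > \<epsilon>"
    then have ti: "t i = \<epsilon>" using tb(1)[of i] by simp
    have M2: "2 * \<epsilon> \<le> M" using M \<epsilon>(2) by simp
    then have "0 \<le> \<epsilon> * (q i - kint1 (t(i := 2 * \<epsilon>)) i / 2)" using step[of "2 * \<epsilon>" i] \<epsilon>(1) ti by simp
    then have "kint1 (t(i := 2 * \<epsilon>)) i \<le> 2 * q i" using \<epsilon>(1) by (simp add: zero_le_mult_iff)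
    moreover have "c1 / (3 * sqrt (3 * \<epsilon>)) \<le> kint1 (t(i := 2 * \<epsilon>)) i"
      unfolding c1_def
      by (rule kint1_lower_bound[OF n]) (use tpos tb M M2 \<epsilon> in auto)
    ultimately show False using eps Q[of i] q[of i] by linarith
  qed
  have eq: "kint1 t i = 2 * q i" for i
  proof -
    \<comment> \<open>Room to displace t_i to both sides within the box. As the displacement
      shrinks, continuity of \<open>kint1\<close> turns the two one-sided inequalities into an
      equality.\<close>
    define \<delta> where "\<delta> = min (M - t i) (t i - \<epsilon>)"
    have \<delta>: "\<delta> > 0" "\<delta> \<le> M - t i" "\<delta> \<le> t i - \<epsilon>" using tM[of i] te[of i] by (auto simp: \<delta>_def)
    let ?d = "\<lambda>k. \<delta> * inverse (real (Suc k))"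
    have d: "0 < ?d k" "?d k \<le> \<delta>" for k using \<delta>(1) by (auto simp: field_simps)
    have dl: "?d \<longlonglongrightarrow> 0" by (rule tendsto_mult_right_zero[OF LIMSEQ_inverse_real_of_nat])
    have lim: "(\<lambda>k. kint1 (t(i := t i + \<sigma> * ?d k)) i) \<longlonglongrightarrow> kint1 t i" if "\<bar>\<sigma>\<bar> = 1" for \<sigma>
    proof (rule kint1_tendsto[OF n \<epsilon>(1)])
      show "\<epsilon> \<le> (t(i := t i + \<sigma> * ?d k)) j" for k j
      proof -
        have "\<bar>\<sigma> * ?d k\<bar> \<le> \<delta>" using that d[of k] by (simp add: abs_mult)
        then have "t i + \<sigma> * ?d k \<ge> \<epsilon>" using \<delta>(3) by linarith
        then show ?thesis using tb(1)[of j] by simp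
      qed
      show "\<epsilon> \<le> t j" for j by (rule tb(1))
      have "(\<lambda>k. t i + \<sigma> * ?d k) \<longlonglongrightarrow> t i + \<sigma> * 0" by (intro tendsto_add tendsto_mult tendsto_const dl)
      then show "(\<lambda>k. (t(i := t i + \<sigma> * ?d k)) j) \<longlonglongrightarrow> t j" for j by (cases "j = i") auto
    qed
    have sgn: "0 \<le> \<sigma> * (q i - kint1 (t(i := t i + \<sigma> * ?d k)) i / 2)" if "\<bar>\<sigma>\<bar> = 1" for \<sigma> k
    proof -
      have "\<bar>\<sigma> * ?d k\<bar> \<le> \<delta>" using that d[of k] by (simp add: abs_mult)
      then have "\<epsilon> \<le> t i + \<sigma> * ?d k" "t i + \<sigma> * ?d k \<le> M" using \<delta> by linarith+
      then have "0 \<le> (t i + \<sigma> * ?d k - t i) * (q i - kint1 (t(i := t i + \<sigma> * ?d k)) i / 2)" by (rule step)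
      then have "0 \<le> ?d k * (\<sigma> * (q i - kint1 (t(i := t i + \<sigma> * ?d k)) i / 2))"
        by (simp only: add_diff_cancel_left' mult_ac)
      then show ?thesis by (metis d(1) mult_pos_neg not_le)
    qed
    have "kint1 (t(i := t i + 1 * ?d k)) i \<le> 2 * q i" for k
      using sgn[of 1 k] unfolding mult_1 by linarith
    then have le: "kint1 t i \<le> 2 * q i"
      by (intro LIMSEQ_le_const2[OF lim[of 1]]) auto
    have "kint1 (t(i := t i + - 1 * ?d k)) i \<ge> 2 * q i" for k
    proof -
      define X where "X = kint1 (t(i := t i + - 1 * ?d k)) i"
      have "0 \<le> - 1 * (q i - X / 2)" unfolding X_def by (rule sgn) simp
      then have "2 * q i \<le> X" by simp
      then show ?thesis unfolding X_def .
    qed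
    then have "kint1 t i \<ge> 2 * q i"
      by (intro LIMSEQ_le_const[OF lim[of "- 1"]]) auto
    with le show ?thesis by simp
  qed
  show thesis using that[of t] tpos eq by blast
qed

text \<open>The normalisation of p is the one forced by \<open>sum_kint1\<close>; it makes the
  kernel of the stationary point equal to 1/2 at 0. Scaling all t_i by rho leaves the first
  quotients unchanged and multiplies the last one by rho, so m can be prescribed separately.\<close>

lemma exists_ellipsoid_parameters:
  fixes p :: "'n::finite \<Rightarrow> real"
  assumes n: "CARD('n) \<ge> 3" and p: "\<And>i. p i > 0" "(\<Sum>i\<in>UNIV. p i) = 1 / 2" and m: "m > 0"
  obtains t where "\<And>i. t i > 0" "\<And>i. kint1 t i / (4 * ell_kernel t 0) = p i" "kint t / (4 * ell_kernel t 0) = m"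
proof -
  obtain t where t: "\<And>i. t i > 0" "\<And>i. kint1 t i = 2 * p i" 
    by (rule exists_kint1[where q=p, OF n p(1)]) blast
  have K0: "ell_kernel t 0 = 1 / 2"
  proof -
    have "(\<Sum>i\<in>UNIV. kint1 t i) = 2 * (\<Sum>i\<in>UNIV. p i)" unfolding t(2) by (rule sum_distrib_left[symmetric])
    then show ?thesis using sum_kint1[where t=t, OF n t(1)] p(2) by linarith
  qed
  have kpos: "kint t > 0"
  proof -
    have "0 < t undefined * kint1 t undefined" using t p(1) by simp
    then show ?thesis using kint1_le_kint[where t=t, OF n t(1), of undefined] by linarith
  qed
  \<comment> \<open>Four times the kernel at 0 is 2, so kint t / 2 is the offset before
    scaling.\<close>
  define \<rho> where "\<rho> = m / (kint t / 2)"
  have \<rho>: "\<rho> > 0" using m kpos by (simp add: \<rho>_def)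
  define \<kappa> where "\<kappa> = exp (- (real CARD('n) * ln \<rho>) / 2)"
  define r where "r i = \<rho> * t i" for i
  have ker: "ell_kernel r (\<rho> * s) = \<kappa> * ell_kernel t s" if "s \<ge> 0" for s
  proof -
    have l: "ln (r i + \<rho> * s) = ln \<rho> + ln (t i + s)" for i
    proof -
      have "r i + \<rho> * s = \<rho> * (t i + s)" by (simp add: r_def algebra_simps)
      moreover have "t i + s > 0" using t(1)[of i] that by simp
      ultimately show ?thesis using \<rho> by (simp add: ln_mult)
    qed
    have "(\<Sum>i\<in>UNIV. ln (r i + \<rho> * s)) = real CARD('n) * ln \<rho> + (\<Sum>i\<in>UNIV. ln (t i + s))"
      unfolding l sum.distrib by simp
    then have "- (\<Sum>i\<in>UNIV. ln (r i + \<rho> * s)) / 2 = - (real CARD('n) * ln \<rho>) / 2 + - (\<Sum>i\<in>UNIV. ln (t i + s)) / 2"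
      by linarith
    then show ?thesis unfolding ell_kernel_def \<kappa>_def by (simp only: exp_add)
  qed
  have aff: "(LBINT s. f s) = \<rho> * (LBINT s. f (\<rho> * s))" for f :: "real \<Rightarrow> real"
    using lborel_integral_real_affine[of \<rho> f 0] \<rho> by simp
  have ind: "indicator {0..} (\<rho> * s) = (indicator {0..} s :: real)" for s
    using \<rho> by (simp add: indicator_def zero_le_mult_iff)
  have "indicator {0..} (\<rho> * s) * ell_kernel r (\<rho> * s) = \<kappa> * (indicator {0..} s * ell_kernel t s)" for s :: real
    by (cases "s \<ge> 0") (simp_all add: ind ker)
  then have "kint r = \<rho> * (LBINT s. \<kappa> * (indicator {0..} s * ell_kernel t s))"
    unfolding kint_def aff[of "\<lambda>s. indicator {0..} s * ell_kernel r s"] by (simp only:)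
  then have k: "kint r = \<rho> * \<kappa> * kint t" by (simp add: kint_def)
  have "kint1 r i = \<rho> * (LBINT s. \<kappa> / \<rho> * (indicator {0..} s * (1 / (t i + s) * ell_kernel t s)))" for i
  proof -
    have "indicator {0..} (\<rho> * s) * (1 / (r i + \<rho> * s) * ell_kernel r (\<rho> * s)) =
       \<kappa> / \<rho> * (indicator {0..} s * (1 / (t i + s) * ell_kernel t s))" for s :: real
    proof (cases "s \<ge> 0")
      case True
      have "r i + \<rho> * s = \<rho> * (t i + s)" by (simp add: r_def algebra_simps)
      then show ?thesis using True by (simp add: ind ker)
    qed (simp add: ind)
    then show ?thesis 
      unfolding kint1_def aff[of "\<lambda>s. indicator {0..} s * (1 / (r i + s) * ell_kernel r s)"] by (simp only:)
  qed
  then have "kint1 r i = \<rho> * (\<kappa> / \<rho> * kint1 t i)" for i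
    by (simp only: integral_mult_right_zero kint1_def[of t])
  then have k1: "kint1 r i = \<kappa> * kint1 t i" for i using \<rho> by simp
  have k0: "ell_kernel r 0 = \<kappa> / 2" using ker[of 0] K0 by simp
  have \<kappa>: "\<kappa> > 0" by (simp add: \<kappa>_def)
  show thesis
  proof (rule that[of r])
    show "r i > 0" for i using \<rho> t(1) by (simp add: r_def)
    show "kint1 r i / (4 * ell_kernel r 0) = p i" for i using \<kappa> t(2) by (simp add: k1 k0)
    show "kint r / (4 * ell_kernel r 0) = m" using \<kappa> kpos by (simp add: k k0 \<rho>_def)
  qed
qed

section \<open>Conclusion\<close>

lemma bavg_linear_bound:
  fixes u w :: "real^'n \<Rightarrow> real"
  assumes u: "continuous_on UNIV u" and w: "continuous_on UNIV w" and r: "r > 0"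
    and B: "\<And>x. \<bar>u x - \<theta> * w x\<bar> \<le> B"
  shows "\<bar>bavg k u r c - \<theta> * bavg k w r c\<bar> \<le> B * bmass TYPE('n) k"
proof -
  have int: "integrable lborel (\<lambda>y. v y * bump k c r y)" if "continuous_on UNIV v" for v
    by (rule integrable_continuous_cball[of _ c r], intro continuous_on_mult that continuous_on_bump)
      (simp add: bump_eq_0[OF r] del: mem_cball)
  have "bavg k u r c - \<theta> * bavg k w r c = (LBINT y. u y * bump k c r y - \<theta> * (w y * bump k c r y)) / r ^ CARD('n)"
    using int[OF u] int[OF w] by (simp add: bavg_def diff_divide_distrib)
  also have "\<bar>\<dots>\<bar> = \<bar>\<integral>y. u y * bump k c r y - \<theta> * (w y * bump k c r y) \<partial>lborel\<bar> / r ^ CARD('n)"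
    using r by (simp add: abs_div)
  also have "\<dots> \<le> (LBINT y. B * bump k c r y) / r ^ CARD('n)"
  proof (rule divide_right_mono[OF integral_abs_bound_integral])
    show "integrable lborel (\<lambda>y. u y * bump k c r y - \<theta> * (w y * bump k c r y))"
      using int[OF u] int[OF w] by simp
    show "integrable lborel (\<lambda>y. B * bump k c r y)" by (intro integrable_mult_right integrable_bump r)
    show "\<bar>u x * bump k c r x - \<theta> * (w x * bump k c r x)\<bar> \<le> B * bump k c r x" for x
    proof -
      have "u x * bump k c r x - \<theta> * (w x * bump k c r x) = (u x - \<theta> * w x) * bump k c r x"
        by (simp add: algebra_simps)
      then show ?thesis using mult_right_mono[OF B[of x] bump_nonneg[of k c r x]] by (simp add: abs_mult)
    qed
  qed (use r in simp)
  also have "\<dots> = B * bmass TYPE('n) k" using bavg_const[OF r, of k B c] by (simp add: bavg_def)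
  finally show ?thesis .
qed

text \<open>Both deficits are bounded, so the averages of u and w about 0 are \<open>bmass 0\<close>
  r^2 / 4 up to bounded terms. Boundedness of u - theta w then bounds (1 - theta) r^2 for all
  r.\<close>

lemma obst_proportional_growth:
  fixes u w :: "real^'n \<Rightarrow> real"
  assumes n: "CARD('n) \<ge> 3" and u: "obst u" "bounded {x. u x = 0}" and w: "obst w" "bounded {x. w x = 0}"
    and B: "\<And>x. \<bar>u x - \<theta> * w x\<bar> \<le> B"
  shows "\<theta> = 1"
proof (rule ccontr)
  assume ne: "\<theta> \<noteq> 1"
  let ?m = "bmass TYPE('n) 2" and ?k = "bmass TYPE('n) 0"
  obtain Ku where Ku: "\<And>r c. r > 0 \<Longrightarrow> deficit u r c \<le> Ku"
    using pot_bounded[OF u(1) n u(2)] by metis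
  obtain Kw where Kw: "\<And>r c. r > 0 \<Longrightarrow> deficit w r c \<le> Kw"
    using pot_bounded[OF w(1) n w(2)] by metis
  define C where "C = B * ?m + \<bar>?m * u 0\<bar> + \<bar>\<theta>\<bar> * \<bar>?m * w 0\<bar> + Ku + \<bar>\<theta>\<bar> * Kw"
  have bound: "\<bar>?k * r\<^sup>2 / 4 * (1 - \<theta>)\<bar> \<le> C" if r: "r > 0" for r
  proof -
    have "?k * r\<^sup>2 / 4 * (1 - \<theta>) = (bavg 2 u r 0 - \<theta> * bavg 2 w r 0) - ?m * u 0 + \<theta> * (?m * w 0)
       + deficit u r 0 - \<theta> * deficit w r 0"
      by (simp add: deficit_def field_simps)
    moreover have "\<bar>bavg 2 u r 0 - \<theta> * bavg 2 w r 0\<bar> \<le> B * ?m"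
      by (rule bavg_linear_bound[OF obst_continuous[OF u(1)] obst_continuous[OF w(1)] r B])
    moreover have "\<bar>\<theta> * (?m * w 0)\<bar> = \<bar>\<theta>\<bar> * \<bar>?m * w 0\<bar>" by (simp add: abs_mult)
    moreover have "\<bar>deficit u r 0\<bar> \<le> Ku" using Ku[OF r, of 0] deficit_nonneg[OF u(1) r, of 0] by simp
    moreover have "\<bar>\<theta> * deficit w r 0\<bar> \<le> \<bar>\<theta>\<bar> * Kw"
      using mult_left_mono[OF Kw[OF r, of 0], of "\<bar>\<theta>\<bar>"] deficit_nonneg[OF w(1) r, of 0] by (simp add: abs_mult)
    ultimately show ?thesis unfolding C_def by linarith
  qed
  have kpos: "?k > 0" by (rule bmass_pos)
  define a where "a = ?k / 4 * \<bar>1 - \<theta>\<bar>"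
  have a: "a > 0" using kpos ne by (simp add: a_def)
  define r where "r = max 1 ((C + 1) / a)"
  have r: "r \<ge> 1" "(C + 1) / a \<le> r" by (auto simp: r_def)
  have "C + 1 \<le> a * r" using r(2) a by (simp add: field_simps)
  also have "\<dots> \<le> a * r\<^sup>2" using r(1) a by (simp add: power2_eq_square)
  also have "\<dots> = \<bar>?k * r\<^sup>2 / 4 * (1 - \<theta>)\<bar>" using kpos by (simp add: a_def abs_mult)
  also have "\<dots> \<le> C" using r(1) by (intro bound) simp
  finally show False by simp
qed

text \<open>Continuity fixes the representative of the Sobolev function for which the zero set and
  its interior make sense. The translation appears because \<open>ellipsoid\<close> describes
  ellipsoids centred at the origin.\<close>

theorem mainTheorem1:
  fixes u :: "real^'n \<Rightarrow> real"
  assumes "CARD('n) \<ge> 3"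
    and "continuous_on UNIV u"
    and "\<forall>x. u x \<ge> 0"
    and "weak_obstacle_solution u"
    and "bounded {x. u x = 0}"
    and "interior {x. u x = 0} \<noteq> {}"
  shows "\<exists>c. ellipsoid ((\<lambda>x. x - c) ` {x. u x = 0})"
proof -
  note n = assms(1) and b = assms(5) and i = assms(6)
  have u: "obst u" by (rule weak_obstacle_solution_imp_obst[OF assms(2-4)])
  obtain e :: "'n \<Rightarrow> real^'n" and p c m where on: "\<And>i j. e i \<bullet> e j = (if i = j then 1 else 0)"
    and p: "\<And>i. p i > 0" and m: "m > 0"
    and form: "\<And>x. u x = (\<Sum>i\<in>UNIV. p i * (e i \<bullet> (x - c))\<^sup>2) - m + pot u x"
    by (rule obst_normal_form[OF u n b i]) blast
  \<comment> \<open>The Laplacian of the quadratic part of u. It is not yet known to be 1, so the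
    ellipsoid is fitted to p_i / theta, with the same offset m.\<close>
  define \<theta> where "\<theta> = 2 * (\<Sum>i\<in>UNIV. p i)"
  have "(\<Sum>i\<in>UNIV. p i) > 0" using p by (intro sum_pos) auto
  then have \<theta>: "\<theta> > 0" by (simp add: \<theta>_def)
  have "(\<Sum>i\<in>UNIV. p i / \<theta>) = 1 / 2" using \<theta> by (simp add: \<theta>_def flip: sum_divide_distrib)
  moreover have "p i / \<theta> > 0" for i using p \<theta> by simp
  ultimately obtain t where t: "\<And>i. t i > 0" "\<And>i. kint1 t i / (4 * ell_kernel t 0) = p i / \<theta>"
    "kint t / (4 * ell_kernel t 0) = m"
    using exists_ellipsoid_parameters[OF n _ _ m, where p="\<lambda>i. p i / \<theta>"] by metis
  interpret E: ellipsoid_data e t c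
    by unfold_locales (use on t(1) n in auto)
  have coef: "E.coef i = p i / \<theta>" for i using t(2) by (simp add: E.coef_def kint1_def)
  have offset: "E.offset = m" using t(3) by (simp add: E.offset_def kint_def)
  obtain K where K: "\<And>x. pot u x \<le> K" using pot_bounded[OF u n b] by metis
  have pot: "pot u x > 0" for x by (rule pot_pos[OF u n b i])
  \<comment> \<open>The quadratic terms cancel; what remains are constants and the two bounded
    potentials.\<close>
  have "\<bar>u x - \<theta> * E.w x\<bar> \<le> m + K + \<theta> * m" for x
  proof -
    define S where "S = (\<Sum>i\<in>UNIV. p i * (e i \<bullet> (x - c))\<^sup>2)"
    define D where "D = E.w x - (S / \<theta> - m)"
    have "(\<Sum>i\<in>UNIV. E.coef i * (e i \<bullet> (x - c))\<^sup>2) = S / \<theta>"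
      by (simp add: coef S_def sum_divide_distrib)
    then have D: "0 \<le> D" "D \<le> m"
      using E.w_minus_quadratic_bounds[of x] by (simp_all add: offset D_def)
    have "\<theta> * E.w x = S + \<theta> * (D - m)" using \<theta> by (simp add: D_def algebra_simps)
    then have "u x - \<theta> * E.w x = - m + pot u x + \<theta> * (m - D)"
      using form[of x] by (simp add: S_def algebra_simps)
    moreover have "0 \<le> \<theta> * (m - D)" "\<theta> * (m - D) \<le> \<theta> * m" using \<theta> D by auto
    ultimately show ?thesis using K[of x] pot[of x] m by linarith
  qed
  then have "\<theta> = 1"
    by (rule obst_proportional_growth[OF n u b E.obst_w E.bounded_w_zero])
  define q where "q x = (\<Sum>i\<in>UNIV. p i * (e i \<bullet> (x - c))\<^sup>2) - m" for x
  have wq: "(\<Sum>i\<in>UNIV. E.coef i * (e i \<bullet> (x - c))\<^sup>2) - E.offset = q x" for x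
    by (simp add: coef offset \<open>\<theta> = 1\<close> q_def)
  have uq: "u x = q x + pot u x" for x using form[of x] by (simp add: q_def)
  have wge: "E.w x \<ge> q x" for x using E.w_minus_quadratic_bounds(1)[of x] unfolding wq by simp
  have "u x \<le> E.w x" for x
  proof (rule obst_comparison[OF u E.obst_w])
    fix \<delta> :: real assume "\<delta> > 0"
    then obtain R where R: "\<And>x. norm x \<ge> R \<Longrightarrow> pot u x < \<delta>"
      using pot_vanishes_at_infinity[OF u n b] by blast
    have "u x - E.w x < \<delta>" if "norm x \<ge> R" for x
      using R[OF that] wge[of x] uq[of x] by linarith
    then show "\<exists>R. \<forall>x. norm x \<ge> R \<longrightarrow> u x - E.w x < \<delta>" by blast
  qed
  moreover have "E.w x \<le> u x" for x
  proof (rule obst_comparison[OF E.obst_w u])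
    fix \<delta> :: real assume "\<delta> > 0"
    then obtain R where R: "\<And>x. norm x \<ge> R \<Longrightarrow> E.w x - q x < \<delta>"
      using E.w_asymptotic unfolding wq by blast
    have "E.w x - u x < \<delta>" if "norm x \<ge> R" for x
      using R[OF that] pot[of x] uq[of x] by linarith
    then show "\<exists>R. \<forall>x. norm x \<ge> R \<longrightarrow> E.w x - u x < \<delta>" by blast
  qed
  ultimately have "u = E.w" by (intro ext antisym)
  then show ?thesis using E.ellipsoid_w_zero by blast
qed

end
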